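(* Let $f,g\colon(\mathbb{R}^2,0)\to(\mathbb{R},0)$ be nonzero real analytic function germs, both regular in $x$, such that $0\in\{f=0\}\subset\{g=0\}$ (as germs at the origin). Let $\beta_1,\dots,\beta_k$ be the common real Newton--Puiseux roots of $f$ and $g$, and let $m_j$, $n_j$ be the multiplicities of $\beta_j$ as a root of $f$ and of $g$ respectively. Define $$\mathscr{L}^+_g(f):=\max\left\{\ell(\gamma),\ \frac{m_j}{n_j}\ \Big|\ \gamma\in\mathcal V_{\mathbb R}(f),\ j=1,\dots,k\right\},\qquad \mathscr{L}^-_g(f):=\mathscr{L}^+_{\bar g}(\bar f),$$ where $\bar f(x,y):=f(x,-y)$ and $\bar g(x,y):=g(x,-y)$. Then $$\mathscr{L}_g(f)=\max\{\mathscr{L}^+_g(f),\ \mathscr{L}^-_g(f)\}.$$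
   Context: A germ $f(x,y)=f_m(x,y)+f_{m+1}(x,y)+\cdots$ (with $f_k$ homogeneous of degree $k$, $f_m\not\equiv0$) is regular in $x$ if $f_m(1,0)\neq0$. The Łojasiewicz exponent $\mathscr{L}_g(f)$ of $f$ with respect to $g$ is the infimum of all $\alpha>0$ for which there exist $C,r>0$ with $|f(x,y)|\ge C|g(x,y)|^\alpha$ for $|(x,y)|\le r$. A Puiseux series is an element $\phi(y)=\sum_i a_i y^{\alpha_i}\in\mathbb{C}\{y^{1/N}\}$ (some $N\ge1$, positive rational exponents $\alpha_1<\alpha_2<\cdots$); it is real if all coefficients are real. A Newton--Puiseux root of $f$ is a Puiseux series $\phi$ with $f(\phi(y),y)\equiv0$; its multiplicity is the largest $m$ with $f(x,y)=(x-\phi(y))^m h(x,y)$, $h(\phi(y),y)\not\equiv0$. For a Puiseux series $\phi(y)=\sum_i a_iy^{\alpha_i}$ and $\rho>0$, the $\rho$-approximation of $\phi$ is $\sum_{\alpha_i<\rho}a_iy^{\alpha_i}+cy^\rho$ with $c$ a generic real number. The real approximation of $\phi$ is its $\rho$-approximation where $\rho$ is the smallest exponent of $\phi$ with non-real coefficient. $\mathcal V_{\mathbb R}(f)$ is the set of real approximations of all non-real Newton--Puiseux roots of $f$. For a Puiseux series $\phi$ (evaluated at real $y>0$) with $g(\phi(y),y)\not\equiv0$, $\ell(\phi):=\dfrac{\mathrm{ord}_y f(\phi(y),y)}{\mathrm{ord}_y g(\phi(y),y)}$. *)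

theory Defs
  imports "HOL-Analysis.Analysis"
begin

(* A real analytic germ at 0 in R^2 is represented by its (unique) Taylor coefficient
   array  a i j  (coefficient of x^i y^j), required to converge on some polydisc. *)

definition conv2 :: "(nat \<Rightarrow> nat \<Rightarrow> 'a::real_normed_field) \<Rightarrow> bool" where
  "conv2 a \<longleftrightarrow> (\<exists>r>0. (\<lambda>(i,j). norm (a i j) * r ^ (i + j)) summable_on UNIV)"

definition ev2 :: "(nat \<Rightarrow> nat \<Rightarrow> real) \<Rightarrow> 'a::{real_normed_field,banach} \<Rightarrow> 'a \<Rightarrow> 'a" where
  "ev2 a x y = (\<Sum>\<^sub>\<infinity>(i,j)\<in>UNIV. of_real (a i j) * x ^ i * y ^ j)"

definition cev2 :: "(nat \<Rightarrow> nat \<Rightarrow> complex) \<Rightarrow> complex \<Rightarrow> complex \<Rightarrow> complex" where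
  "cev2 h x t = (\<Sum>\<^sub>\<infinity>(i,j)\<in>UNIV. h i j * x ^ i * t ^ j)"

(* f regular in x: the lowest-degree homogeneous part f_m satisfies f_m(1,0) \<noteq> 0 *)
definition regular_x :: "(nat \<Rightarrow> nat \<Rightarrow> real) \<Rightarrow> bool" where
  "regular_x a \<longleftrightarrow> (\<exists>m. a m 0 \<noteq> 0 \<and> (\<forall>i j. i + j < m \<longrightarrow> a i j = 0))"

definition flipy :: "(nat \<Rightarrow> nat \<Rightarrow> real) \<Rightarrow> nat \<Rightarrow> nat \<Rightarrow> real" where
  "flipy a i j = (-1) ^ j * a i j"

(* Puiseux series: phi q = coefficient of y^q (q rational); the support lies in (1/N) Z_{>0}
   and the series converges as a power series in y^(1/N). *)
definition puis_supp :: "(rat \<Rightarrow> complex) \<Rightarrow> nat \<Rightarrow> bool" where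
  "puis_supp \<phi> N \<longleftrightarrow> (\<forall>q. \<phi> q \<noteq> 0 \<longrightarrow> q > 0 \<and> (\<exists>k::nat. q = of_nat k / of_nat N))"

definition puis_conv :: "(rat \<Rightarrow> complex) \<Rightarrow> nat \<Rightarrow> bool" where
  "puis_conv \<phi> N \<longleftrightarrow> (\<exists>r>0. summable (\<lambda>k. norm (\<phi> (of_nat k / of_nat N)) * r ^ k))"

definition is_puiseux :: "(rat \<Rightarrow> complex) \<Rightarrow> bool" where
  "is_puiseux \<phi> \<longleftrightarrow> (\<exists>N>0. puis_supp \<phi> N \<and> puis_conv \<phi> N)"

definition pden :: "(rat \<Rightarrow> complex) \<Rightarrow> nat" where
  "pden \<phi> = (SOME N. N > 0 \<and> puis_supp \<phi> N \<and> puis_conv \<phi> N)"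

definition pev :: "(rat \<Rightarrow> complex) \<Rightarrow> real \<Rightarrow> complex" where
  "pev \<phi> y = (\<Sum>k. \<phi> (of_nat k / of_nat (pden \<phi>)) * of_real (y powr (real k / real (pden \<phi>))))"

definition real_puiseux :: "(rat \<Rightarrow> complex) \<Rightarrow> bool" where
  "real_puiseux \<phi> \<longleftrightarrow> (\<forall>q. \<phi> q \<in> \<real>)"

definition np_root :: "(nat \<Rightarrow> nat \<Rightarrow> real) \<Rightarrow> (rat \<Rightarrow> complex) \<Rightarrow> bool" where
  "np_root a \<phi> \<longleftrightarrow> is_puiseux \<phi> \<and>
     (\<forall>\<^sub>F y in at_right 0. ev2 a (pev \<phi> y) (complex_of_real y) = 0)"

(* multiplicity: largest m with f(x,y) = (x - phi(y))^m h(x,y), h(phi(y),y) \<noteq> 0,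
   h convergent power series in x and t = y^(1/N) *)
definition np_mult :: "(nat \<Rightarrow> nat \<Rightarrow> real) \<Rightarrow> (rat \<Rightarrow> complex) \<Rightarrow> nat" where
  "np_mult a \<phi> = (GREATEST m. \<exists>N h. N > 0 \<and> puis_supp \<phi> N \<and> conv2 h \<and>
       (\<exists>\<epsilon>>0. \<forall>x t. norm x < \<epsilon> \<and> 0 < t \<and> t < \<epsilon> \<longrightarrow>
           ev2 a x (complex_of_real (t ^ N)) = (x - pev \<phi> (t ^ N)) ^ m * cev2 h x (complex_of_real t)) \<and>
       \<not> (\<forall>\<^sub>F t in at_right 0. cev2 h (pev \<phi> (t ^ N)) (complex_of_real t) = 0))"

(* order in y of a germ F on y > 0 (leading exponent of its Puiseux expansion) *)
definition ord0 :: "(real \<Rightarrow> complex) \<Rightarrow> real" where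
  "ord0 F = (THE q. \<exists>c. c \<noteq> 0 \<and> ((\<lambda>y. F y / complex_of_real (y powr q)) \<longlongrightarrow> c) (at_right 0))"

definition ell :: "(nat \<Rightarrow> nat \<Rightarrow> real) \<Rightarrow> (nat \<Rightarrow> nat \<Rightarrow> real) \<Rightarrow> (rat \<Rightarrow> complex) \<Rightarrow> real" where
  "ell a b \<phi> = ord0 (\<lambda>y. ev2 a (pev \<phi> y) (complex_of_real y)) /
               ord0 (\<lambda>y. ev2 b (pev \<phi> y) (complex_of_real y))"

definition rho_approx :: "(rat \<Rightarrow> complex) \<Rightarrow> rat \<Rightarrow> real \<Rightarrow> rat \<Rightarrow> complex" where
  "rho_approx \<phi> \<rho> c q = (if q < \<rho> then \<phi> q else if q = \<rho> then complex_of_real c else 0)"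

definition nonreal_exp :: "(rat \<Rightarrow> complex) \<Rightarrow> rat" where
  "nonreal_exp \<phi> = (LEAST q. \<phi> q \<notin> \<real>)"

definition real_approx :: "(rat \<Rightarrow> complex) \<Rightarrow> real \<Rightarrow> rat \<Rightarrow> complex" where
  "real_approx \<phi> c = rho_approx \<phi> (nonreal_exp \<phi>) c"

definition ell_generic :: "(nat \<Rightarrow> nat \<Rightarrow> real) \<Rightarrow> (nat \<Rightarrow> nat \<Rightarrow> real) \<Rightarrow> (rat \<Rightarrow> complex) \<Rightarrow> real" where
  "ell_generic a b \<phi> = (THE L. \<forall>\<^sub>F c in cofinite. ell a b (real_approx \<phi> c) = L)"

definition Lplus :: "(nat \<Rightarrow> nat \<Rightarrow> real) \<Rightarrow> (nat \<Rightarrow> nat \<Rightarrow> real) \<Rightarrow> real" where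
  "Lplus a b = Max ({ell_generic a b \<gamma> | \<gamma>. np_root a \<gamma> \<and> \<not> real_puiseux \<gamma>} \<union>
                    {real (np_mult a \<beta>) / real (np_mult b \<beta>) | \<beta>.
                        np_root a \<beta> \<and> np_root b \<beta> \<and> real_puiseux \<beta>})"

definition Lminus :: "(nat \<Rightarrow> nat \<Rightarrow> real) \<Rightarrow> (nat \<Rightarrow> nat \<Rightarrow> real) \<Rightarrow> real" where
  "Lminus a b = Lplus (flipy a) (flipy b)"

definition loj_exp :: "(real \<Rightarrow> real \<Rightarrow> real) \<Rightarrow> (real \<Rightarrow> real \<Rightarrow> real) \<Rightarrow> real" where
  "loj_exp f g = Inf {\<alpha>. \<alpha> > 0 \<and> (\<exists>C>0. \<exists>r>0. \<forall>x y. norm (x, y) \<le> r \<longrightarrow>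
                       \<bar>f x y\<bar> \<ge> C * \<bar>g x y\<bar> powr \<alpha>)}"

end

theory Submission
  imports Defs "HOL-Complex_Analysis.Complex_Analysis" "HOL-Computational_Algebra.Fundamental_Theorem_Algebra"
begin

text \<open>
  Puiseux's theorem is proved by induction on the order \<open>m\<close> in \<open>x\<close>: translate by a root of the
  \<open>x\<close>-derivative, so that the coefficient of \<open>x\<close> vanishes, and blow up by \<open>x = s^p z\<close>, \<open>t = s^q\<close>; the
  resulting polynomial of degree \<open>m\<close> in \<open>z\<close> then has no root of multiplicity \<open>m\<close>. Hence for \<open>y = t^N > 0\<close>
  both germs are units times products of differences \<open>x - \<phi>(t)\<close>.

  For real \<open>x\<close> let \<open>\<phi>\<close> be the root closest to \<open>x\<close>, at distance \<open>t^\<tau>\<close>. Every other root \<open>\<psi>\<close> is at distance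
  comparable to \<open>t\<close> to the power \<open>min \<tau> (ord (\<phi> - \<psi>))\<close>. Giving each root the weight (multiplicity in
  \<open>f\<close>) minus \<open>\<alpha>\<close> times (multiplicity in \<open>g\<close>), the inequality \<open>|f| \<ge> C |g|^\<alpha>\<close> says that the weighted sum of
  these exponents, a piecewise linear function on the tree of real truncations of the roots, is never
  positive. Along the tree this function can only stop growing at a real approximation of a non-real
  root of \<open>f\<close>, or grow for ever along a real root of \<open>f\<close>, and \<open>\<alpha> \<ge> L\<^sup>+\<close> excludes both.
  Conversely the real approximations are test arcs, and near a real root one fixes \<open>y\<close> and lets \<open>x\<close>
  tend to the root.
\<close>

text \<open>A germ in two variables is encoded as a bounded function holomorphic in each variable
  separately. Iterated divided differences in x yield its coefficients as holomorphic functions of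
  t, together with a geometric remainder; substitution, simple roots and double series all rest on
  this expansion. Killing the coefficient of x, rather than that of x^(m-1), is what lets the
  induction feed on itself: the translation is a root of the x-derivative, a germ of order m - 1.
  Roots are then split off one at a time by exact division by x. Both germs are brought to one
  ramified parameter t, whose integer exponents replace the rational exponents of y. Real
  approximations stop at the lowest non-real coefficient because a non-real root stays, for small t
  > 0, at distance at least a constant times t^\<rho> from the real axis, \<rho> being the index of
  that coefficient: a real x never sees the tree beyond that level.\<close>

abbreviation (input) cx :: "real \<Rightarrow> complex" where
  "cx \<equiv> complex_of_real"

section \<open>Bounded separately holomorphic germs\<close>

text \<open>The substitute for joint holomorphy on a bidisc. The bound \<open>M\<close> is an
  explicit parameter because the estimates below track how much each divided difference enlarges
  it.\<close>

definition bsep :: "real \<Rightarrow> real \<Rightarrow> (complex \<Rightarrow> complex \<Rightarrow> complex) \<Rightarrow> bool" where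
  "bsep r M F \<longleftrightarrow> (\<forall>t\<in>ball 0 r. (\<lambda>x. F x t) holomorphic_on ball 0 r) \<and>
     (\<forall>x\<in>ball 0 r. F x holomorphic_on ball 0 r) \<and>
     (\<forall>x\<in>ball 0 r. \<forall>t\<in>ball 0 r. norm (F x t) \<le> M)"

text \<open>The divided difference in the first variable, with its removable singularity filled in.
  The functions \<open>(dq ^^ i) F 0\<close> are the coefficients of \<open>x ^ i\<close> in the
  expansion of \<open>F\<close> in powers of \<open>x\<close>, as functions of
  \<open>t\<close>.\<close>

definition dq :: "(complex \<Rightarrow> complex \<Rightarrow> complex) \<Rightarrow> complex \<Rightarrow> complex \<Rightarrow> complex" where
  "dq F x t = (if x = 0 then deriv (\<lambda>x. F x t) 0 else (F x t - F 0 t) / x)"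

lemma bsepD:
  assumes "bsep r M F"
  shows "t \<in> ball 0 r \<Longrightarrow> (\<lambda>x. F x t) holomorphic_on ball 0 r"
    and "x \<in> ball 0 r \<Longrightarrow> F x holomorphic_on ball 0 r"
    and "x \<in> ball 0 r \<Longrightarrow> t \<in> ball 0 r \<Longrightarrow> norm (F x t) \<le> M"
  using assms by (auto simp: bsep_def)

lemma bsep_mono:
  assumes "bsep r M F" "r' \<le> r" "M \<le> M'"
  shows "bsep r' M' F"
proof -
  have s: "ball (0::complex) r' \<subseteq> ball 0 r" using assms by auto
  show ?thesis unfolding bsep_def
    using bsepD[OF assms(1)] s assms(3)
    by (meson holomorphic_on_subset order_trans subsetD)
qed

text \<open>For \<open>norm x \<ge> r/2\<close> the numerator is at most \<open>2 * M\<close> and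
  the denominator at least \<open>r/2\<close>; the maximum modulus principle carries the resulting
  bound into the smaller disc.\<close>

lemma dq_bound:
  fixes q :: "complex \<Rightarrow> complex"
  assumes hol: "q holomorphic_on ball 0 r" and b: "\<And>x. x \<in> ball 0 r \<Longrightarrow> norm (q x) \<le> M" and r: "r > 0"
    and x: "x \<in> ball 0 r"
  shows "norm (if x = 0 then deriv q 0 else (q x - q 0) / x) \<le> 4 * M / r"
proof -
  let ?d = "\<lambda>x. if x = 0 then deriv q 0 else (q x - q 0) / x"
  have h: "?d holomorphic_on ball 0 r"
    using pole_lemma_open[OF hol, of 0] by (simp cong: if_cong)
  have M: "M \<ge> 0" using b[of 0] r norm_ge_zero order_trans by (metis centre_in_ball)
  have big: "norm (?d z) \<le> 4 * M / r" if z: "z \<in> ball 0 r" "norm z \<ge> r/2" for z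
  proof -
    have z0: "z \<noteq> 0" using z r by auto
    have "norm (q z - q 0) \<le> 2 * M"
      using norm_triangle_ineq4[of "q z" "q 0"] b[OF z(1)] b[of 0] r by auto
    then have "norm (?d z) \<le> 2 * M / norm z"
      using z0 by (simp add: norm_divide divide_right_mono)
    also have "\<dots> \<le> 2 * M / (r/2)"
      using z z0 r M by (intro divide_left_mono mult_pos_pos) auto
    finally show ?thesis by simp
  qed
  show ?thesis
  proof (cases "norm x \<ge> r/2")
    case True then show ?thesis using big x by blast
  next
    case False
    have "norm (?d x) \<le> 4 * M / r"
    proof (rule maximum_modulus_frontier[of ?d "cball 0 (r/2)"])
      show "?d holomorphic_on interior (cball 0 (r/2))"
        using h r by (elim holomorphic_on_subset) auto
      show "continuous_on (closure (cball 0 (r/2))) ?d"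
        by (rule holomorphic_on_imp_continuous_on[OF holomorphic_on_subset[OF h]]) (use r in auto)
      fix z :: complex assume "z \<in> frontier (cball 0 (r/2))"
      then have "norm z = r/2" using r by auto
      then show "norm (?d z) \<le> 4 * M / r" using big[of z] r by auto
    qed (use False in auto)
    then show ?thesis .
  qed
qed

lemma lipschitz_zero:
  fixes q :: "complex \<Rightarrow> complex"
  assumes hol: "q holomorphic_on ball 0 r" and b: "\<And>x. x \<in> ball 0 r \<Longrightarrow> norm (q x) \<le> M" and r: "r > 0"
    and x: "x \<in> ball 0 r"
  shows "norm (q x - q 0) \<le> 4 * M / r * norm x"
proof (cases "x = 0")
  case False
  then show ?thesis using dq_bound[OF hol b r x]
    by (simp add: norm_divide field_simps)
qed auto

lemma holomorphic_limit_bound: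
  fixes f :: "nat \<Rightarrow> complex \<Rightarrow> complex"
  assumes S: "open S" and hol: "\<And>n. f n holomorphic_on S"
    and le: "\<And>n s. s \<in> S \<Longrightarrow> norm (f n s - g s) \<le> B n" and B: "B \<longlonglongrightarrow> 0"
  shows "g holomorphic_on S"
proof (rule holomorphic_uniform_sequence[OF S hol])
  fix x assume "x \<in> S"
  then obtain d where d: "d > 0" "cball x d \<subseteq> S" using S open_contains_cball by metis
  have "uniform_limit S f g sequentially"
  proof (rule uniform_limitI)
    fix e :: real assume "e > 0"
    then have "\<forall>\<^sub>F n in sequentially. B n < e" by (rule order_tendstoD(2)[OF B])
    then show "\<forall>\<^sub>F n in sequentially. \<forall>s\<in>S. dist (f n s) (g s) < e"
    proof eventually_elim
      case (elim n)
      show ?case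
      proof
        fix s assume "s \<in> S"
        then show "dist (f n s) (g s) < e" using le[of s n] elim by (simp add: dist_norm)
      qed
    qed
  qed
  then show "\<exists>d>0. cball x d \<subseteq> S \<and> uniform_limit (cball x d) f g sequentially"
    using d uniform_limit_on_subset by blast
qed

lemma geometric_null: "(\<lambda>n. M * (1/2) ^ n) \<longlonglongrightarrow> (0::real)"
  using tendsto_mult[OF tendsto_const LIMSEQ_power_zero[of "1/2::real"]] by simp

text \<open>The delicate point is holomorphy in \<open>t\<close> on the slice \<open>x = 0\<close>,
  where \<open>dq F\<close> is a derivative in the other variable. That slice is a uniform limit of
  slices with \<open>x\<close> nonzero.\<close>

lemma bsep_dq:
  assumes F: "bsep r M F" and r: "r > 0"
  shows "bsep r (4 * M / r) (dq F)"
proof -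
  note B = bsepD[OF F]
  have holx: "(\<lambda>x. dq F x t) holomorphic_on ball 0 r" if "t \<in> ball 0 r" for t
    using pole_lemma_open[OF B(1)[OF that], of 0] by (simp add: dq_def[abs_def] cong: if_cong)
  have bnd: "norm (dq F x t) \<le> 4 * M / r" if "x \<in> ball 0 r" "t \<in> ball 0 r" for x t
    using dq_bound[OF B(1)[OF that(2)] B(3) r that(1)] that(2) by (simp add: dq_def)
  have holt: "dq F x holomorphic_on ball 0 r" if x: "x \<in> ball 0 r" "x \<noteq> 0" for x
  proof -
    have "(\<lambda>t. (F x t - F 0 t) / x) holomorphic_on ball 0 r"
      using x r by (intro holomorphic_intros B(2)) auto
    then show ?thesis using x by (simp add: dq_def[abs_def])
  qed
  have holt0: "dq F 0 holomorphic_on ball 0 r"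
  proof (rule holomorphic_limit_bound)
    define z where "z n = cx (r / (2 * real (Suc n)))" for n
    have zb: "z n \<in> ball 0 r" "z n \<noteq> 0" for n
    proof -
      have "r / (2 * real (Suc n)) \<le> r / 2" using r by (simp add: field_simps)
      also have "\<dots> < r" using r by simp
      finally show "z n \<in> ball 0 r" unfolding z_def mem_ball dist_0_norm norm_of_real using r by simp
      show "z n \<noteq> 0" unfolding z_def of_real_eq_0_iff using r by simp
    qed
    show "dq F (z n) holomorphic_on ball 0 r" for n using holt zb by blast
    have lim: "z \<longlonglongrightarrow> 0"
    proof -
      have "(\<lambda>n. (r/2) * inverse (real (Suc n))) \<longlonglongrightarrow> (r/2) * 0"
        by (intro tendsto_intros LIMSEQ_inverse_real_of_nat)
      then have "(\<lambda>n. of_real ((r/2) * inverse (real (Suc n)))) \<longlonglongrightarrow> (of_real 0::complex)"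
        by (intro tendsto_of_real) simp
      then show ?thesis unfolding z_def by (simp add: field_simps)
    qed
    \<comment> \<open>\<open>lipschitz_zero\<close> is applied to \<open>dq F\<close>, which is
      itself bounded by \<open>4 * M / r\<close>; this makes the convergence uniform in
      \<open>s\<close>.\<close>
    let ?B = "4 * (4 * M / r) / r"
    have "(\<lambda>n. ?B * norm (z n)) \<longlonglongrightarrow> ?B * norm (0::complex)"
      by (intro tendsto_intros lim)
    then show "(\<lambda>n. ?B * norm (z n)) \<longlonglongrightarrow> 0" by simp
    show "norm (dq F (z n) s - dq F 0 s) \<le> ?B * norm (z n)" if s: "s \<in> ball 0 r" for n s
      by (rule lipschitz_zero[OF holx[OF s] bnd r zb(1)]) (use s in auto)
  qed auto
  show ?thesis unfolding bsep_def using holx bnd holt holt0 by metis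
qed

lemma bsep_dq_pow:
  assumes F: "bsep r M F" and r: "r > 0"
  shows "bsep r (M * (4 / r) ^ n) ((dq ^^ n) F)"
proof (induction n)
  case (Suc n)
  have "M * (4 / r) ^ Suc n = 4 * (M * (4 / r) ^ n) / r" by simp
  then show ?case using bsep_dq[OF Suc r] by (metis comp_apply funpow.simps(2))
qed (use F in auto)

lemma dq_step: "F x t = F 0 t + x * dq F x t"
  by (simp add: dq_def)

lemma dq_expand: "F x t = (\<Sum>i<n. (dq ^^ i) F 0 t * x ^ i) + x ^ n * (dq ^^ n) F x t"
proof (induction n)
  case (Suc n)
  have "(dq ^^ n) F x t = (dq ^^ n) F 0 t + x * (dq ^^ Suc n) F x t"
    using dq_step[of "(dq ^^ n) F" x t] by simp
  with Suc show ?case by (simp add: algebra_simps)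
qed auto

text \<open>Each divided difference costs a factor \<open>4 / r\<close> and each power of
  \<open>x\<close> gains \<open>r / 8\<close>, so the remainder decays like
  \<open>(1/2) ^ n\<close>.\<close>

lemma dq_remainder_bound:
  assumes F: "bsep r M F" and r: "r > 0" and x: "norm x \<le> r / 8" and t: "t \<in> ball 0 r"
  shows "norm (F x t - (\<Sum>i<n. (dq ^^ i) F 0 t * x ^ i)) \<le> M * (1/2) ^ n"
proof -
  have "x \<in> ball 0 r" using x r by auto
  then have "norm ((dq ^^ n) F x t) \<le> M * (4 / r) ^ n"
    using bsepD(3)[OF bsep_dq_pow[OF F r]] t by blast
  then have "norm (x ^ n * (dq ^^ n) F x t) \<le> (r/8) ^ n * (M * (4 / r) ^ n)"
    unfolding norm_mult norm_power using x r
    by (intro mult_mono power_mono) auto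
  also have "\<dots> = M * ((r/8) * (4/r)) ^ n" by (simp only: power_mult_distrib mult_ac)
  also have "(r/8) * (4/r) = 1/2" using r by simp
  finally show ?thesis using dq_expand[of F x t n] by simp
qed

text \<open>The truncated expansions in powers of \<open>\<theta> s\<close> are visibly holomorphic
  in \<open>s\<close> and converge uniformly. This is how separate holomorphy yields holomorphy
  along curves; \<open>r/8\<close> is the radius of the remainder estimate.\<close>

lemma bsep_compose_holomorphic:
  assumes F: "bsep r M F" and r: "r > 0" and S: "open S"
    and \<theta>: "\<theta> holomorphic_on S" "\<And>s. s \<in> S \<Longrightarrow> norm (\<theta> s) \<le> r/8"
    and \<tau>: "\<tau> holomorphic_on S" "\<And>s. s \<in> S \<Longrightarrow> \<tau> s \<in> ball 0 r"
  shows "(\<lambda>s. F (\<theta> s) (\<tau> s)) holomorphic_on S"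
proof (rule holomorphic_limit_bound[OF S _ _ geometric_null])
  let ?f = "\<lambda>n s. (\<Sum>i<n. (dq ^^ i) F 0 (\<tau> s) * \<theta> s ^ i)"
  show "?f n holomorphic_on S" for n
  proof (intro holomorphic_intros \<theta>)
    fix i
    have "(dq ^^ i) F 0 holomorphic_on ball 0 r"
      using bsepD(2)[OF bsep_dq_pow[OF F r]] r by simp
    moreover have "\<tau> ` S \<subseteq> ball 0 r" using \<tau>(2) by blast
    ultimately show "(\<lambda>s. (dq ^^ i) F 0 (\<tau> s)) holomorphic_on S"
      using holomorphic_on_compose_gen[OF \<tau>(1), of "(dq ^^ i) F 0" "ball 0 r"]
      by (simp add: o_def)
  qed
  show "norm (?f n s - F (\<theta> s) (\<tau> s)) \<le> M * (1/2) ^ n" if s: "s \<in> S" for n s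
    using dq_remainder_bound[OF F r \<theta>(2)[OF s] \<tau>(2)[OF s]] by (simp add: norm_minus_commute)
qed

section \<open>Germs in two variables: localisation, substitution and algebra\<close>

definition germ2 :: "(complex \<Rightarrow> complex \<Rightarrow> complex) \<Rightarrow> bool" where
  "germ2 F \<longleftrightarrow> (\<exists>r>0. \<exists>M. bsep r M F)"

text \<open>An explicit form of "eventually near the origin" for two complex variables, so that
  single values of \<open>x\<close> and \<open>t\<close> can be plugged in.\<close>

definition near2 :: "(complex \<Rightarrow> complex \<Rightarrow> bool) \<Rightarrow> bool" where
  "near2 P \<longleftrightarrow> (\<exists>e>0. \<forall>x t. norm x < e \<longrightarrow> norm t < e \<longrightarrow> P x t)"

lemma near2_mono: "near2 P \<Longrightarrow> (\<And>x t. P x t \<Longrightarrow> Q x t) \<Longrightarrow> near2 Q"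
  unfolding near2_def by meson

lemma near2_conj: 
  assumes "near2 P" "near2 Q" shows "near2 (\<lambda>x t. P x t \<and> Q x t)"
proof -
  obtain e1 e2 where "e1 > 0" "\<forall>x t. norm x < e1 \<longrightarrow> norm t < e1 \<longrightarrow> P x t"
    "e2 > 0" "\<forall>x t. norm x < e2 \<longrightarrow> norm t < e2 \<longrightarrow> Q x t"
    using assms unfolding near2_def by blast
  then show ?thesis unfolding near2_def by (intro exI[of _ "min e1 e2"]) auto
qed

lemma near2_norm_less: "e > 0 \<Longrightarrow> near2 (\<lambda>x t. norm x < e \<and> norm t < e)"
  unfolding near2_def by blast

lemma bsep_lipschitz_zero:
  assumes F: "bsep r M F" and r: "r > 0" and "x \<in> ball 0 r" "t \<in> ball 0 r"
  shows "norm (F x t - F 0 0) \<le> 4 * M / r * (norm x + norm t)"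
proof -
  note B = bsepD[OF F]
  have "norm (F x t - F 0 t) \<le> 4 * M / r * norm x"
    by (rule lipschitz_zero[OF B(1) B(3) r]) (use assms in auto)
  moreover have "norm (F 0 t - F 0 0) \<le> 4 * M / r * norm t"
    by (rule lipschitz_zero[OF B(2) B(3) r]) (use assms in auto)
  ultimately show ?thesis
    using norm_triangle_ineq[of "F x t - F 0 t" "F 0 t - F 0 0"] by (simp only: distrib_left) simp
qed

lemma germ2_near:
  assumes F: "germ2 F" and e: "e > 0"
  shows "near2 (\<lambda>x t. norm (F x t - F 0 0) < e)"
proof -
  obtain r M where r: "r > 0" "bsep r M F" using F unfolding germ2_def by blast
  have M: "M \<ge> 0" using bsepD(3)[OF r(2), of 0 0] r(1) by (simp) (metis norm_ge_zero order_trans)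
  \<comment> \<open>The summand \<open>1\<close> keeps the denominator positive when
    \<open>M = 0\<close>; as \<open>norm x + norm t < 2 * d\<close>, the factor \<open>8\<close>
    makes the Lipschitz bound come out as \<open>e\<close>.\<close>
  define d where "d = min r (e * r / (8 * (M + 1)))"
  have d: "d > 0" using r e M by (auto simp: d_def)
  have "norm (F x t - F 0 0) < e" if "norm x < d" "norm t < d" for x t
  proof -
    have "norm (F x t - F 0 0) \<le> 4 * M / r * (norm x + norm t)"
      by (rule bsep_lipschitz_zero[OF r(2) r(1)]) (use that d_def in auto)
    also have "\<dots> \<le> 4 * (M+1) / r * (norm x + norm t)"
      using r M by (intro mult_right_mono divide_right_mono) auto
    also have "\<dots> < 4 * (M+1) / r * (2 * (e * r / (8 * (M + 1))))"
      using that M r d_def by (intro mult_strict_left_mono) auto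
    also have "\<dots> = e" using M r by (simp add: divide_simps)
    finally show ?thesis .
  qed
  then show ?thesis unfolding near2_def using d by blast
qed

lemma germ2_dq: "germ2 F \<Longrightarrow> germ2 (dq F)"
  unfolding germ2_def using bsep_dq by blast

lemma germ2_dq_pow: "germ2 F \<Longrightarrow> germ2 ((dq ^^ n) F)"
  by (induction n) (auto simp: germ2_dq)

lemma germ2_I:
  assumes "e > 0" "\<And>t. norm t < e \<Longrightarrow> (\<lambda>x. F x t) holomorphic_on ball 0 e"
     "\<And>x. norm x < e \<Longrightarrow> F x holomorphic_on ball 0 e"
     "\<And>x t. norm x < e \<Longrightarrow> norm t < e \<Longrightarrow> norm (F x t) \<le> M"
  shows "germ2 F"
  unfolding germ2_def bsep_def using assms by (intro exI[of _ e] conjI exI[of _ M]) auto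

text \<open>\<open>X\<close> must be pushed into the disc of radius \<open>r/8\<close>, where the
  expansion of \<open>F\<close> is controlled, while \<open>T\<close> only has to stay in the
  domain.\<close>

lemma germ2_compose:
  assumes F: "germ2 F" and X: "germ2 X" "X 0 0 = 0" and T: "germ2 T" "T 0 0 = 0"
  shows "germ2 (\<lambda>x t. F (X x t) (T x t))"
proof -
  obtain r M where r: "r > 0" "bsep r M F" using F unfolding germ2_def by blast
  obtain r1 M1 where r1: "r1 > 0" "bsep r1 M1 X" using X unfolding germ2_def by blast
  obtain r2 M2 where r2: "r2 > 0" "bsep r2 M2 T" using T unfolding germ2_def by blast
  obtain e1 where e1: "e1 > 0" "\<And>x t. norm x < e1 \<Longrightarrow> norm t < e1 \<Longrightarrow> norm (X x t) < r/8"
    using germ2_near[OF X(1), of "r/8"] r X(2) unfolding near2_def by auto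
  obtain e2 where e2: "e2 > 0" "\<And>x t. norm x < e2 \<Longrightarrow> norm t < e2 \<Longrightarrow> norm (T x t) < r"
    using germ2_near[OF T(1), of r] r T(2) unfolding near2_def by auto
  define e where "e = min (min r1 r2) (min e1 e2)"
  have e: "e > 0" "e \<le> r1" "e \<le> r2" "e \<le> e1" "e \<le> e2" using r1 r2 e1 e2 by (auto simp: e_def)
  show ?thesis
  proof (rule germ2_I[OF e(1)])
    fix x :: complex assume x: "norm x < e"
    show "(\<lambda>t. F (X x t) (T x t)) holomorphic_on ball 0 e"
    proof (rule bsep_compose_holomorphic[OF r(2) r(1)])
      show "X x holomorphic_on ball 0 e"
        by (rule holomorphic_on_subset[OF bsepD(2)[OF r1(2)]]) (use x e in auto)
      show "T x holomorphic_on ball 0 e"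
        by (rule holomorphic_on_subset[OF bsepD(2)[OF r2(2)]]) (use x e in auto)
    qed (use x e e1(2)[of x] e2(2)[of x] in \<open>auto intro!: less_imp_le\<close>)
  next
    fix t :: complex assume t: "norm t < e"
    show "(\<lambda>x. F (X x t) (T x t)) holomorphic_on ball 0 e"
    proof (rule bsep_compose_holomorphic[OF r(2) r(1)])
      show "(\<lambda>x. X x t) holomorphic_on ball 0 e"
        by (rule holomorphic_on_subset[OF bsepD(1)[OF r1(2)]]) (use t e in auto)
      show "(\<lambda>x. T x t) holomorphic_on ball 0 e"
        by (rule holomorphic_on_subset[OF bsepD(1)[OF r2(2)]]) (use t e in auto)
    qed (use t e e1(2)[of _ t] e2(2)[of _ t] in \<open>auto intro!: less_imp_le\<close>)
  next
    fix x t :: complex assume xt: "norm x < e" "norm t < e"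
    then have "norm (X x t) < r" "norm (T x t) < r"
      using e1(2)[of x t] e2(2)[of x t] e r by auto
    then show "norm (F (X x t) (T x t)) \<le> M" using bsepD(3)[OF r(2)] by auto
  qed
qed

lemma germ2_common_radius:
  assumes "germ2 F" "germ2 G"
  shows "\<exists>r M M'. r > 0 \<and> M \<ge> 0 \<and> bsep r M F \<and> bsep r M' G"
proof -
  obtain r M where r: "r > 0" "bsep r M F" using assms unfolding germ2_def by blast
  obtain r' M' where r': "r' > 0" "bsep r' M' G" using assms unfolding germ2_def by blast
  have "bsep (min r r') \<bar>M\<bar> F" "bsep (min r r') M' G"
    by (rule bsep_mono[OF r(2)] bsep_mono[OF r'(2)]; simp)+
  then show ?thesis using r(1) r'(1) by (intro exI[of _ "min r r'"] exI[of _ "\<bar>M\<bar>"] exI[of _ M']) auto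
qed

lemma germ2_add:
  assumes "germ2 F" "germ2 G" shows "germ2 (\<lambda>x t. F x t + G x t)"
proof -
  obtain r M M' where r: "r > 0" "bsep r M F" "bsep r M' G" using germ2_common_radius[OF assms] by blast
  show ?thesis
    by (rule germ2_I[of r _ "M + M'"])
      (use r(1) bsepD[OF r(2)] bsepD[OF r(3)] in \<open>auto intro!: holomorphic_intros norm_triangle_mono\<close>)
qed

lemma germ2_mult:
  assumes "germ2 F" "germ2 G" shows "germ2 (\<lambda>x t. F x t * G x t)"
proof -
  obtain r M M' where r: "r > 0" "M \<ge> 0" "bsep r M F" "bsep r M' G" using germ2_common_radius[OF assms] by blast
  show ?thesis
    by (rule germ2_I[of r _ "M * M'"])
      (use r(1,2) bsepD[OF r(3)] bsepD[OF r(4)] in \<open>auto simp: norm_mult intro!: holomorphic_intros mult_mono\<close>)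
qed

lemma analytic_at_bounded:
  assumes "(\<phi>::complex \<Rightarrow> complex) analytic_on {z}"
  obtains r M where "r > 0" "\<phi> holomorphic_on ball z r" "\<And>t. t \<in> ball z r \<Longrightarrow> norm (\<phi> t) \<le> M"
proof -
  obtain r where r: "r > 0" "\<phi> holomorphic_on ball z r" using assms analytic_at_ball by blast
  have s: "cball z (r/2) \<subseteq> ball z r" using r by auto
  have "continuous_on (cball z (r/2)) \<phi>"
    using r(2) s by (meson holomorphic_on_imp_continuous_on holomorphic_on_subset)
  then have "bounded (\<phi> ` cball z (r/2))"
    by (intro compact_imp_bounded compact_continuous_image) auto
  then obtain M where "\<forall>t\<in>cball z (r/2). norm (\<phi> t) \<le> M" unfolding bounded_iff by blast
  then show ?thesis using r s that[of "r/2" M]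
    by (meson ball_subset_cball half_gt_zero_iff holomorphic_on_subset subset_trans subsetD)
qed

lemma germ2_of_t: assumes "\<phi> analytic_on {0}" shows "germ2 (\<lambda>x t. \<phi> t)"
proof -
  obtain r M where "r > 0" "\<phi> holomorphic_on ball 0 r" "\<And>t. t \<in> ball 0 r \<Longrightarrow> norm (\<phi> t) \<le> M"
    using analytic_at_bounded[OF assms] by blast
  then show ?thesis by (intro germ2_I[of r _ M]) auto
qed

lemma germ2_of_x: assumes "\<phi> analytic_on {0}" shows "germ2 (\<lambda>x t. \<phi> x)"
proof -
  obtain r M where "r > 0" "\<phi> holomorphic_on ball 0 r" "\<And>t. t \<in> ball 0 r \<Longrightarrow> norm (\<phi> t) \<le> M"
    using analytic_at_bounded[OF assms] by blast
  then show ?thesis by (intro germ2_I[of r _ M]) auto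
qed

lemma germ2_const: "germ2 (\<lambda>x t. c)"
  using germ2_of_t[of "\<lambda>_. c"] by auto

lemma germ2_x: "germ2 (\<lambda>x t. x)"
  using germ2_of_x[of "\<lambda>x. x"] by auto

lemma germ2_t: "germ2 (\<lambda>x t. t)"
  using germ2_of_t[of "\<lambda>x. x"] by auto

lemma germ2_power: "germ2 F \<Longrightarrow> germ2 (\<lambda>x t. F x t ^ n)"
  by (induction n) (auto intro: germ2_const germ2_mult)

lemma germ2_diff: "germ2 F \<Longrightarrow> germ2 G \<Longrightarrow> germ2 (\<lambda>x t. F x t - G x t)"
  using germ2_add[of F "\<lambda>x t. (-1) * G x t"] germ2_mult[OF germ2_const[of "-1"], of G] by auto

lemma germ2_sum: "finite I \<Longrightarrow> (\<And>i. i \<in> I \<Longrightarrow> germ2 (F i)) \<Longrightarrow> germ2 (\<lambda>x t. \<Sum>i\<in>I. F i x t)"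
  by (induction I rule: finite_induct) (auto intro: germ2_const germ2_add)

lemma germ2_prod: "finite I \<Longrightarrow> (\<And>i. i \<in> I \<Longrightarrow> germ2 (F i)) \<Longrightarrow> germ2 (\<lambda>x t. \<Prod>i\<in>I. F i x t)"
  by (induction I rule: finite_induct) (auto intro: germ2_const germ2_mult)

lemmas germ2_intros = germ2_const germ2_x germ2_t germ2_power germ2_add germ2_diff germ2_mult
  germ2_of_t germ2_of_x

lemma germ2_analytic_t: assumes "germ2 F" shows "F 0 analytic_on {0}"
proof -
  obtain r M where "r > 0" "bsep r M F" using assms unfolding germ2_def by blast
  then show ?thesis using bsepD(2)[of r M F 0] analytic_at_ball by auto
qed

lemma germ2_analytic_x: assumes "germ2 F" shows "(\<lambda>x. F x 0) analytic_on {0}"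
proof -
  obtain r M where "r > 0" "bsep r M F" using assms unfolding germ2_def by blast
  then show ?thesis using bsepD(1)[of r M F 0] analytic_at_ball by auto
qed

section \<open>Puiseux roots of a germ regular in its first variable\<close>

text \<open>The order in \<open>x\<close> of the restriction to \<open>t = 0\<close>, written as a
  monomial times a unit so that differentiation and division by \<open>x\<close> can be followed
  exactly.\<close>

definition ordx :: "nat \<Rightarrow> (complex \<Rightarrow> complex \<Rightarrow> complex) \<Rightarrow> bool" where
  "ordx m F \<longleftrightarrow> (\<exists>k. k analytic_on {0} \<and> k 0 \<noteq> 0 \<and> (\<forall>\<^sub>F x in nhds 0. F x 0 = x ^ m * k x))"

lemma ordx_dq:
  assumes "ordx (Suc m) F"
  shows "ordx m (dq F)" "F 0 0 = 0"
proof -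
  obtain k where k: "k analytic_on {0}" "k 0 \<noteq> 0" "\<forall>\<^sub>F x in nhds 0. F x 0 = x ^ Suc m * k x"
    using assms unfolding ordx_def by blast
  show F0: "F 0 0 = 0" using eventually_nhds_x_imp_x[OF k(3)] by simp
  have "((\<lambda>x. x * (x ^ m * k x)) has_field_derivative (0 ^ m * k 0)) (at 0)"
  proof -
    have "k field_differentiable at 0"
      using k(1) analytic_on_imp_differentiable_at by blast
    then have "(\<lambda>x. x ^ m * k x) field_differentiable at 0"
      by (intro derivative_intros) auto
    then obtain D where D: "((\<lambda>x. x ^ m * k x) has_field_derivative D) (at 0)"
      using field_differentiable_def by blast
    show ?thesis by (rule derivative_eq_intros refl D)+ simp
  qed
  then have "((\<lambda>x. F x 0) has_field_derivative (0 ^ m * k 0)) (at 0)"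
    by (rule DERIV_cong_ev[THEN iffD1, rotated -1])
       (use k(3) in \<open>auto elim: eventually_mono\<close>)
  then have d: "deriv (\<lambda>x. F x 0) 0 = 0 ^ m * k 0" by (rule DERIV_imp_deriv)
  have "\<forall>\<^sub>F x in nhds 0. dq F x 0 = x ^ m * k x"
    using k(3) by eventually_elim (auto simp: dq_def d F0)
  then show "ordx m (dq F)" using k unfolding ordx_def by blast
qed

lemma ordx_cong:
  assumes "ordx m F" "\<forall>\<^sub>F x in nhds 0. G x 0 = F x 0"
  shows "ordx m G"
proof -
  obtain k where k: "k analytic_on {0}" "k 0 \<noteq> 0" "\<forall>\<^sub>F x in nhds 0. F x 0 = x ^ m * k x"
    using assms unfolding ordx_def by blast
  have "\<forall>\<^sub>F x in nhds 0. G x 0 = x ^ m * k x" using k(3) assms(2) by eventually_elim simp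
  then show ?thesis using k unfolding ordx_def by blast
qed

text \<open>At \<open>t = 0\<close> the expansion coefficients below \<open>m\<close> vanish and the
  one at \<open>m\<close> does not; this places \<open>(m, 0)\<close> as a vertex of the Newton
  polygon.\<close>

lemma ordx_dq_pow:
  assumes "ordx m F"
  shows "i \<le> m \<Longrightarrow> ordx (m - i) ((dq ^^ i) F)" "i < m \<Longrightarrow> (dq ^^ i) F 0 0 = 0" "(dq ^^ m) F 0 0 \<noteq> 0"
proof -
  show *: "i \<le> m \<Longrightarrow> ordx (m - i) ((dq ^^ i) F)" for i
  proof (induction i)
    case (Suc i)
    then have "ordx (Suc (m - Suc i)) ((dq ^^ i) F)" by (simp add: Suc_diff_Suc)
    then show ?case using ordx_dq(1) by simp
  qed (use assms in auto)
  show "(dq ^^ i) F 0 0 = 0" if "i < m"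
    using ordx_dq(2)[of "m - Suc i" "(dq ^^ i) F"] *[of i] that by (simp add: Suc_diff_Suc)
  show "(dq ^^ m) F 0 0 \<noteq> 0"
    using *[of m] eventually_nhds_x_imp_x unfolding ordx_def by fastforce
qed

section \<open>The derivative in x and simple roots\<close>

definition dx :: "(complex \<Rightarrow> complex \<Rightarrow> complex) \<Rightarrow> complex \<Rightarrow> complex \<Rightarrow> complex" where
  "dx F x t = deriv (\<lambda>x. F x t) x"

lemma bsep_shift:
  assumes F: "bsep r M F" and c: "norm c \<le> r/2"
  shows "bsep (r/2) M (\<lambda>x t. F (c + x) t)"
proof -
  have b: "c + x \<in> ball 0 r" if "x \<in> ball 0 (r/2)" for x
    using that c norm_triangle_ineq[of c x] by auto
  have b2: "x \<in> ball 0 r" if "x \<in> ball 0 (r/2)" for x :: complex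
    using that by simp (smt (verit) norm_ge_zero field_sum_of_halves)
  show ?thesis unfolding bsep_def
  proof (intro conjI ballI)
    fix t :: complex assume t: "t \<in> ball 0 (r/2)"
    have sub: "(\<lambda>x. c + x) ` ball 0 (r/2) \<subseteq> ball 0 r" using b by blast
    have "(\<lambda>x. F x t) \<circ> (\<lambda>x. c + x) holomorphic_on ball 0 (r/2)"
      by (rule holomorphic_on_compose_gen[OF _ bsepD(1)[OF F b2[OF t]]])
         (use sub in \<open>simp_all add: holomorphic_intros\<close>)
    then show "(\<lambda>x. F (c + x) t) holomorphic_on ball 0 (r/2)" by (simp add: o_def)
  next
    fix x :: complex assume x: "x \<in> ball 0 (r/2)"
    show "F (c + x) holomorphic_on ball 0 (r/2)"
      by (rule holomorphic_on_subset[OF bsepD(2)[OF F b[OF x]]]) (use b2 in auto)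
    show "norm (F (c + x) t) \<le> M" if "t \<in> ball 0 (r/2)" for t
      using bsepD(3)[OF F b[OF x] b2[OF that]] .
  qed
qed

text \<open>Expresses the derivative at any point through the divided difference of a translate, so
  that \<open>germ2_dx\<close> gets holomorphy in \<open>t\<close> and the bound from
  \<open>bsep_dq\<close>.\<close>

lemma dx_eq_dq_shift:
  shows "dx F x t = dq (\<lambda>u t. F (x + u) t) 0 t"
  using DERIV_shift[of "\<lambda>x. F x t" _ 0 x]
  by (simp add: dx_def dq_def deriv_def add.commute)

lemma germ2_dx:
  assumes "germ2 F" shows "germ2 (dx F)"
proof -
  obtain r M where r: "r > 0" "bsep r M F" using assms unfolding germ2_def by blast
  show ?thesis
  proof (rule germ2_I[of "r/2" _ "4 * M / (r/2)"])
    fix t :: complex assume t: "norm t < r/2"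
    have "(\<lambda>x. F x t) holomorphic_on ball 0 r" using bsepD(1)[OF r(2)] t r by auto
    then have "deriv (\<lambda>x. F x t) holomorphic_on ball 0 r" by (rule holomorphic_deriv) auto
    then show "(\<lambda>x. dx F x t) holomorphic_on ball 0 (r/2)" unfolding dx_def
      by (rule holomorphic_on_subset) (use r in auto)
  next
    fix x :: complex assume x: "norm x < r/2"
    have B: "bsep (r/2) (4 * M / (r/2)) (dq (\<lambda>u t. F (x + u) t))"
      using bsep_dq[OF bsep_shift[OF r(2)], of x] x r by auto
    show "dx F x holomorphic_on ball 0 (r/2)"
      using bsepD(2)[OF B, of 0] r by (simp add: dx_eq_dq_shift[abs_def])
    show "norm (dx F x t) \<le> 4 * M / (r/2)" if "norm t < r/2" for t
      using bsepD(3)[OF B, of 0 t] that r by (simp add: dx_eq_dq_shift)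
  qed (use r in auto)
qed

lemma ordx_dx:
  assumes "ordx (Suc m) F" shows "ordx m (dx F)"
proof -
  obtain k where k: "k analytic_on {0}" "k 0 \<noteq> 0" "\<forall>\<^sub>F x in nhds 0. F x 0 = x ^ Suc m * k x"
    using assms unfolding ordx_def by blast
  obtain r where r: "r > 0" "k holomorphic_on ball 0 r" using k(1) analytic_at_ball by blast
  obtain r1 where r1: "r1 > 0" "\<And>x. norm x < r1 \<Longrightarrow> F x 0 = x ^ Suc m * k x"
    using k(3) unfolding eventually_nhds_metric by auto
  define e where "e = min r r1"
  \<comment> \<open>By the product rule the derivative of \<open>x ^ Suc m * k x\<close> is
    \<open>x ^ m\<close> times this function, whose value at \<open>0\<close> is a nonzero multiple
    of \<open>k 0\<close>.\<close>
  define k' where "k' x = of_nat (Suc m) * k x + x * deriv k x" for x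
  have "k' analytic_on {0}" unfolding k'_def
    by (intro analytic_intros k) 
  moreover have "k' 0 \<noteq> 0" using k by (simp add: k'_def del: of_nat_Suc)
  moreover have "dx F x 0 = x ^ m * k' x" if x: "norm x < e" for x
  proof -
    have kx: "(k has_field_derivative deriv k x) (at x)"
      using holomorphic_derivI[OF r(2)] x e_def by auto
    have "((\<lambda>x. x ^ Suc m * k x) has_field_derivative x ^ m * k' x) (at x)"
      by (rule derivative_eq_intros kx refl)+ (simp add: k'_def algebra_simps)
    then have "((\<lambda>x. F x 0) has_field_derivative x ^ m * k' x) (at x)"
      by (rule has_field_derivative_transform_within_open[of _ _ _ "ball 0 r1"])
         (use x r1 e_def in auto)
    then show ?thesis unfolding dx_def by (rule DERIV_imp_deriv)
  qed
  moreover have "e > 0" using r r1 by (auto simp: e_def)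
  ultimately show ?thesis unfolding ordx_def eventually_nhds_metric by (metis dist_0_norm dist_commute)
qed

text \<open>An implicit function theorem by the simplified Newton iteration
  \<open>x - F x t / c\<close>, where \<open>c\<close> is the x-derivative of \<open>F\<close> at
  the origin: its own x-derivative vanishes there, so it contracts by \<open>1/2\<close> nearby. The
  fixed point is holomorphic in \<open>t\<close> as a uniform limit of iterates.\<close>

lemma simple_root:
  assumes F: "germ2 F" "F 0 0 = 0" "dq F 0 0 \<noteq> 0"
  shows "\<exists>\<phi>. \<phi> analytic_on {0} \<and> \<phi> 0 = 0 \<and> (\<forall>\<^sub>F t in nhds 0. F (\<phi> t) t = 0)"
proof -
  define c where "c = dq F 0 0"
  define G where "G x t = x - F x t * (1 / c)" for x t
  have c0: "c \<noteq> 0" using F c_def by simp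
  have G: "germ2 G" unfolding G_def by (intro germ2_intros F)
  obtain r M where r: "r > 0" "bsep r M G" using G unfolding germ2_def by blast
  have "(\<lambda>x. F x 0) field_differentiable at 0"
    using germ2_analytic_x[OF F(1)] analytic_on_imp_differentiable_at by blast
  then have "((\<lambda>x. F x 0) has_field_derivative c) (at 0)"
    by (simp add: c_def dq_def DERIV_deriv_iff_field_differentiable)
  then have "((\<lambda>x. G x 0) has_field_derivative (1 - c * (1/c))) (at 0)"
    unfolding G_def by (auto intro!: derivative_eq_intros)
  then have dG0: "dx G 0 0 = 0" using c0 unfolding dx_def by (simp add: DERIV_imp_deriv)
  obtain e1 where e1: "e1 > 0" "\<And>x t. norm x < e1 \<Longrightarrow> norm t < e1 \<Longrightarrow> norm (dx G x t) < 1/2"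
    using germ2_near[OF germ2_dx[OF G], of "1/2"] dG0 unfolding near2_def by auto
  \<comment> \<open>\<open>e1 / 2\<close> keeps the closed disc inside the region of contraction;
    \<open>r / 8\<close> is the radius demanded by \<open>bsep_compose_holomorphic\<close>.\<close>
  define \<delta> where "\<delta> = min (e1/2) (r/8)"
  have \<delta>: "\<delta> > 0" "\<delta> < e1" "\<delta> \<le> r/8" "\<delta> < r" using e1 r by (auto simp: \<delta>_def)
  have G0: "G 0 0 = 0" by (simp add: G_def F)
  \<comment> \<open>The image of the centre has norm below \<open>\<delta>/2\<close> and the
    contraction adds at most \<open>\<delta>/2\<close>, so the closed disc is mapped into
    itself.\<close>
  obtain e2 where e2: "e2 > 0" "\<And>x t. norm x < e2 \<Longrightarrow> norm t < e2 \<Longrightarrow> norm (G x t) < \<delta>/2"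
    using germ2_near[OF G, of "\<delta>/2"] \<delta> G0 unfolding near2_def by auto
  define e where "e = min (min e1 e2) r"
  have e: "e > 0" "e \<le> e1" "e \<le> e2" "e \<le> r" using e1 e2 r by (auto simp: e_def)
  have lip: "norm (G x t - G x' t) \<le> 1/2 * norm (x - x')"
    if "x \<in> cball 0 \<delta>" "x' \<in> cball 0 \<delta>" "norm t < e" for x x' t
  proof (rule field_differentiable_bound[of "cball 0 \<delta>" "\<lambda>x. G x t" "\<lambda>x. dx G x t"])
    fix z :: complex assume z: "z \<in> cball 0 \<delta>"
    have h: "(\<lambda>x. G x t) holomorphic_on ball 0 r" using bsepD(1)[OF r(2)] that e by auto
    show "((\<lambda>x. G x t) has_field_derivative dx G z t) (at z within cball 0 \<delta>)"
      unfolding dx_def using holomorphic_derivI[OF h, of z] z \<delta> by (auto intro: has_field_derivative_at_within)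
    show "norm (dx G z t) \<le> 1/2" using e1(2)[of z t] z \<delta> that e by auto
  qed (use that in auto)
  have into: "G x t \<in> cball 0 \<delta>" if "x \<in> cball 0 \<delta>" "norm t < e" for x t
  proof -
    have "norm (G x t - G 0 t) \<le> 1/2 * norm (x - 0)" using lip[OF that(1) _ that(2), of 0] \<delta> by simp
    moreover have "norm (G 0 t) < \<delta>/2" using e2(2)[of 0 t] e2 that e by auto
    moreover have "norm (G x t) \<le> norm (G x t - G 0 t) + norm (G 0 t)"
      using norm_triangle_ineq[of "G x t - G 0 t" "G 0 t"] by simp
    ultimately show ?thesis using that by auto
  qed
  have fix_ex: "\<exists>!x. x \<in> cball 0 \<delta> \<and> G x t = x" if t: "norm t < e" for t
  proof -
    have "\<exists>!x\<in>cball 0 \<delta>. (\<lambda>x. G x t) x = x"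
      by (rule Banach_fix[of _ "1/2"]) (use t into lip \<delta> in \<open>auto simp: dist_norm complete_eq_closed\<close>)
    then show ?thesis by simp
  qed
  define \<phi> where "\<phi> t = (THE x. x \<in> cball 0 \<delta> \<and> G x t = x)" for t
  have \<phi>: "\<phi> t \<in> cball 0 \<delta>" "G (\<phi> t) t = \<phi> t" if "norm t < e" for t
    using theI'[OF fix_ex[OF that]] unfolding \<phi>_def by auto
  define f where "f n = ((\<lambda>u t. G (u t) t) ^^ n) (\<lambda>t. 0)" for n
  have f_Suc: "f (Suc n) t = G (f n t) t" for n t by (simp add: f_def)
  have f_in: "norm t < e \<Longrightarrow> f n t \<in> cball 0 \<delta>" for n t
    by (induction n) (use \<delta> into in \<open>auto simp: f_Suc simp del: mem_cball, auto simp: f_def\<close>)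
  have f_hol: "f n holomorphic_on ball 0 e" for n
  proof (induction n)
    case (Suc n)
    have "norm (f n t) \<le> r/8" if "t \<in> ball 0 e" for t
      using f_in[of t n] that \<delta>(3) by simp
    then have "(\<lambda>t. G (f n t) t) holomorphic_on ball 0 e"
      by (rule bsep_compose_holomorphic[OF r(2,1) open_ball Suc])
         (use e in \<open>auto intro!: holomorphic_intros\<close>)
    then show ?case by (simp add: f_Suc[abs_def])
  qed (simp add: f_def)
  have f_conv: "norm t < e \<Longrightarrow> norm (f n t - \<phi> t) \<le> \<delta> * (1/2) ^ n" for n t
  proof (induction n)
    case 0
    then show ?case using \<phi>(1)[of t] by (simp add: f_def)
  next
    case (Suc n)
    have "norm (f (Suc n) t - \<phi> t) = norm (G (f n t) t - G (\<phi> t) t)"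
      using \<phi>(2)[of t] Suc.prems by (simp add: f_Suc)
    also have "\<dots> \<le> 1/2 * norm (f n t - \<phi> t)" by (rule lip) (use Suc.prems f_in \<phi> in auto)
    finally show ?case using Suc by auto
  qed
  have "\<phi> holomorphic_on ball 0 e"
    by (rule holomorphic_limit_bound[OF open_ball f_hol _ geometric_null]) (use f_conv in auto)
  then have "\<phi> analytic_on {0}" using e analytic_at_ball by blast
  moreover have "\<phi> 0 = 0"
    unfolding \<phi>_def by (rule the1_equality[OF fix_ex]) (use G0 e \<delta> in auto)
  moreover have "F (\<phi> t) t = 0" if "norm t < e" for t using \<phi>(2)[OF that] c0 by (simp add: G_def)
  then have "\<forall>\<^sub>F t in nhds 0. F (\<phi> t) t = 0"
    unfolding eventually_nhds_metric using e(1) by (intro exI[of _ e]) auto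
  ultimately show ?thesis by blast
qed

section \<open>Blowing up along an edge of the Newton polygon\<close>

lemma analytic_factor:
  assumes "\<phi> analytic_on {0}" "\<not> (\<forall>\<^sub>F t in nhds (0::complex). \<phi> t = 0)"
  obtains d k where "k analytic_on {0}" "k 0 \<noteq> (0::complex)" "\<forall>\<^sub>F t in nhds 0. \<phi> t = t ^ d * k t"
proof (cases "\<phi> 0 = 0")
  case False
  then show ?thesis using assms that[of \<phi> 0] by simp
next
  case True
  obtain r where r: "r > 0" "\<phi> holomorphic_on ball 0 r" using assms(1) analytic_at_ball by blast
  have "\<not> \<phi> constant_on ball 0 r"
  proof
    assume "\<phi> constant_on ball 0 r"
    then have "\<forall>t\<in>ball 0 r. \<phi> t = 0" using True r unfolding constant_on_def by force
    then show False using assms(2) r unfolding eventually_nhds_metric by (metis dist_0_norm dist_commute mem_ball)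
  qed
  from holomorphic_factor_zero_nonconstant[OF r(2) open_ball connected_ball _ True this]
  obtain g s n where g: "0 < s" "g holomorphic_on ball 0 s" "\<And>w. w \<in> ball 0 s \<Longrightarrow> \<phi> w = (w - 0) ^ n * g w"
      "\<And>w. w \<in> ball 0 s \<Longrightarrow> g w \<noteq> 0" using r by (metis centre_in_ball)
  have "\<forall>\<^sub>F t in nhds 0. \<phi> t = t ^ n * g t"
    unfolding eventually_nhds_metric using g by (intro exI[of _ s]) auto
  moreover have "g 0 \<noteq> 0" using g by simp
  moreover have "g analytic_on {0}" using g analytic_at_ball by blast
  ultimately show ?thesis using that by blast
qed

text \<open>A root of multiplicity \<open>m\<close> would make \<open>P\<close> equal to
  \<open>k * (z - c) ^ m\<close>. Its linear coefficient is a nonzero multiple of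
  \<open>c ^ (m - 1)\<close>, so \<open>c1\<close> forces \<open>c = 0\<close> and \<open>P\<close>
  becomes a monomial, against \<open>i0\<close>.\<close>

lemma poly_root_multiplicity_less:
  fixes P :: "complex poly"
  assumes m: "degree P = m" "m \<ge> 2" and c1: "coeff P 1 = 0" and i0: "i0 < m" "coeff P i0 \<noteq> 0"
  obtains c m' Q where "0 < m'" "m' < m" "P = [:-c,1:] ^ m' * Q" "poly Q c \<noteq> 0"
proof -
  have "\<exists>c. poly P c = 0"
    by (rule fundamental_theorem_of_algebra_alt) (use m in auto)
  then obtain c where c: "poly P c = 0" by blast
  have P0: "P \<noteq> 0" using i0 by auto
  define m' where "m' = order c P"
  obtain Q where Q: "P = [:-c,1:] ^ m' * Q" "\<not> [:-c,1:] dvd Q"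
    using order_decomp[OF P0, of c] m'_def by auto
  have Qc: "poly Q c \<noteq> 0" using Q(2) by (simp add: poly_eq_0_iff_dvd)
  have pos: "m' > 0" using c P0 order_root[of P c] by (simp add: m'_def)
  have Q0: "Q \<noteq> 0" using Q P0 by auto
  have deg: "m = m' + degree Q" using m Q Q0 by (simp add: degree_mult_eq degree_linear_power)
  have "m' \<noteq> m"
  proof
    assume eq: "m' = m"
    then obtain k where k: "Q = [:k:]" using deg degree_eq_zeroE[of Q] by auto
    have k0: "k \<noteq> 0" using k Q0 by auto
    have P: "P = smult k ([:-c,1:] ^ m)" using Q k eq by simp
    have "poly (pderiv P) 0 = k * (of_nat m * (-c) ^ (m - 1))"
      using m unfolding P by (simp add: pderiv_smult pderiv_power pderiv_pCons)
    moreover have "poly (pderiv P) 0 = coeff P 1" by (simp add: poly_0_coeff_0 coeff_pderiv)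
    ultimately have "c = 0" using c1 k0 m by simp
    then have "P = monom k m" unfolding P by (simp add: monom_altdef)
    then show False using i0 by simp
  qed
  then show ?thesis using that[OF pos _ Q(1) Qc] deg by auto
qed

lemma eventually_nhds_0_power:
  assumes "\<forall>\<^sub>F t in nhds (0::complex). P t" "N > 0"
  shows "\<forall>\<^sub>F t in nhds 0. P (t ^ N)"
proof -
  have "isCont (\<lambda>t::complex. t ^ N) 0" by (intro continuous_intros)
  then have "filterlim (\<lambda>t::complex. t ^ N) (nhds 0) (nhds 0)"
    using assms(2) by (metis continuous_at tendsto_at_iff_tendsto_nhds zero_power)
  then show ?thesis using assms(1) by (simp add: filterlim_iff)
qed

lemma ex_min_finite:
  fixes f :: "'a \<Rightarrow> real"
  assumes "finite J" "J \<noteq> {}"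
  obtains i where "i \<in> J" "\<And>j. j \<in> J \<Longrightarrow> f i \<le> f j"
  using ex_is_arg_min_if_finite[OF assms, of f] unfolding is_arg_min_linorder by blast

lemma blowup:
  assumes F: "germ2 F" "ordx m F" and m: "m \<ge> 2"
    and a1: "\<forall>\<^sub>F t in nhds 0. dq F 0 t = 0" and a0: "\<not> (\<forall>\<^sub>F t in nhds 0. F 0 t = 0)"
  obtains p q c m' H where "p > 0" "q > 0" "0 < m'" "m' < m" "germ2 H" "ordx m' H"
    "\<forall>\<^sub>F s in nhds 0. \<forall>z. F (s ^ p * (c + z)) (s ^ q) = s ^ (p * m) * H z s"
proof -
  define A where "A i = (dq ^^ i) F 0" for i
  have A_an: "A i analytic_on {0}" for i
    unfolding A_def using germ2_dq_pow[OF F(1)] germ2_analytic_t by blast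
  \<comment> \<open>Indices of the lower coefficients that do not vanish identically:
    \<open>0\<close> is among them by \<open>a0\<close>, and \<open>1\<close> is not by
    \<open>a1\<close>.\<close>
  define J where "J = {i. i < m \<and> \<not> (\<forall>\<^sub>F t in nhds 0. A i t = 0)}"
  have J: "finite J" "0 \<in> J" "1 \<notin> J" using m a0 a1 by (auto simp: J_def A_def)
  have "\<forall>i\<in>J. \<exists>d k. k analytic_on {0} \<and> k 0 \<noteq> 0 \<and> (\<forall>\<^sub>F t in nhds 0. A i t = t ^ d * k t)"
    using analytic_factor[OF A_an] unfolding J_def by blast
  then obtain d k where dk: "\<And>i. i \<in> J \<Longrightarrow> k i analytic_on {0}" "\<And>i. i \<in> J \<Longrightarrow> k i 0 \<noteq> 0"
      "\<And>i. i \<in> J \<Longrightarrow> \<forall>\<^sub>F t in nhds 0. A i t = t ^ d i * k i t"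
    by metis
  \<comment> \<open>The least slope \<open>d i / (m - i)\<close> belongs to the edge of the Newton
    polygon at the vertex \<open>(m, 0)\<close>; it equals \<open>p / q\<close> and gives the
    weights of the substitution.\<close>
  obtain i0 where i0: "i0 \<in> J" "\<And>i. i \<in> J \<Longrightarrow> real (d i0) / real (m - i0) \<le> real (d i) / real (m - i)"
    using ex_min_finite[of J "\<lambda>i. real (d i) / real (m - i)"] J by blast
  define p where "p = d i0"
  define q where "q = m - i0"
  have q: "q > 0" using i0(1) by (auto simp: q_def J_def)
  have p: "p > 0"
  proof (rule ccontr)
    assume "\<not> p > 0"
    then have "A i0 0 \<noteq> 0"
      using eventually_nhds_x_imp_x[OF dk(3)[OF i0(1)]] dk(2)[OF i0(1)] by (simp add: p_def)
    moreover have "A i0 0 = 0" using ordx_dq_pow(2)[OF F(2), of i0] i0(1) by (simp add: A_def J_def)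
    ultimately show False by simp
  qed
  have le: "p * (m - i) \<le> d i * q" if "i \<in> J" for i
  proof -
    have "real p * real (m - i) \<le> real (d i) * real q"
      using i0(2)[OF that] that q unfolding p_def[symmetric] q_def[symmetric]
      by (simp add: J_def divide_simps split: if_splits)
    then show ?thesis by (metis of_nat_le_iff of_nat_mult)
  qed
  \<comment> \<open>The subtraction is exact by \<open>le\<close>, and the exponent is
    \<open>0\<close> at \<open>i0\<close>: that coefficient survives at
    \<open>s = 0\<close>.\<close>
  define b where "b i s = (if i \<in> J then s ^ (d i * q - p * (m - i)) * k i (s ^ q) else 0)" for i s
  have kq: "(\<lambda>s. k i (s ^ q)) analytic_on {0}" if "i \<in> J" for i
    using analytic_on_compose_gen[of "\<lambda>s. s ^ q" "{0}" "k i" "{0}"] dk(1)[OF that] q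
    by (auto simp: o_def analytic_intros)
  have b_an: "b i analytic_on {0}" for i
    unfolding b_def by (cases "i \<in> J") (auto intro!: analytic_intros kq)
  have Ab: "\<forall>\<^sub>F s in nhds 0. A i (s ^ q) = s ^ (p * (m - i)) * b i s" if "i < m" for i
  proof (cases "i \<in> J")
    case True
    show ?thesis using eventually_nhds_0_power[OF dk(3)[OF True] q]
    proof eventually_elim
      case (elim s)
      have "(s ^ q) ^ d i = s ^ (p * (m - i)) * s ^ (d i * q - p * (m - i))"
        using le[OF True] by (simp flip: power_add power_mult add: mult.commute)
      then show ?case using elim True by (simp add: b_def)
    qed
  next
    case False
    then have "\<forall>\<^sub>F t in nhds 0. A i t = 0" using that by (auto simp: J_def)
    from eventually_nhds_0_power[OF this q] show ?thesis
      by eventually_elim (simp add: b_def False)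
  qed
  define K where "K = (dq ^^ m) F"
  have K: "germ2 K" "K 0 0 \<noteq> 0" using germ2_dq_pow[OF F(1)] ordx_dq_pow(3)[OF F(2)] by (auto simp: K_def)
  define G where "G z s = (\<Sum>i<m. b i s * z ^ i) + z ^ m * K (s ^ p * z) (s ^ q)" for z s
  \<comment> \<open>\<open>z\<close> is unrestricted, since \<open>dq_expand\<close> is an algebraic
    identity in \<open>x\<close>; only \<open>s\<close> has to be small.\<close>
  have FG: "\<forall>\<^sub>F s in nhds 0. \<forall>z. F (s ^ p * z) (s ^ q) = s ^ (p * m) * G z s"
  proof -
    have "\<forall>\<^sub>F s in nhds 0. \<forall>i\<in>{..<m}. A i (s ^ q) = s ^ (p * (m - i)) * b i s"
      by (intro eventually_ball_finite) (use Ab in auto)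
    then show ?thesis
    proof eventually_elim
      case (elim s)
      show ?case
      proof
        fix z
        have "(s ^ p * z) ^ i * A i (s ^ q) = s ^ (p * m) * (b i s * z ^ i)" if "i < m" for i
        proof -
          have "s ^ (p * m) = s ^ (p * i) * s ^ (p * (m - i))"
            using that by (simp flip: power_add distrib_left)
          then show ?thesis using elim that by (simp add: power_mult_distrib power_mult)
        qed
        then have "(\<Sum>i<m. A i (s ^ q) * (s ^ p * z) ^ i) = s ^ (p * m) * (\<Sum>i<m. b i s * z ^ i)"
          unfolding sum_distrib_left by (intro sum.cong) (auto simp: mult.commute)
        then show "F (s ^ p * z) (s ^ q) = s ^ (p * m) * G z s"
          using dq_expand[of F "s ^ p * z" "s ^ q" m] power_mult[of s p m]
          by (simp add: G_def A_def K_def distrib_left power_mult_distrib mult_ac)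

      qed
    qed
  qed
  \<comment> \<open>The restriction of \<open>G\<close> to \<open>s = 0\<close>, the polynomial
    attached to the edge. The remainder contributes the constant \<open>K 0 0\<close> in degree
    \<open>m\<close>.\<close>
  define P where "P = (\<Sum>i<m. monom (b i 0) i) + monom (K 0 0) m"
  have cP: "coeff P i = (if i < m then b i 0 else if i = m then K 0 0 else 0)" for i
    by (simp add: P_def coeff_sum)
  have degP: "degree P = m"
  proof (rule antisym)
    show "degree P \<le> m" by (rule degree_le) (simp add: cP)
    show "m \<le> degree P" by (rule le_degree) (simp add: cP K)
  qed
  have b0: "b i0 0 \<noteq> 0" using i0(1) dk(2)[OF i0(1)] q by (simp add: b_def p_def q_def zero_power)
  have "coeff P 1 = 0" using m J by (simp add: cP b_def)
  moreover have "i0 < m" using i0(1) by (simp add: J_def)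
  moreover have "coeff P i0 \<noteq> 0" using b0 calculation by (simp add: cP)
  ultimately obtain c m' Q where Q: "0 < m'" "m' < m" "P = [:-c,1:] ^ m' * Q" "poly Q c \<noteq> 0"
    by (rule poly_root_multiplicity_less[OF degP m])
  \<comment> \<open>Recentring at the root \<open>c\<close> turns its multiplicity \<open>m'\<close>
    into the order of \<open>H\<close> in \<open>z\<close>.\<close>
  define H where "H z s = G (c + z) s" for z s
  have "germ2 H"
  proof -
    have "germ2 (\<lambda>z s. K (s ^ p * (c + z)) (s ^ q))"
      by (rule germ2_compose[OF K(1)]) (use p q in \<open>auto intro!: germ2_intros analytic_intros simp: zero_power\<close>)
    then show ?thesis unfolding H_def G_def
      by (intro germ2_intros germ2_sum) (auto intro!: b_an)
  qed
  moreover have "ordx m' H"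
  proof -
    have "H z 0 = z ^ m' * poly Q (c + z)" for z
    proof -
      have "H z 0 = poly P (c + z)" using p q
        by (simp add: H_def G_def P_def poly_sum poly_monom zero_power mult.commute)
      then show ?thesis using Q(3) by simp
    qed
    moreover have "(\<lambda>z. poly Q (c + z)) analytic_on {0}"
      unfolding poly_altdef by (intro analytic_intros)
    ultimately show ?thesis unfolding ordx_def using Q(4) by (intro exI[of _ "\<lambda>z. poly Q (c + z)"]) auto
  qed
  moreover have "\<forall>\<^sub>F s in nhds 0. \<forall>z. F (s ^ p * (c + z)) (s ^ q) = s ^ (p * m) * H z s"
    using FG by eventually_elim (auto simp: H_def)
  ultimately show ?thesis using that p q Q by blast
qed

section \<open>Puiseux's theorem: existence of a root and complete factorization\<close>

theorem puiseux_root_exists: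
  assumes "germ2 F" "ordx m F" "m > 0"
  shows "\<exists>N>0. \<exists>\<phi>. \<phi> analytic_on {0} \<and> \<phi> 0 = 0 \<and> (\<forall>\<^sub>F t in nhds 0. F (\<phi> t) (t ^ N) = 0)"
  using assms
proof (induction m arbitrary: F rule: less_induct)
  case (less m F)
  show ?case
  proof (cases "m = 1")
    case True
    have "ordx (Suc 0) F" using less.prems True by simp
    then have "F 0 0 = 0" "dq F 0 0 \<noteq> 0"
      using ordx_dq_pow(2,3)[of "Suc 0" F] by (simp_all add: ordx_dq(2))
    from simple_root[OF less.prems(1) this] show ?thesis by (intro exI[of _ 1]) auto
  next
    case False
    then have m: "m \<ge> 2" using less.prems by simp
    have "ordx (m - 1) (dx F)" using ordx_dx[of "m - 1" F] less.prems by simp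
    from less.IH[OF _ germ2_dx[OF less.prems(1)] this] m
    obtain N \<theta> where \<theta>: "N > 0" "\<theta> analytic_on {0}" "\<theta> 0 = 0" "\<forall>\<^sub>F t in nhds 0. dx F (\<theta> t) (t ^ N) = 0"
      by auto
    define F1 where "F1 x t = F (\<theta> t + x) (t ^ N)" for x t
    have F1: "germ2 F1" unfolding F1_def
      by (rule germ2_compose[OF less.prems(1)]) (use \<theta> in \<open>auto intro!: germ2_intros analytic_intros simp: zero_power\<close>)
    have o1: "ordx m F1" by (rule ordx_cong[OF less.prems(2)]) (use \<theta> in \<open>simp add: F1_def zero_power\<close>)
    have d1: "\<forall>\<^sub>F t in nhds 0. dq F1 0 t = 0"
      using \<theta>(4) by eventually_elim (simp add: dx_eq_dq_shift F1_def dq_def)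
    show ?thesis
    \<comment> \<open>\<open>\<theta>\<close> may already be a root of \<open>F\<close>, necessarily
      a multiple one; the blow-up requires a constant coefficient that does not vanish
      identically.\<close>
    proof (cases "\<forall>\<^sub>F t in nhds 0. F1 0 t = 0")
      case True
      then have "\<forall>\<^sub>F t in nhds 0. F (\<theta> t) (t ^ N) = 0" by (simp add: F1_def)
      then show ?thesis using \<theta> by blast
    next
      case False
      obtain p q c m' H where H: "p > 0" "q > 0" "0 < m'" "m' < m"
        "germ2 H" "ordx m' H" "\<forall>\<^sub>F s in nhds 0. \<forall>z. F1 (s ^ p * (c + z)) (s ^ q) = s ^ (p * m) * H z s"
        by (rule blowup[OF F1 o1 m d1 False])
      from less.IH[OF H(4,5,6,3)] obtain N2 \<psi> where \<psi>: "N2 > 0" "\<psi> analytic_on {0}" "\<psi> 0 = 0"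
        "\<forall>\<^sub>F t in nhds 0. H (\<psi> t) (t ^ N2) = 0" by blast
      \<comment> \<open>Undoes the substitutions with \<open>s = t ^ N2\<close>: the root
        \<open>\<psi> t\<close> of \<open>H\<close> is recentred by \<open>c\<close>, scaled by
        \<open>s ^ p\<close> and translated by \<open>\<theta> (s ^ q)\<close>; the second variable
        becomes \<open>s ^ (q * N)\<close>.\<close>
      define \<phi> where "\<phi> t = \<theta> (t ^ (N2 * q)) + t ^ (N2 * p) * (c + \<psi> t)" for t
      have "(\<lambda>t. \<theta> (t ^ (N2 * q))) analytic_on {0}"
        using analytic_on_compose_gen[of "\<lambda>s. s ^ (N2 * q)" "{0}" \<theta> "{0}"] \<theta>(2) \<psi>(1) H(2)
        by (auto simp: o_def analytic_intros)
      then have "\<phi> analytic_on {0}" unfolding \<phi>_def by (intro analytic_intros \<psi>)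
      moreover have "\<phi> 0 = 0" using \<theta> \<psi> H by (simp add: \<phi>_def zero_power)
      moreover have "\<forall>\<^sub>F t in nhds 0. F (\<phi> t) (t ^ (N2 * q * N)) = 0"
        using eventually_nhds_0_power[OF H(7) \<psi>(1)] \<psi>(4)
      proof eventually_elim
        case (elim t)
        have "F1 ((t ^ N2) ^ p * (c + \<psi> t)) ((t ^ N2) ^ q) = 0" using elim by simp
        then show ?case by (simp add: F1_def \<phi>_def flip: power_mult)
      qed
      ultimately show ?thesis using H \<psi> \<theta> by (intro exI[of _ "N2 * q * N"] conjI exI[of _ \<phi>]) auto
    qed
  qed
qed

text \<open>After translation by a root, \<open>F1 0 t = 0\<close> near \<open>0\<close>, and
  \<open>dq_step\<close> divides by \<open>x\<close> exactly, lowering the order by one. The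
  quotient may ramify further, so the root already found is reparametrised.\<close>

theorem puiseux_factorization:
  assumes "germ2 F" "ordx m F"
  shows "\<exists>N>0. \<exists>\<phi> U. (\<forall>i<m. \<phi> i analytic_on {0} \<and> \<phi> i 0 = 0) \<and> germ2 U \<and> U 0 0 \<noteq> 0 \<and>
    near2 (\<lambda>x t. F x (t ^ N) = U x t * (\<Prod>i<m. x - \<phi> i t))"
  using assms
proof (induction m arbitrary: F)
  case 0
  then have "F 0 0 \<noteq> 0" using ordx_dq_pow(3)[of 0 F] by simp
  then show ?case using 0 by (intro exI[of _ 1] conjI exI[of _ "\<lambda>_ _. 0"] exI[of _ F])
    (auto simp: near2_def intro: exI[of _ 1])
next
  case (Suc m)
  from puiseux_root_exists[OF Suc.prems] obtain N \<phi> where \<phi>: "N > 0" "\<phi> analytic_on {0}" "\<phi> 0 = 0"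
    "\<forall>\<^sub>F t in nhds 0. F (\<phi> t) (t ^ N) = 0" by auto
  define F1 where "F1 x t = F (x + \<phi> t) (t ^ N)" for x t
  define F2 where "F2 x t = dq F1 (x - \<phi> t) t" for x t
  have F1: "germ2 F1" unfolding F1_def
    by (rule germ2_compose[OF Suc.prems(1)]) (use \<phi> in \<open>auto intro!: germ2_intros analytic_intros simp: zero_power\<close>)
  have o1: "ordx (Suc m) F1" by (rule ordx_cong[OF Suc.prems(2)]) (use \<phi> in \<open>simp add: F1_def zero_power\<close>)
  have F2: "germ2 F2" unfolding F2_def
    by (rule germ2_compose[OF germ2_dq[OF F1]]) (use \<phi> in \<open>auto intro!: germ2_intros analytic_intros simp: zero_power\<close>)
  have o2: "ordx m F2" by (rule ordx_cong[OF ordx_dq(1)[OF o1]]) (use \<phi> in \<open>simp add: F2_def\<close>)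
  have F2F: "\<forall>\<^sub>F t in nhds 0. \<forall>x. F x (t ^ N) = (x - \<phi> t) * F2 x t"
    using \<phi>(4)
  proof eventually_elim
    case (elim t)
    show ?case
    proof
      fix x
      have "F1 0 t = 0" using elim by (simp add: F1_def)
      then show "F x (t ^ N) = (x - \<phi> t) * F2 x t"
        using dq_step[of F1 "x - \<phi> t" t] by (simp add: F2_def) (simp add: F1_def)
    qed
  qed
  from Suc.IH[OF F2 o2] obtain N2 \<psi> U where \<psi>: "N2 > 0" "\<And>i. i < m \<Longrightarrow> \<psi> i analytic_on {0}"
    "\<And>i. i < m \<Longrightarrow> \<psi> i 0 = 0" "germ2 U" "U 0 0 \<noteq> 0"
    "near2 (\<lambda>x t. F2 x (t ^ N2) = U x t * (\<Prod>i<m. x - \<psi> i t))" by blast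
  define \<omega> where "\<omega> i = (if i < m then \<psi> i else (\<lambda>t. \<phi> (t ^ N2)))" for i
  have "(\<lambda>t. \<phi> (t ^ N2)) analytic_on {0}"
    using analytic_on_compose_gen[of "\<lambda>s. s ^ N2" "{0}" \<phi> "{0}"] \<phi>(2) \<psi>(1)
    by (auto simp: o_def analytic_intros)
  then have "\<omega> i analytic_on {0} \<and> \<omega> i 0 = 0" for i
    using \<psi> \<phi> by (auto simp: \<omega>_def zero_power)
  moreover have "near2 (\<lambda>x t. F x (t ^ (N2 * N)) = U x t * (\<Prod>i<Suc m. x - \<omega> i t))"
  proof -
    obtain e where e: "e > 0" "\<And>t x. norm t < e \<Longrightarrow> F x ((t ^ N2) ^ N) = (x - \<phi> (t ^ N2)) * F2 x (t ^ N2)"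
      using eventually_nhds_0_power[OF F2F \<psi>(1)] unfolding eventually_nhds_metric by auto
    have "near2 (\<lambda>x t. F2 x (t ^ N2) = U x t * (\<Prod>i<m. x - \<psi> i t) \<and> norm x < e \<and> norm t < e)"
      by (intro near2_conj \<psi> near2_norm_less e)
    then show ?thesis
      by (rule near2_mono) (use e in \<open>auto simp: \<omega>_def power_mult\<close>)
  qed
  ultimately show ?case using \<psi> \<phi> by (intro exI[of _ "N2 * N"] conjI exI[of _ \<omega>] exI[of _ U]) auto
qed

section \<open>Double power series of a germ\<close>

text \<open>The Weierstrass test over finite sets of indices gives holomorphy in each variable, and
  the sum of the majorants is the bound.\<close>

lemma germ2_cev2:
  assumes "conv2 h" shows "germ2 (cev2 h)"
proof -
  obtain r where r: "r > 0" "(\<lambda>(i,j). norm (h i j) * r ^ (i + j)) summable_on UNIV"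
    using assms unfolding conv2_def by blast
  define M where "M = (\<lambda>(i,j). norm (h i j) * r ^ (i + j))"
  have M: "M summable_on UNIV" using r by (simp add: M_def)
  have bd: "norm (h (fst p) (snd p) * x ^ fst p * t ^ snd p) \<le> M p" if "norm x \<le> r" "norm t \<le> r" for p x t
  proof -
    have "norm x ^ fst p * norm t ^ snd p \<le> r ^ fst p * r ^ snd p"
      using that r by (intro mult_mono power_mono) auto
    then show ?thesis unfolding norm_mult norm_power
      by (simp add: M_def split_beta power_add mult.assoc mult_left_mono)
  qed
  have cev: "cev2 h x t = (\<Sum>\<^sub>\<infinity>p\<in>UNIV. h (fst p) (snd p) * x ^ fst p * t ^ snd p)" for x t
    by (simp add: cev2_def case_prod_unfold)
  show ?thesis
  proof (rule germ2_I[OF r(1)])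
    fix t :: complex assume t: "norm t < r"
    have "uniform_limit (cball 0 r) (\<lambda>X x. \<Sum>p\<in>X. h (fst p) (snd p) * x ^ fst p * t ^ snd p)
        (\<lambda>x. cev2 h x t) (finite_subsets_at_top UNIV)"
      unfolding cev by (rule Weierstrass_m_test_general[OF _ M]) (use t bd in auto)
    then show "(\<lambda>x. cev2 h x t) holomorphic_on ball 0 r"
      by (rule holomorphic_uniform_limit[rotated])
         (auto intro!: always_eventually continuous_intros holomorphic_intros)
  next
    fix x :: complex assume x: "norm x < r"
    have "uniform_limit (cball 0 r) (\<lambda>X t. \<Sum>p\<in>X. h (fst p) (snd p) * x ^ fst p * t ^ snd p)
        (\<lambda>t. cev2 h x t) (finite_subsets_at_top UNIV)"
      unfolding cev by (rule Weierstrass_m_test_general[OF _ M]) (use x bd in auto)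
    then show "cev2 h x holomorphic_on ball 0 r"
      by (rule holomorphic_uniform_limit[rotated])
         (auto intro!: always_eventually continuous_intros holomorphic_intros)
  next
    fix x t :: complex assume "norm x < r" "norm t < r"
    then show "norm (cev2 h x t) \<le> infsum M UNIV"
      unfolding cev using bd
      by (intro norm_infsum_le[OF has_sum_infsum has_sum_infsum[OF M]])
         (auto intro!: abs_summable_summable Infinite_Sum.abs_summable_on_comparison_test'[OF M])
  qed
qed

lemma summable_on_geometric2:
  "(\<lambda>p::nat \<times> nat. (1/4) ^ fst p * (1/8::real) ^ snd p) summable_on UNIV"
proof -
  have g: "((\<lambda>i::nat. (c::real) ^ i) has_sum (1 / (1 - c))) UNIV" if "0 \<le> c" "c < 1" for c
    by (rule norm_summable_imp_has_sum) (use that in \<open>auto simp: summable_geometric geometric_sums\<close>)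
  have "(\<lambda>p::nat \<times> nat. (1/4) ^ fst p * (1/8::real) ^ snd p) summable_on Sigma UNIV (\<lambda>_. UNIV)"
  proof (rule summable_on_SigmaI)
    show "((\<lambda>y. (1/4) ^ fst (x, y) * (1/8::real) ^ snd (x, y)) has_sum ((1/4) ^ x * (1 / (1 - 1/8)))) UNIV" for x :: nat
      unfolding fst_conv snd_conv by (rule has_sum_cmult_right[OF g]) auto
    show "(\<lambda>x::nat. (1/4) ^ x * (1 / (1 - 1/8::real))) summable_on UNIV"
      using has_sum_imp_summable[OF g[of "1/4"]] by (intro summable_on_cmult_left) auto
  qed auto
  then show ?thesis by simp
qed

text \<open>The definition of multiplicity asks for a cofactor given by a double series
  \<open>cev2 h\<close>, whereas the factorization produces germs. Cauchy's inequality for the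
  coefficient functions \<open>A i\<close> on the disc of radius \<open>r/2\<close> gives absolute
  convergence.\<close>

lemma germ2_power_series:
  assumes "germ2 F"
  obtains h where "conv2 h" "near2 (\<lambda>x t. F x t = cev2 h x t)"
proof -
  obtain r M where r: "r > 0" "bsep r M F" using assms unfolding germ2_def by blast
  define A where "A i = (dq ^^ i) F 0" for i
  define h where "h i j = (deriv ^^ j) (A i) 0 / fact j" for i j
  have A: "A i holomorphic_on ball 0 r" "\<And>t. t \<in> ball 0 r \<Longrightarrow> norm (A i t) \<le> M * (4 / r) ^ i" for i
    using bsepD(2,3)[OF bsep_dq_pow[OF r(2,1), of i], of 0] r by (auto simp: A_def)
  have hb: "norm (h i j) \<le> M * (4 / r) ^ i / (r/2) ^ j" for i j
  proof -
    have "norm ((deriv ^^ j) (A i) 0) \<le> fact j * (M * (4 / r) ^ i) / (r/2) ^ j"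
    proof (rule Cauchy_inequality)
      show "A i holomorphic_on ball 0 (r/2)" by (rule holomorphic_on_subset[OF A(1)]) (use r in auto)
      show "continuous_on (cball 0 (r/2)) (A i)"
        by (rule holomorphic_on_imp_continuous_on[OF holomorphic_on_subset[OF A(1)]]) (use r in auto)
      show "norm (A i x) \<le> M * (4 / r) ^ i" if "norm (0 - x) = r/2" for x
        using A(2)[of x i] that r by auto
    qed (use r in auto)
    then show ?thesis by (simp add: h_def norm_divide field_simps)
  qed
  \<comment> \<open>With \<open>\<rho> = r/16\<close> the growth rates \<open>4 / r\<close> in
    \<open>x\<close> and \<open>2 / r\<close> in \<open>t\<close> become the ratios
    \<open>1/4\<close> and \<open>1/8\<close>.\<close>
  define \<rho> where "\<rho> = r/16"
  have hb2: "norm (h i j) * \<rho> ^ (i + j) \<le> M * ((1/4) ^ i * (1/8) ^ j)" for i j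
  proof -
    have "norm (h i j) * \<rho> ^ (i + j) \<le> M * (4 / r) ^ i / (r/2) ^ j * \<rho> ^ (i + j)"
      using hb[of i j] r by (intro mult_right_mono) (auto simp: \<rho>_def)
    also have "\<dots> = M * ((4 / r * \<rho>) ^ i * (\<rho> / (r/2)) ^ j)"
      by (simp add: power_add power_mult_distrib power_divide)
    also have "4 / r * \<rho> = 1/4" using r by (simp add: \<rho>_def)
    also have "\<rho> / (r/2) = 1/8" using r by (simp add: \<rho>_def)
    finally show ?thesis .
  qed
  have sM: "(\<lambda>p::nat \<times> nat. M * ((1/4) ^ fst p * (1/8::real) ^ snd p)) summable_on UNIV"
    by (intro summable_on_cmult_right summable_on_geometric2)
  have "(\<lambda>p. norm (norm (h (fst p) (snd p)) * \<rho> ^ (fst p + snd p))) summable_on UNIV"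
    by (rule Infinite_Sum.abs_summable_on_comparison_test'[OF sM]) (use hb2 r in \<open>auto simp: \<rho>_def\<close>)
  then have sh: "(\<lambda>(i,j). norm (h i j) * \<rho> ^ (i + j)) summable_on UNIV"
    using r by (simp add: case_prod_unfold \<rho>_def)
  then have "conv2 h" unfolding conv2_def using r by (intro exI[of _ \<rho>]) (auto simp: \<rho>_def)
  moreover have "F x t = cev2 h x t" if x: "norm x < \<rho>" and t: "norm t < \<rho>" for x t
  proof -
    have bd: "norm (h (fst p) (snd p) * x ^ fst p * t ^ snd p) \<le> norm (h (fst p) (snd p)) * \<rho> ^ (fst p + snd p)" for p
    proof -
      have "norm x ^ fst p * norm t ^ snd p \<le> \<rho> ^ fst p * \<rho> ^ snd p"
        using x t r by (intro mult_mono power_mono) (auto simp: \<rho>_def)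
      then show ?thesis unfolding norm_mult norm_power
        by (simp add: power_add mult.assoc mult_left_mono)
    qed
    have abs: "(\<lambda>p. norm (h (fst p) (snd p) * x ^ fst p * t ^ snd p)) summable_on UNIV"
      by (rule Infinite_Sum.abs_summable_on_comparison_test'[OF sh]) (use bd in \<open>auto simp: split_beta\<close>)
    have "(\<lambda>p. h (fst p) (snd p) * x ^ fst p * t ^ snd p) summable_on UNIV"
      by (rule abs_summable_summable[OF abs])
    then have sum: "(\<lambda>p. h (fst p) (snd p) * x ^ fst p * t ^ snd p) summable_on Sigma UNIV (\<lambda>_. UNIV)"
      by simp
    have tb: "t \<in> ball 0 r" using t r by (auto simp: \<rho>_def)
    have inner: "((\<lambda>j. h i j * x ^ i * t ^ j) has_sum (A i t * x ^ i)) UNIV" for i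
    proof -
      have "(\<lambda>j. h i j * t ^ j) sums A i t"
        using holomorphic_power_series[OF A(1) tb] by (simp add: h_def)
      then have s: "(\<lambda>j. x ^ i * (h i j * t ^ j)) sums (x ^ i * A i t)" by (rule sums_mult)
      have "(\<lambda>j. norm (h (fst (i,j)) (snd (i,j)) * x ^ fst (i,j) * t ^ snd (i,j))) summable_on UNIV"
        using Infinite_Sum.abs_summable_on_Sigma_iff[of "\<lambda>p. h (fst p) (snd p) * x ^ fst p * t ^ snd p" UNIV "\<lambda>_. UNIV"] abs
        by simp
      then have "summable (\<lambda>j. norm (h i j * x ^ i * t ^ j))"
        using summable_on_imp_summable by fastforce
      then show ?thesis using norm_summable_imp_has_sum[of "\<lambda>j. x ^ i * (h i j * t ^ j)"] s
        by (simp add: mult_ac)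
    qed
    have outer: "((\<lambda>i. A i t * x ^ i) has_sum F x t) UNIV"
    proof (rule norm_summable_imp_has_sum)
      have xr: "norm x \<le> r/8" using x r by (auto simp: \<rho>_def)
      show "(\<lambda>i. A i t * x ^ i) sums F x t"
        unfolding sums_def
      proof (rule LIM_zero_cancel[OF Lim_null_comparison])
        show "\<forall>\<^sub>F n in sequentially. norm ((\<Sum>i<n. A i t * x ^ i) - F x t) \<le> M * (1/2) ^ n"
          using dq_remainder_bound[OF r(2,1) xr tb] by (simp add: A_def norm_minus_commute)
        show "(\<lambda>n. M * (1/2) ^ n) \<longlonglongrightarrow> 0" by (rule geometric_null)
      qed
      show "summable (\<lambda>i. norm (A i t * x ^ i))"
      proof (rule summable_comparison_test)
        have "norm (A i t * x ^ i) \<le> M * (1/2) ^ i" for i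
        proof -
          have "norm (A i t) * norm x ^ i \<le> M * (4 / r) ^ i * (r/8) ^ i"
            using A(2)[OF tb, of i] xr order_trans[OF norm_ge_zero A(2)[OF tb, of i]]
            by (intro mult_mono power_mono) auto
          also have "\<dots> = M * (4 / r * (r/8)) ^ i" by (simp only: power_mult_distrib mult.assoc)
          also have "4 / r * (r/8) = 1/2" using r by simp
          finally show ?thesis by (simp add: norm_mult norm_power)
        qed
        then show "\<exists>N. \<forall>n\<ge>N. norm (norm (A n t * x ^ n)) \<le> M * (1/2) ^ n" by auto
        show "summable (\<lambda>n. M * (1/2) ^ n)" by (intro summable_mult summable_geometric) auto
      qed
    qed
    \<comment> \<open>Absolute summability allows summation over \<open>j\<close> inside the sum
      over \<open>i\<close>: the inner sum is the Taylor series of \<open>A i\<close>, the outer one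
      the expansion in divided differences.\<close>
    have "((\<lambda>p. h (fst p) (snd p) * x ^ fst p * t ^ snd p) has_sum F x t) (Sigma UNIV (\<lambda>_. UNIV))"
      by (rule has_sum_SigmaI[OF _ outer sum]) (use inner in auto)
    then show ?thesis by (simp add: cev2_def case_prod_unfold infsumI)
  qed
  then have "near2 (\<lambda>x t. F x t = cev2 h x t)"
    unfolding near2_def using r by (intro exI[of _ \<rho>]) (auto simp: \<rho>_def)
  ultimately show ?thesis using that by blast
qed

section \<open>Convergent one-variable series\<close>

definition conv1 :: "(nat \<Rightarrow> complex) \<Rightarrow> bool" where
  "conv1 c \<longleftrightarrow> (\<exists>r>0. summable (\<lambda>k. norm (c k) * r ^ k))"

definition sev :: "(nat \<Rightarrow> complex) \<Rightarrow> complex \<Rightarrow> complex" where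
  "sev c t = (\<Sum>k. c k * t ^ k)"

abbreviation rsev :: "(nat \<Rightarrow> complex) \<Rightarrow> real \<Rightarrow> complex" where
  "rsev c t \<equiv> sev c (cx t)"

lemma conv1_sums:
  assumes "conv1 c"
  shows "\<exists>r>0. \<forall>t. norm t < r \<longrightarrow> (\<lambda>k. c k * t ^ k) sums sev c t"
proof -
  obtain r where r: "r > 0" "summable (\<lambda>k. norm (c k) * r ^ k)" using assms conv1_def by blast
  have *: "summable (\<lambda>k. norm (c k) * norm t ^ k)" if "norm t < r" for t :: complex
    by (rule summable_comparison_test[OF _ r(2)]) (use that in \<open>auto intro!: exI[of _ 0] mult_left_mono power_mono\<close>)
  have "(\<lambda>k. c k * t ^ k) sums sev c t" if "norm t < r" for t
    unfolding sev_def
    by (intro summable_sums summable_norm_cancel[of "\<lambda>k. c k * t ^ k"])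
       (use *[OF that] in \<open>simp add: norm_mult norm_power\<close>)
  with r(1) show ?thesis by blast
qed

lemma conv1I_sums:
  assumes "r > 0" "\<And>t. norm t < r \<Longrightarrow> summable (\<lambda>k. c k * t ^ k)"
  shows "conv1 c"
  unfolding conv1_def
proof (intro exI conjI)
  have "summable (\<lambda>n. norm (c n * cx (r/4) ^ n))"
    by (rule powser_insidea[of c "cx (r/2)"]) (use assms in auto)
  then show "summable (\<lambda>k. norm (c k) * (r/4) ^ k)"
    using assms(1) by (simp add: norm_mult norm_power norm_divide)
qed (use assms in auto)

lemma conv1_analytic:
  assumes "conv1 c" shows "sev c analytic_on {0}"
proof -
  obtain r where r: "r > 0" "\<And>t. norm t < r \<Longrightarrow> (\<lambda>k. c k * t ^ k) sums sev c t"
    using conv1_sums[OF assms] by blast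
  have "sev c holomorphic_on ball 0 r"
    by (rule power_series_holomorphic[of 0 r c]) (use r in auto)
  then show ?thesis using r analytic_at_ball by blast
qed

lemma analytic_series:
  assumes "\<phi> analytic_on {0}"
  obtains c where "conv1 c" "c 0 = \<phi> 0" "\<forall>\<^sub>F t in nhds 0. \<phi> t = sev c t"
proof -
  obtain r where r: "r > 0" "\<phi> holomorphic_on ball 0 r" using assms analytic_at_ball by blast
  define c where "c k = (deriv ^^ k) \<phi> 0 / fact k" for k
  have s: "(\<lambda>k. c k * t ^ k) sums \<phi> t" if "norm t < r" for t
    using holomorphic_power_series[OF r(2), of t] that by (simp add: c_def)
  have "conv1 c" by (rule conv1I_sums[OF r(1)]) (use s sums_summable in blast)
  moreover have "\<forall>\<^sub>F t in nhds 0. \<phi> t = sev c t"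
    unfolding eventually_nhds_metric using r s by (intro exI[of _ r]) (auto simp: sev_def sums_iff)
  ultimately show ?thesis using that[of c] by (simp add: c_def)
qed

lemma conv1_diff:
  assumes "conv1 c" "conv1 c'"
  shows "conv1 (\<lambda>k. c k - c' k)" "\<forall>\<^sub>F t in nhds 0. sev c t - sev c' t = sev (\<lambda>k. c k - c' k) t"
proof -
  obtain r where r: "r > 0" "\<And>t. norm t < r \<Longrightarrow> (\<lambda>k. c k * t ^ k) sums sev c t"
    using conv1_sums[OF assms(1)] by blast
  obtain r' where r': "r' > 0" "\<And>t. norm t < r' \<Longrightarrow> (\<lambda>k. c' k * t ^ k) sums sev c' t"
    using conv1_sums[OF assms(2)] by blast
  have s: "(\<lambda>k. (c k - c' k) * t ^ k) sums (sev c t - sev c' t)" if "norm t < min r r'" for t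
    using sums_diff[OF r(2) r'(2), of t] that by (simp add: left_diff_distrib)
  show "conv1 (\<lambda>k. c k - c' k)" 
  proof (rule conv1I_sums)
    show "min r r' > 0" using r r' by simp
    show "summable (\<lambda>k. (c k - c' k) * t ^ k)" if "norm t < min r r'" for t
      by (rule sums_summable[OF s[OF that]])
  qed
  show "\<forall>\<^sub>F t in nhds 0. sev c t - sev c' t = sev (\<lambda>k. c k - c' k) t"
    unfolding eventually_nhds_metric using r r' s by (intro exI[of _ "min r r'"]) (auto simp: sev_def sums_iff)
qed

lemma conv1_shift:
  assumes "conv1 c" "\<And>k. k < d \<Longrightarrow> c k = 0"
  shows "conv1 (\<lambda>k. c (k + d))" "\<forall>\<^sub>F t in nhds 0. sev c t = t ^ d * sev (\<lambda>k. c (k + d)) t"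
proof -
  obtain r where r: "r > 0" "\<And>t. norm t < r \<Longrightarrow> (\<lambda>k. c k * t ^ k) sums sev c t"
    using conv1_sums[OF assms(1)] by blast
  have s: "(\<lambda>k. t ^ d * (c (k + d) * t ^ k)) sums sev c t" if "norm t < r" for t
  proof -
    have "(\<lambda>k. c (k + d) * t ^ (k + d)) sums (sev c t - (\<Sum>i<d. c i * t ^ i))"
      using sums_iff_shift[of "\<lambda>k. c k * t ^ k" d "sev c t - (\<Sum>i<d. c i * t ^ i)"] r(2)[OF that] by simp
    moreover have "(\<Sum>i<d. c i * t ^ i) = 0" using assms(2) by simp
    ultimately show ?thesis by (simp add: power_add mult_ac)
  qed
  have s': "summable (\<lambda>k. c (k + d) * t ^ k)" if "norm t < r" for t
  proof (cases "t = 0")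
    case True
    then show ?thesis using sums_summable[OF powser_sums_zero[of "\<lambda>k. c (k + d)"]] by simp
  next
    case False
    then show ?thesis using sums_summable[OF s[OF that]] by (simp add: summable_mult_D)
  qed
  show c: "conv1 (\<lambda>k. c (k + d))" by (rule conv1I_sums[OF r(1) s'])
  have "sev c t = t ^ d * sev (\<lambda>k. c (k + d)) t" if "norm t < r" for t
    using sums_unique2[OF s[OF that] sums_mult[OF summable_sums[OF s'[OF that]], of "t ^ d"]]
    by (simp add: sev_def)
  then show "\<forall>\<^sub>F t in nhds 0. sev c t = t ^ d * sev (\<lambda>k. c (k + d)) t"
    unfolding eventually_nhds_metric using r by (intro exI[of _ r]) auto
qed

lemma sev_0: "sev c 0 = c 0"
  unfolding sev_def by (rule sums_unique[symmetric]) (rule powser_sums_zero)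

lemma sev_leading:
  assumes "conv1 c" "\<And>k. k < d \<Longrightarrow> c k = 0"
  shows "((\<lambda>t. sev c t / t ^ d) \<longlongrightarrow> c d) (at 0)"
proof -
  have s: "conv1 (\<lambda>k. c (k + d))" "\<forall>\<^sub>F t in nhds 0. sev c t = t ^ d * sev (\<lambda>k. c (k + d)) t"
    using conv1_shift[OF assms(1), of d] assms(2) by blast+
  have "isCont (sev (\<lambda>k. c (k + d))) 0"
    by (rule analytic_at_imp_isCont[OF conv1_analytic[OF s(1)]])
  then have "((sev (\<lambda>k. c (k + d))) \<longlongrightarrow> c d) (at 0)" by (simp add: isCont_def sev_0)
  moreover have "\<forall>\<^sub>F t in at 0. sev (\<lambda>k. c (k + d)) t = sev c t / t ^ d"
    using s(2) unfolding eventually_at_filter by eventually_elim auto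
  ultimately show ?thesis by (rule Lim_transform_eventually)
qed

text \<open>The coefficients of \<open>c\<close> after \<open>t\<close> is replaced by
  \<open>t ^ M\<close>; it brings series with different ramification to a common parameter.\<close>

definition stretch :: "nat \<Rightarrow> (nat \<Rightarrow> complex) \<Rightarrow> nat \<Rightarrow> complex" where
  "stretch M c k = (if M dvd k then c (k div M) else 0)"

lemma sev_stretch: assumes "M > 0" shows "sev (stretch M c) t = sev c (t ^ M)"
proof -
  have "(\<Sum>k. stretch M c (M * k) * t ^ (M * k)) = (\<Sum>k. stretch M c k * t ^ k)"
    by (rule suminf_mono_reindex) (use assms in \<open>auto simp: strict_mono_def stretch_def\<close>)
  then show ?thesis using assms by (simp add: sev_def stretch_def power_mult)
qed

lemma conv1_stretch: assumes "conv1 c" "M > 0" shows "conv1 (stretch M c)"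
proof -
  obtain r where r: "r > 0" "\<And>t. norm t < r \<Longrightarrow> (\<lambda>k. c k * t ^ k) sums sev c t"
    using conv1_sums[OF assms(1)] by blast
  show ?thesis
  proof (rule conv1I_sums[of "min r 1"])
    fix t :: complex assume t: "norm t < min r 1"
    have "norm (t ^ M) \<le> norm t ^ 1" unfolding norm_power
      by (rule power_decreasing) (use t assms in auto)
    then have "(\<lambda>k. c k * (t ^ M) ^ k) sums sev c (t ^ M)" using t by (intro r) auto
    then have "summable (\<lambda>k. stretch M c (M * k) * t ^ (M * k))"
      using assms by (simp add: stretch_def power_mult sums_iff)
    then show "summable (\<lambda>k. stretch M c k * t ^ k)"
      by (rule summable_mono_reindex[THEN iffD1, rotated -1])
         (use assms in \<open>auto simp: strict_mono_def stretch_def\<close>)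
  qed (use r in auto)
qed

lemma sev_neq_eventually:
  assumes "conv1 c" "conv1 c'" "c \<noteq> c'"
  shows "\<forall>\<^sub>F t in at 0. sev c t \<noteq> sev c' t"
proof -
  define d where "d = (LEAST k. c k \<noteq> c' k)"
  have ex: "\<exists>k. c k \<noteq> c' k" using assms(3) by auto
  have d: "c d \<noteq> c' d" unfolding d_def by (rule LeastI_ex[OF ex])
  have "c k = c' k" if "k < d" for k using that not_less_Least d_def by blast
  then have "((\<lambda>t. sev (\<lambda>k. c k - c' k) t / t ^ d) \<longlongrightarrow> c d - c' d) (at 0)"
    by (intro sev_leading conv1_diff assms) auto
  then have "\<forall>\<^sub>F t in at 0. sev (\<lambda>k. c k - c' k) t / t ^ d \<noteq> 0"
    by (rule tendsto_imp_eventually_ne) (use d in auto)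
  moreover have "\<forall>\<^sub>F t in at 0. sev c t - sev c' t = sev (\<lambda>k. c k - c' k) t"
    using conv1_diff(2)[OF assms(1,2)] by (rule eventually_at_filter[THEN iffD2, OF eventually_mono]) auto
  ultimately show ?thesis by eventually_elim auto
qed

section \<open>Puiseux series\<close>

text \<open>Links coefficient sequences to functions of rational exponents: at
  \<open>y = t ^ N\<close> this Puiseux series is the power series \<open>c\<close> in
  \<open>t\<close>.\<close>

definition puis :: "nat \<Rightarrow> (nat \<Rightarrow> complex) \<Rightarrow> rat \<Rightarrow> complex" where
  "puis N c q = (if q * of_nat N \<in> \<nat> then c (nat \<lfloor>q * of_nat N\<rfloor>) else 0)"

lemma puis_frac: "N > 0 \<Longrightarrow> puis N c (of_nat k / of_nat N) = c k"
  by (simp add: puis_def)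

lemma puis_nz: 
  assumes "N > 0" "puis N c q \<noteq> 0" obtains k where "q = of_nat k / of_nat N" "c k \<noteq> 0"
proof -
  have "q * of_nat N \<in> \<nat>" using assms by (auto simp: puis_def split: if_splits)
  then obtain k where "q * of_nat N = of_nat k" by (auto simp: Nats_def)
  then have "q = of_nat k / of_nat N" using assms by (simp add: field_simps)
  then show ?thesis using that[of k] assms by (simp add: puis_frac)
qed

lemma puis_eqI:
  assumes "N > 0" "\<And>k. f (of_nat k / of_nat N) = c k" "\<And>q. f q \<noteq> 0 \<Longrightarrow> \<exists>k::nat. q = of_nat k / of_nat N"
  shows "f = puis N c"
proof
  fix q
  show "f q = puis N c q"
  proof (cases "\<exists>k::nat. q = of_nat k / of_nat N")
    case True then show ?thesis using assms by (auto simp: puis_frac)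
  next
    case False
    then have "f q = 0" "puis N c q = 0" using assms(3) puis_nz[OF assms(1)] by metis+
    then show ?thesis by simp
  qed
qed

lemma puis_inj: "N > 0 \<Longrightarrow> puis N c = puis N c' \<longleftrightarrow> c = c'"
  by (metis ext puis_frac)

lemma puis_stretch:
  assumes "N > 0" "M > 0" shows "puis (N * M) (stretch M c) = puis N c"
proof (rule puis_eqI[symmetric])
  fix k :: nat
  show "puis N c (of_nat k / of_nat (N * M)) = stretch M c k"
  proof (cases "M dvd k")
    case True
    then obtain j where "k = M * j" by blast
    then have "of_nat k / of_nat (N * M) = (of_nat j / of_nat N :: rat)" using assms by simp
    then have "puis N c (of_nat k / of_nat (N * M)) = c j" using puis_frac[OF assms(1)] by simp
    then show ?thesis using \<open>k = M * j\<close> assms by (simp add: stretch_def)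
  next
    case False
    have "puis N c (of_nat k / of_nat (N * M)) = 0"
    proof (rule ccontr)
      assume "\<not> ?thesis"
      then obtain j where "of_nat k / of_nat (N * M) = (of_nat j / of_nat N :: rat)"
        using puis_nz[OF assms(1)] by metis
      then have "(of_nat k :: rat) = of_nat (M * j)" using assms by (simp add: field_simps)
      then show False using False by (metis dvd_triv_left of_nat_eq_iff)
    qed
    then show ?thesis using False by (simp add: stretch_def)
  qed
next
  fix q assume "puis N c q \<noteq> 0"
  then obtain j where "q = of_nat j / of_nat N" using puis_nz[OF assms(1)] by metis
  then have "q = of_nat (j * M) / of_nat (N * M)" using assms by simp
  then show "\<exists>k::nat. q = of_nat k / of_nat (N * M)" by blast
qed (use assms in auto)

lemma puis_supp_puis: "N > 0 \<Longrightarrow> c 0 = 0 \<Longrightarrow> puis_supp (puis N c) N"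
  unfolding puis_supp_def by (metis puis_nz gr0I of_nat_0_less_iff zero_less_divide_iff)

lemma puis_conv_puis: "N > 0 \<Longrightarrow> puis_conv (puis N c) N \<longleftrightarrow> conv1 c"
  by (simp add: puis_conv_def conv1_def puis_frac)

lemma is_puiseux_puis: "N > 0 \<Longrightarrow> c 0 = 0 \<Longrightarrow> conv1 c \<Longrightarrow> is_puiseux (puis N c)"
  unfolding is_puiseux_def using puis_supp_puis puis_conv_puis by blast

lemma puis_supp_eq_puis:
  assumes "N > 0" "puis_supp \<gamma> N"
  shows "\<gamma> = puis N (\<lambda>k. \<gamma> (of_nat k / of_nat N))" "\<gamma> 0 = 0"
  using assms unfolding puis_supp_def by (auto intro!: puis_eqI)

text \<open>\<open>pev\<close> evaluates with a denominator picked by \<open>SOME\<close>, which may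
  differ from \<open>N\<close>. Both expansions are compared over the product of the two
  denominators, where equal series have equal coefficient sequences.\<close>

lemma pev_puis:
  assumes "N > 0" "c 0 = 0" "conv1 c" "t > 0"
  shows "pev (puis N c) (t ^ N) = rsev c t"
proof -
  define M where "M = pden (puis N c)"
  have M: "M > 0" "puis_supp (puis N c) M" "puis_conv (puis N c) M"
    using someI_ex[of "\<lambda>M. M > 0 \<and> puis_supp (puis N c) M \<and> puis_conv (puis N c) M"]
      is_puiseux_puis[OF assms(1-3)] unfolding M_def pden_def is_puiseux_def by blast+
  define c' where "c' k = puis N c (of_nat k / of_nat M)" for k
  have eq: "puis N c = puis M c'" unfolding c'_def by (rule puis_supp_eq_puis(1)[OF M(1,2)])
  have "puis (N * M) (stretch M c) = puis (N * M) (stretch N c')"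
    using puis_stretch[OF assms(1) M(1), of c] puis_stretch[OF M(1) assms(1), of c'] eq by (simp add: mult.commute)
  then have st: "stretch M c = stretch N c'" using puis_inj assms M by simp
  \<comment> \<open>The parameter for the common denominator: \<open>t = s ^ M\<close> and
    \<open>y = s ^ (N * M)\<close>.\<close>
  define s where "s = root M t"
  have s: "s > 0" "s ^ M = t" using assms M by (auto simp: s_def)
  have "(t ^ N) powr (real k / real M) = (s ^ N) ^ k" for k
  proof -
    have "(t ^ N) powr (real k / real M) = ((s powr real M) powr real N) powr (real k / real M)"
      using s assms(4) by (simp add: powr_realpow)
    also have "\<dots> = s powr (real N * real k)" using M by (simp add: powr_powr field_simps)
    also have "\<dots> = s powr real (N * k)" by simp
    also have "\<dots> = s ^ (N * k)" using s(1) by (rule powr_realpow)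
    finally show ?thesis by (simp add: power_mult)
  qed
  then have "pev (puis N c) (t ^ N) = sev c' (cx s ^ N)"
    unfolding pev_def M_def[symmetric] sev_def c'_def by simp
  also have "\<dots> = rsev (stretch M c) s" using st sev_stretch[OF assms(1)] by simp
  also have "\<dots> = rsev c t" using sev_stretch[OF M(1)] s by (metis of_real_power)
  finally show ?thesis .
qed

section \<open>Evaluation and orders along arcs\<close>

lemma ev2_eq_cev2: "ev2 a x y = cev2 (\<lambda>i j. cx (a i j)) x y"
  by (simp add: ev2_def cev2_def)

lemma germ2_ev2: assumes "conv2 a" shows "germ2 (ev2 a)"
proof -
  have "conv2 (\<lambda>i j. cx (a i j))" using assms by (simp add: conv2_def)
  from germ2_cev2[OF this] show ?thesis by (simp add: ev2_eq_cev2[abs_def])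
qed

lemma ev2_summable:
  fixes a :: "nat \<Rightarrow> nat \<Rightarrow> real"
  assumes "conv2 a"
  shows "\<exists>e>0. \<forall>x y. \<bar>x\<bar> < e \<longrightarrow> \<bar>y\<bar> < e \<longrightarrow> (\<lambda>p. a (fst p) (snd p) * x ^ fst p * y ^ snd p) summable_on UNIV"
proof -
  obtain r where r: "r > 0" "(\<lambda>(i,j). norm (a i j) * r ^ (i + j)) summable_on UNIV"
    using assms unfolding conv2_def by blast
  have "(\<lambda>p. a (fst p) (snd p) * x ^ fst p * y ^ snd p) summable_on UNIV" if "\<bar>x\<bar> < r" "\<bar>y\<bar> < r" for x y
  proof (rule abs_summable_summable, rule Infinite_Sum.abs_summable_on_comparison_test'[OF r(2)])
    fix p :: "nat \<times> nat"
    have "\<bar>x\<bar> ^ fst p * \<bar>y\<bar> ^ snd p \<le> r ^ fst p * r ^ snd p"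
      using that r by (intro mult_mono power_mono) auto
    then show "norm (a (fst p) (snd p) * x ^ fst p * y ^ snd p) \<le> (case p of (i, j) \<Rightarrow> norm (a i j) * r ^ (i + j))"
      by (simp add: abs_mult power_abs power_add mult.assoc mult_left_mono case_prod_unfold)
  qed
  then show ?thesis using r by blast
qed

text \<open>\<open>ev2\<close> is a polymorphic infinite sum, so its real and complex instances are
  separate sums; they are linked where the real family is summable.\<close>

lemma ev2_of_real:
  assumes "conv2 a"
  shows "\<exists>e>0. \<forall>x y. \<bar>x\<bar> < e \<longrightarrow> \<bar>y\<bar> < e \<longrightarrow>
    ev2 a (cx x) (cx y) = cx (ev2 a x y)"
proof -
  obtain e where e: "e > 0" "\<forall>x y. \<bar>x\<bar> < e \<longrightarrow> \<bar>y\<bar> < e \<longrightarrow> (\<lambda>p. a (fst p) (snd p) * x ^ fst p * y ^ snd p) summable_on UNIV"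
    using ev2_summable[OF assms] by blast
  have "ev2 a (cx x) (cx y) = cx (ev2 a x y)" if "\<bar>x\<bar> < e" "\<bar>y\<bar> < e" for x y
  proof -
    have "((\<lambda>p. a (fst p) (snd p) * x ^ fst p * y ^ snd p) has_sum ev2 a x y) UNIV"
      using has_sum_infsum[of "\<lambda>p. a (fst p) (snd p) * x ^ fst p * y ^ snd p" UNIV] e that
      by (simp add: ev2_def case_prod_unfold)
    from infsumI[OF has_sum_of_real[OF this, where 'a=complex]] show ?thesis
      by (simp add: ev2_def case_prod_unfold)
  qed
  then show ?thesis using e by blast
qed

lemma ev2_on_axis:
  "ev2 a x 0 = (\<Sum>\<^sub>\<infinity>i\<in>UNIV. of_real (a i 0) * x ^ i)"
proof -
  have "ev2 a x 0 = (\<Sum>\<^sub>\<infinity>p\<in>range (\<lambda>i. (i, 0)). of_real (a (fst p) (snd p)) * x ^ fst p * 0 ^ snd p)"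
    unfolding ev2_def case_prod_unfold
    by (rule infsum_cong_neutral) (auto simp: image_iff power_0_left split: if_splits)
  also have "\<dots> = (\<Sum>\<^sub>\<infinity>i\<in>UNIV. of_real (a i 0) * x ^ i)"
    by (subst infsum_reindex) (auto simp: inj_on_def o_def)
  finally show ?thesis .
qed

lemma ordx_ev2:
  assumes "conv2 a" "a m 0 \<noteq> 0" "\<And>i. i < m \<Longrightarrow> a i 0 = 0"
  shows "ordx m (ev2 a)"
proof -
  define c where "c i = cx (a i 0)" for i
  obtain r where r: "r > 0" "(\<lambda>(i,j). norm (a i j) * r ^ (i + j)) summable_on UNIV"
    using assms unfolding conv2_def by blast
  have "(\<lambda>(i,j). norm (a i j) * r ^ (i + j)) summable_on range (\<lambda>i. (i, 0))"
    by (rule summable_on_subset_banach[OF r(2)]) auto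
  then have "(\<lambda>i. norm (a i 0) * r ^ i) summable_on UNIV"
    by (subst (asm) summable_on_reindex) (auto simp: inj_on_def o_def)
  then have sr: "summable (\<lambda>i. norm (a i 0) * r ^ i)" by (rule summable_on_imp_summable)
  then have c: "conv1 c" unfolding conv1_def c_def using r by auto
  have "ev2 a x 0 = sev c x" if "norm x < r" for x
  proof -
    have "summable (\<lambda>i. norm (c i * x ^ i))"
      by (rule summable_comparison_test[OF _ sr])
         (use that in \<open>auto simp: c_def norm_mult norm_power intro!: exI[of _ 0] mult_left_mono power_mono\<close>)
    then have "((\<lambda>i. c i * x ^ i) has_sum sev c x) UNIV"
      unfolding sev_def by (intro norm_summable_imp_has_sum summable_sums) (auto intro: summable_norm_cancel)
    then show ?thesis by (simp add: ev2_on_axis infsumI c_def)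
  qed
  then have ev: "\<forall>\<^sub>F x in nhds 0. ev2 a x 0 = sev c x"
    unfolding eventually_nhds_metric using r by (intro exI[of _ r]) auto
  have s: "conv1 (\<lambda>k. c (k + m))" "\<forall>\<^sub>F t in nhds 0. sev c t = t ^ m * sev (\<lambda>k. c (k + m)) t"
    using conv1_shift[OF c, of m] assms(3) by (auto simp: c_def)
  have "\<forall>\<^sub>F x in nhds 0. ev2 a x 0 = x ^ m * sev (\<lambda>k. c (k + m)) x"
    using ev s(2) by eventually_elim simp
  moreover have "sev (\<lambda>k. c (k + m)) 0 \<noteq> 0" using assms by (simp add: sev_0 c_def)
  ultimately show ?thesis unfolding ordx_def using conv1_analytic[OF s(1)] by blast
qed

text \<open>\<open>y = t ^ N\<close> is an increasing bijection of the positive half line, so germs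
  at \<open>0\<close> from the right may be tested in either parameter.\<close>

lemma eventually_at_right_power:
  assumes "N > 0"
  shows "(\<forall>\<^sub>F y in at_right 0. P y) \<longleftrightarrow> (\<forall>\<^sub>F t in at_right (0::real). P (t ^ N))"
proof
  assume "\<forall>\<^sub>F y in at_right 0. P y"
  then obtain b where b: "b > 0" "\<And>y. y > 0 \<Longrightarrow> y < b \<Longrightarrow> P y"
    unfolding eventually_at_right_field by blast
  have "P (t ^ N)" if "t > 0" "t < root N b" for t
  proof (rule b(2))
    show "t ^ N < b" using that assms b by (metis less_le power_strict_mono real_root_pow_pos2 real_root_pow_pos)
  qed (use that in auto)
  then show "\<forall>\<^sub>F t in at_right 0. P (t ^ N)" unfolding eventually_at_right_field
    using b assms by (intro exI[of _ "root N b"]) auto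
next
  assume "\<forall>\<^sub>F t in at_right 0. P (t ^ N)"
  then obtain b where b: "b > 0" "\<And>y. y > 0 \<Longrightarrow> y < b \<Longrightarrow> P (y ^ N)"
    unfolding eventually_at_right_field by blast
  have "P y" if "y > 0" "y < b ^ N" for y
  proof -
    have "root N y < b" using that assms b
      by (metis real_root_less_iff real_root_power_cancel less_imp_le)
    then have "P (root N y ^ N)" using that assms by (intro b) auto
    then show ?thesis using that assms by simp
  qed
  then show "\<forall>\<^sub>F t in at_right 0. P t" unfolding eventually_at_right_field
    using b assms by (intro exI[of _ "b ^ N"]) auto
qed

lemma tendsto_at_right_power:
  assumes "N > 0"
  shows "(f \<longlongrightarrow> l) (at_right 0) \<longleftrightarrow> ((\<lambda>t. f (t ^ N)) \<longlongrightarrow> l) (at_right (0::real))"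
  unfolding tendsto_def by (intro all_cong1 imp_cong refl eventually_at_right_power[OF assms])

lemma eventually_at_right_of_real:
  assumes "\<forall>\<^sub>F t in at (0::complex). P t"
  shows "\<forall>\<^sub>F t in at_right (0::real). P (cx t)"
proof -
  obtain d where "d > 0" "\<And>t. t \<noteq> 0 \<Longrightarrow> norm t < d \<Longrightarrow> P t"
    using assms unfolding eventually_at by auto
  then show ?thesis unfolding eventually_at_right_field by (intro exI[of _ d]) auto
qed

lemma tendsto_at_right_of_real:
  assumes "(f \<longlongrightarrow> l) (at (0::complex))"
  shows "((\<lambda>t. f (cx t)) \<longlongrightarrow> l) (at_right 0)"
  using assms unfolding tendsto_def using eventually_at_right_of_real by fast

lemma conv1_tendsto_0:
  assumes "conv1 c" "c 0 = 0"
  shows "((\<lambda>t. rsev c t) \<longlongrightarrow> 0) (at_right 0)"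
  using tendsto_at_right_of_real[OF sev_leading[OF assms(1), of 0]] assms(2) by simp

text \<open>The order in \<open>t\<close> of the difference of the two series. It is unspecified for
  equal sequences; the truncated variants below are defined so as to make sense there too.\<close>

definition contact :: "(nat \<Rightarrow> complex) \<Rightarrow> (nat \<Rightarrow> complex) \<Rightarrow> nat" where
  "contact c c' = (LEAST k. c k \<noteq> c' k)"

lemma contact:
  assumes "c \<noteq> c'"
  shows "c (contact c c') \<noteq> c' (contact c c')" "k < contact c c' \<Longrightarrow> c k = c' k"
proof -
  have ex: "\<exists>k. c k \<noteq> c' k" using assms by auto
  show "c (contact c c') \<noteq> c' (contact c c')" unfolding contact_def by (rule LeastI_ex[OF ex])
  show "k < contact c c' \<Longrightarrow> c k = c' k"
    using not_less_Least[of k "\<lambda>k. c k \<noteq> c' k"] by (simp add: contact_def)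
qed

lemma contact_eqI: "c k \<noteq> c' k \<Longrightarrow> (\<And>j. j < k \<Longrightarrow> c j = c' j) \<Longrightarrow> contact c c' = k"
  unfolding contact_def by (rule Least_equality) (auto intro: leI)

lemma sev_diff_leading:
  assumes "conv1 c" "conv1 c'" "c \<noteq> c'"
  shows "((\<lambda>t. (sev c t - sev c' t) / t ^ contact c c') \<longlongrightarrow> c (contact c c') - c' (contact c c')) (at 0)"
proof -
  have "((\<lambda>t. sev (\<lambda>k. c k - c' k) t / t ^ contact c c') \<longlongrightarrow> c (contact c c') - c' (contact c c')) (at 0)"
    by (rule sev_leading) (auto intro: conv1_diff assms simp: contact(2)[OF assms(3)])
  moreover have "\<forall>\<^sub>F t in at 0. sev (\<lambda>k. c k - c' k) t / t ^ contact c c' = (sev c t - sev c' t) / t ^ contact c c'"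
    using conv1_diff(2)[OF assms(1,2)] unfolding eventually_at_filter by (auto elim: eventually_mono)
  ultimately show ?thesis by (rule Lim_transform_eventually)
qed

text \<open>\<open>mc k c c'\<close> is the contact order of \<open>c\<close> and \<open>c'\<close> truncated at \<open>k\<close>.\<close>

definition mc :: "nat \<Rightarrow> (nat \<Rightarrow> complex) \<Rightarrow> (nat \<Rightarrow> complex) \<Rightarrow> nat" where
  "mc k c c' = (\<Sum>j<k. if \<forall>i\<le>j. c i = c' i then 1 else 0)"

lemma mc_agree: assumes "\<And>j. j < k \<Longrightarrow> c j = c' j" shows "mc k c c' = k"
proof -
  have "mc k c c' = (\<Sum>j<k. 1)" unfolding mc_def by (rule sum.cong) (use assms in auto)
  then show ?thesis by simp
qed

lemma mc_contact: assumes "c \<noteq> c'" shows "mc k c c' = min k (contact c c')"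
proof (induction k)
  case (Suc k)
  have "(\<forall>i\<le>k. c i = c' i) \<longleftrightarrow> k < contact c c'"
    using contact[OF assms] by (metis le_less_trans not_le)
  then show ?case using Suc by (simp add: mc_def)
qed (simp add: mc_def)

text \<open>If two exponents both gave nonzero limits, their quotient would make a power of
  \<open>y\<close> converge to a nonzero number at \<open>0\<close>, which forces its exponent to
  vanish. Hence the description in \<open>ord0\<close> is definite.\<close>

lemma ord0_eqI:
  assumes "((\<lambda>y. F y / cx (y powr q)) \<longlongrightarrow> c) (at_right 0)" "c \<noteq> 0"
  shows "ord0 F = q"
  unfolding ord0_def
proof (rule the_equality)
  fix p assume "\<exists>c. c \<noteq> 0 \<and> ((\<lambda>y. F y / cx (y powr p)) \<longlongrightarrow> c) (at_right 0)"
  then obtain c' where c': "c' \<noteq> 0" "((\<lambda>y. F y / cx (y powr p)) \<longlongrightarrow> c') (at_right 0)" by blast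
  have lim: "((\<lambda>y. (F y / cx (y powr p)) / (F y / cx (y powr q))) \<longlongrightarrow> c' / c) (at_right 0)"
    using c' assms by (intro tendsto_intros)
  have nz: "\<forall>\<^sub>F y in at_right 0. F y / cx (y powr q) \<noteq> 0"
    using tendsto_imp_eventually_ne[OF assms] .
  have "\<forall>\<^sub>F y in at_right 0. norm ((F y / cx (y powr p)) / (F y / cx (y powr q))) = y powr (q - p)"
    using nz eventually_at_right_less[of 0]
    by eventually_elim (simp add: norm_divide powr_diff)
  then have lim2: "((\<lambda>y. y powr (q - p)) \<longlongrightarrow> norm (c' / c)) (at_right 0)"
    by (rule Lim_transform_eventually[OF tendsto_norm[OF lim]])
  show "p = q"
  proof (rule ccontr)
    assume "p \<noteq> q"
    then consider "q - p > 0" | "p - q > 0" by linarith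
    then show False
    proof cases
      case 1
      have "((\<lambda>y. y powr (q - p)) \<longlongrightarrow> 0) (at_right (0::real))"
        using 1 by (intro tendsto_eq_intros) (auto simp: eventually_at_right_less eventually_mono[OF eventually_at_right_less])
      then have "norm (c' / c) = 0" by (intro tendsto_unique[OF _ lim2]) auto
      then show False using c' assms by simp
    next
      case 2
      have "((\<lambda>y. y powr (p - q)) \<longlongrightarrow> 0) (at_right (0::real))"
        using 2 by (intro tendsto_eq_intros) (auto simp: eventually_at_right_less eventually_mono[OF eventually_at_right_less])
      then have "((\<lambda>y. y powr (q - p) * y powr (p - q)) \<longlongrightarrow> norm (c' / c) * 0) (at_right 0)"
        by (intro tendsto_mult lim2)
      moreover have "\<forall>\<^sub>F y in at_right (0::real). y powr (q - p) * y powr (p - q) = 1"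
        using eventually_at_right_less[of 0] by eventually_elim (simp flip: powr_add)
      ultimately have "((\<lambda>y. 1) \<longlongrightarrow> norm (c' / c) * 0) (at_right (0::real))"
        by (rule Lim_transform_eventually)
      then show False using tendsto_unique[of "at_right (0::real)" "\<lambda>_. 1::real" 1 0] by auto
    qed
  qed
qed (use assms in blast)

section \<open>Germs in factored form\<close>

lemma near2_power: assumes "near2 P" "k > 0" shows "near2 (\<lambda>x t. P x (t ^ k))"
proof -
  obtain e where e: "e > 0" "\<And>x t. norm x < e \<Longrightarrow> norm t < e \<Longrightarrow> P x t"
    using assms unfolding near2_def by blast
  have "P x (t ^ k)" if "norm x < min e 1" "norm t < min e 1" for x t
  proof -
    have "norm (t ^ k) \<le> norm t ^ 1" unfolding norm_power
      by (rule power_decreasing) (use that assms in auto)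
    then show ?thesis using that e by auto
  qed
  then show ?thesis unfolding near2_def using e by (intro exI[of _ "min e 1"]) auto
qed

lemma near2_of_eventually: 
  assumes "\<forall>\<^sub>F t in nhds 0. P t" shows "near2 (\<lambda>x t. P t)"
  using assms unfolding near2_def eventually_nhds_metric by auto

lemma near2_arc:
  assumes "near2 P" "(X \<longlongrightarrow> 0) (at_right (0::real))"
  shows "\<forall>\<^sub>F t in at_right 0. P (X t) (cx t)"
proof -
  obtain e where e: "e > 0" "\<And>x t. norm x < e \<Longrightarrow> norm t < e \<Longrightarrow> P x t"
    using assms unfolding near2_def by blast
  have "\<forall>\<^sub>F t in at_right 0. norm (X t) < e"
    using assms(2) e(1) by (auto simp: tendsto_iff dist_norm)
  moreover have "\<forall>\<^sub>F t in at_right (0::real). 0 < t \<and> t < e"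
    using e(1) unfolding eventually_at_right_field by blast
  ultimately show ?thesis by eventually_elim (use e in auto)
qed

lemma germ2_tendsto_arc:
  assumes "germ2 F" "(X \<longlongrightarrow> 0) (at_right (0::real))"
  shows "((\<lambda>t. F (X t) (cx t)) \<longlongrightarrow> F 0 0) (at_right 0)"
  using near2_arc[OF germ2_near[OF assms(1)] assms(2)] by (auto simp: tendsto_iff dist_norm)

lemma germ2_isCont_x:
  assumes "germ2 F" shows "near2 (\<lambda>x t. isCont (\<lambda>x. F x t) x)"
proof -
  obtain r M where r: "r > 0" "bsep r M F" using assms unfolding germ2_def by blast
  have "isCont (\<lambda>x. F x t) x" if "norm x < r" "norm t < r" for x t
    using holomorphic_on_imp_continuous_on[OF bsepD(1)[OF r(2), of t]] that
    by (auto simp: continuous_on_eq_continuous_at)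
  then show ?thesis unfolding near2_def using r by blast
qed

text \<open>Cancelling the smaller power leaves a limit that is both \<open>0\<close> and a nonzero
  value. It serves to compare two factorizations in \<open>x\<close> at a fixed parameter.\<close>

lemma vanishing_order_unique:
  fixes A B :: "complex \<Rightarrow> complex"
  assumes "isCont A p" "isCont B p" "A p \<noteq> 0" "B p \<noteq> 0"
    "\<forall>\<^sub>F x in nhds p. (x - p) ^ k * A x = (x - p) ^ k' * B x"
  shows "k = k'"
proof -
  have *: False if "isCont A p" "isCont B p" "A p \<noteq> 0"
    "\<forall>\<^sub>F x in nhds p. (x - p) ^ k * A x = (x - p) ^ k' * B x" "k < k'" for A B :: "complex \<Rightarrow> complex" and k k'
  proof -
    have "\<forall>\<^sub>F x in at p. (x - p) ^ (k' - k) * B x = A x"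
      using that(4) unfolding eventually_at_filter
    proof eventually_elim
      case (elim x)
      have "(x - p) ^ k' = (x - p) ^ k * (x - p) ^ (k' - k)" using that(5) by (simp flip: power_add)
      then show ?case using elim by auto
    qed
    moreover have "((\<lambda>x. (x - p) ^ (k' - k) * B x) \<longlongrightarrow> (p - p) ^ (k' - k) * B p) (at p)"
      using that(2) by (intro tendsto_intros) (auto simp: isCont_def)
    ultimately have "(A \<longlongrightarrow> (p - p) ^ (k' - k) * B p) (at p)" by (rule Lim_transform_eventually[rotated])
    then have "(A \<longlongrightarrow> 0) (at p)" using that(5) by (simp add: zero_power)
    then show False using that(1,3) tendsto_unique[of "at p" A] by (auto simp: isCont_def)
  qed
  have sym: "\<forall>\<^sub>F x in nhds p. (x - p) ^ k' * B x = (x - p) ^ k * A x"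
    using assms(5) by eventually_elim simp
  show ?thesis using *[OF assms(1,2,3,5)] *[OF assms(2,1,4) sym] by (metis linorder_neqE_nat)
qed

lemma not_eventually_at_right:
  assumes "\<forall>\<^sub>F t in at_right (0::real). \<not> P t" shows "\<not> (\<forall>\<^sub>F t in at_right 0. P t)"
proof
  assume "\<forall>\<^sub>F t in at_right 0. P t"
  with assms have "\<forall>\<^sub>F t in at_right (0::real). False" by eventually_elim auto
  then show False by simp
qed

text \<open>The outcome of the factorization, with series in place of analytic functions. A root is
  repeated in the list \<open>c\<close> according to its multiplicity.\<close>

locale factored =
  fixes a :: "nat \<Rightarrow> nat \<Rightarrow> real" and N m :: nat and c :: "nat \<Rightarrow> nat \<Rightarrow> complex"
    and U :: "complex \<Rightarrow> complex \<Rightarrow> complex"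
  assumes N: "N > 0" and c_conv: "\<And>i. i < m \<Longrightarrow> conv1 (c i)" and c0: "\<And>i. i < m \<Longrightarrow> c i 0 = 0"
    and U: "germ2 U" "U 0 0 \<noteq> 0"
    and fac: "near2 (\<lambda>x t. ev2 a x (t ^ N) = U x t * (\<Prod>i<m. x - sev (c i) t))"
begin

lemma fac_arc:
  assumes "(X \<longlongrightarrow> 0) (at_right (0::real))"
  shows "\<forall>\<^sub>F t in at_right 0. ev2 a (X t) (cx (t ^ N)) =
    U (X t) (cx t) * (\<Prod>i<m. X t - rsev (c i) t)"
  using near2_arc[OF fac assms] by (simp add: of_real_power)

lemma U_arc_nz:
  assumes "(X \<longlongrightarrow> 0) (at_right (0::real))"
  shows "\<forall>\<^sub>F t in at_right 0. U (X t) (cx t) \<noteq> 0"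
  using tendsto_imp_eventually_ne[OF germ2_tendsto_arc[OF U(1) assms] U(2)] .

text \<open>\<open>N\<close> may be replaced by any positive multiple, so two germs can be given a
  common parameter \<open>t\<close>.\<close>

lemma refine:
  assumes "k > 0" shows "factored a (N * k) m (\<lambda>i. stretch k (c i)) (\<lambda>x t. U x (t ^ k))"
proof
  show "germ2 (\<lambda>x t. U x (t ^ k))"
    by (rule germ2_compose[OF U(1)]) (use assms in \<open>auto intro!: germ2_intros analytic_intros simp: zero_power\<close>)
  show "near2 (\<lambda>x t. ev2 a x (t ^ (N * k)) = U x (t ^ k) * (\<Prod>i<m. x - sev (stretch k (c i)) t))"
    by (rule near2_mono[OF near2_power[OF fac assms]])
       (simp add: sev_stretch[OF assms] mult.commute flip: power_mult)
qed (use N assms c_conv c0 U in \<open>auto simp: conv1_stretch stretch_def zero_power\<close>)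

text \<open>A candidate \<open>\<gamma>\<close> comes with its own denominator \<open>M\<close> and
  is compared with the roots over \<open>N * M\<close>. Along it a product of finitely many
  differences vanishes for small parameters, while distinct convergent series differ on a punctured
  neighbourhood.\<close>

lemma np_root_iff: "np_root a \<gamma> \<longleftrightarrow> (\<exists>i<m. \<gamma> = puis N (c i))"
proof
  assume "np_root a \<gamma>"
  then obtain M where M: "M > 0" "puis_supp \<gamma> M" "puis_conv \<gamma> M" and
    z: "\<forall>\<^sub>F y in at_right 0. ev2 a (pev \<gamma> y) (cx y) = 0"
    unfolding np_root_def is_puiseux_def by blast
  define d where "d k = \<gamma> (of_nat k / of_nat M)" for k
  have \<gamma>: "\<gamma> = puis M d" "d 0 = 0" using puis_supp_eq_puis[OF M(1,2)] by (simp_all add: d_def[abs_def])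
  have d: "conv1 d" using M puis_conv_puis \<gamma> by metis
  interpret R: factored a "N * M" m "\<lambda>i. stretch M (c i)" "\<lambda>x t. U x (t ^ M)" by (rule refine[OF M(1)])
  have sd: "conv1 (stretch N d)" "stretch N d 0 = 0" using conv1_stretch[OF d N] \<gamma> by (auto simp: stretch_def)
  have pe: "pev \<gamma> (s ^ (N * M)) = rsev (stretch N d) s" if "s > 0" for s
    using pev_puis[of "N * M" "stretch N d" s] that N M sd puis_stretch[OF M(1) N, of d] \<gamma>
    by (simp add: mult.commute)
  note X = conv1_tendsto_0[OF sd]
  have "\<forall>\<^sub>F s in at_right 0. (\<Prod>i<m. rsev (stretch N d) s - rsev (stretch M (c i)) s) = 0"
    using R.fac_arc[OF X] R.U_arc_nz[OF X] eventually_at_right_less[of 0]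
      eventually_at_right_power[OF R.N, THEN iffD1, OF z]
    by (eventually_elim) (use pe R.N in auto)
  have "\<exists>i<m. stretch N d = stretch M (c i)"
  proof (rule ccontr)
    assume "\<not> ?thesis"
    then have "\<forall>i\<in>{..<m}. \<forall>\<^sub>F s in at_right 0. rsev (stretch N d) s \<noteq> rsev (stretch M (c i)) s"
      using sev_neq_eventually[OF sd(1) R.c_conv] eventually_at_right_of_real by blast
    then have "\<forall>\<^sub>F s in at_right 0. \<forall>i\<in>{..<m}. rsev (stretch N d) s \<noteq> rsev (stretch M (c i)) s"
      by (intro eventually_ball_finite) auto
    with \<open>\<forall>\<^sub>F s in at_right 0. (\<Prod>i<m. _ i s) = 0\<close>
    have "\<forall>\<^sub>F s in at_right (0::real). False" by eventually_elim auto
    then show False by simp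
  qed
  then obtain i where i: "i < m" "stretch N d = stretch M (c i)" by blast
  have "puis N (c i) = puis (N * M) (stretch N d)" using puis_stretch[OF N M(1)] i by metis
  also have "\<dots> = \<gamma>" using puis_stretch[OF M(1) N, of d] \<gamma> by (simp add: mult.commute)
  finally show "\<exists>i<m. \<gamma> = puis N (c i)" using i by blast
next
  assume "\<exists>i<m. \<gamma> = puis N (c i)"
  then obtain i where i: "i < m" "\<gamma> = puis N (c i)" by blast
  have "\<forall>\<^sub>F t in at_right 0. ev2 a (pev \<gamma> (t ^ N)) (cx (t ^ N)) = 0"
    using fac_arc[OF conv1_tendsto_0[OF c_conv[OF i(1)] c0[OF i(1)]]] eventually_at_right_less[of 0]
  proof eventually_elim
    case (elim t)
    then show ?case using pev_puis[OF N c0[OF i(1)] c_conv[OF i(1)], of t] i by auto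
  qed
  then have "\<forall>\<^sub>F y in at_right 0. ev2 a (pev \<gamma> y) (cx y) = 0"
    by (rule eventually_at_right_power[OF N, THEN iffD2])
  then show "np_root a \<gamma>"
    unfolding np_root_def using is_puiseux_puis[of N "c i"] N c0[OF i(1)] c_conv[OF i(1)] i(2) by simp
qed

text \<open>The unit contributes a nonzero constant and each factor its contact order with the arc,
  so the order of the germ is a sum of contact orders.\<close>

lemma arc_leading:
  assumes d: "conv1 d" "d 0 = 0" "\<And>i. i < m \<Longrightarrow> d \<noteq> c i"
  shows "\<exists>K. K \<noteq> 0 \<and> ((\<lambda>t. ev2 a (rsev d t) (cx (t ^ N)) /
    cx t ^ (\<Sum>i<m. contact d (c i))) \<longlongrightarrow> K) (at_right 0)"
proof (intro exI conjI)
  let ?o = "\<lambda>i. contact d (c i)"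
  let ?K = "U 0 0 * (\<Prod>i<m. d (?o i) - c i (?o i))"
  show "?K \<noteq> 0" using U contact(1)[OF d(3)] by auto
  note X = conv1_tendsto_0[OF d(1,2)]
  have "((\<lambda>t. U (rsev d t) (cx t) *
     (\<Prod>i<m. (rsev d t - rsev (c i) t) / cx t ^ ?o i)) \<longlongrightarrow> ?K) (at_right 0)"
  proof (rule tendsto_mult[OF germ2_tendsto_arc[OF U(1) X] tendsto_prod])
    fix i assume "i \<in> {..<m}"
    then have i: "i < m" by simp
    show "((\<lambda>t. (rsev d t - rsev (c i) t) / cx t ^ ?o i) \<longlongrightarrow>
        d (?o i) - c i (?o i)) (at_right 0)"
      by (rule tendsto_at_right_of_real[OF sev_diff_leading[OF d(1) c_conv[OF i] d(3)[OF i]]])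
  qed
  moreover have "\<forall>\<^sub>F t in at_right 0. U (rsev d t) (cx t) *
     (\<Prod>i<m. (rsev d t - rsev (c i) t) / cx t ^ ?o i) =
     ev2 a (rsev d t) (cx (t ^ N)) / cx t ^ (\<Sum>i<m. ?o i)"
    using fac_arc[OF X] by eventually_elim (simp add: prod_dividef power_sum)
  ultimately show "((\<lambda>t. ev2 a (rsev d t) (cx (t ^ N)) /
    cx t ^ (\<Sum>i<m. ?o i)) \<longlongrightarrow> ?K) (at_right 0)"
    by (rule Lim_transform_eventually)
qed

lemma ord0_arc:
  assumes d: "conv1 d" "d 0 = 0" "\<And>i. i < m \<Longrightarrow> d \<noteq> c i"
  shows "ord0 (\<lambda>y. ev2 a (pev (puis N d) y) (cx y)) = real (\<Sum>i<m. contact d (c i)) / real N"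
proof -
  let ?S = "\<Sum>i<m. contact d (c i)"
  obtain K where K: "K \<noteq> 0" "((\<lambda>t. ev2 a (rsev d t) (cx (t ^ N)) /
    cx t ^ ?S) \<longlongrightarrow> K) (at_right 0)" using arc_leading[OF d] by blast
  have ev: "\<forall>\<^sub>F t in at_right 0. ev2 a (rsev d t) (cx (t ^ N)) / cx t ^ ?S =
     ev2 a (pev (puis N d) (t ^ N)) (cx (t ^ N)) / cx ((t ^ N) powr (real ?S / real N))"
    using eventually_at_right_less[of 0]
  proof eventually_elim
    case (elim t)
    have "(t ^ N) powr (real ?S / real N) = (t powr real N) powr (real ?S / real N)"
      using elim by (simp add: powr_realpow)
    also have "\<dots> = t powr real ?S" using N by (simp add: powr_powr)
    also have "\<dots> = t ^ ?S" using elim by (rule powr_realpow)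
    finally show ?case using pev_puis[OF N d(2,1) elim] by simp
  qed
  show ?thesis
  proof (rule ord0_eqI[OF _ K(1)])
    show "((\<lambda>y. ev2 a (pev (puis N d) y) (cx y) / cx (y powr (real ?S / real N))) \<longlongrightarrow> K) (at_right 0)"
      by (rule tendsto_at_right_power[OF N, THEN iffD2]) (rule Lim_transform_eventually[OF K(2) ev])
  qed
qed

text \<open>The factors equal to \<open>x - c i\<close> are grouped; the remaining ones are nonzero
  along this root for small parameters.\<close>

lemma multiplicity_cofactor:
  assumes i: "i < m"
  obtains H where "germ2 H"
    "near2 (\<lambda>x t. ev2 a x (t ^ N) = (x - sev (c i) t) ^ card {j. j < m \<and> c j = c i} * H x t)"
    "\<forall>\<^sub>F t in at_right 0. H (rsev (c i) t) (cx t) \<noteq> 0"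
proof -
  define J where "J = {j. j < m \<and> c j = c i}"
  define H where "H x t = U x t * (\<Prod>j\<in>{..<m} - J. x - sev (c j) t)" for x t
  have J: "J \<subseteq> {..<m}" by (auto simp: J_def)
  have "germ2 H" unfolding H_def
    by (intro germ2_mult germ2_prod germ2_diff U germ2_x germ2_of_t conv1_analytic c_conv) auto
  moreover have "near2 (\<lambda>x t. ev2 a x (t ^ N) = (x - sev (c i) t) ^ card J * H x t)"
  proof (rule near2_mono[OF fac])
    fix x t assume e: "ev2 a x (t ^ N) = U x t * (\<Prod>i<m. x - sev (c i) t)"
    have "(\<Prod>j<m. x - sev (c j) t) = (\<Prod>j\<in>{..<m} - J. x - sev (c j) t) * (\<Prod>j\<in>J. x - sev (c j) t)"
      by (rule prod.subset_diff[OF J]) auto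
    also have "(\<Prod>j\<in>J. x - sev (c j) t) = (\<Prod>j\<in>J. x - sev (c i) t)"
      by (rule prod.cong) (auto simp: J_def)
    also have "\<dots> = (x - sev (c i) t) ^ card J" by simp
    finally show "ev2 a x (t ^ N) = (x - sev (c i) t) ^ card J * H x t" using e by (simp add: H_def)
  qed
  moreover have "\<forall>\<^sub>F t in at_right 0. H (rsev (c i) t) (cx t) \<noteq> 0"
  proof -
    note X = conv1_tendsto_0[OF c_conv[OF i] c0[OF i]]
    have "\<forall>j\<in>{..<m} - J. \<forall>\<^sub>F s in at_right 0. rsev (c i) s \<noteq> rsev (c j) s"
    proof
      fix j assume "j \<in> {..<m} - J"
      then have "j < m" "c i \<noteq> c j" by (auto simp: J_def)
      then show "\<forall>\<^sub>F s in at_right 0. rsev (c i) s \<noteq> rsev (c j) s"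
        using eventually_at_right_of_real[OF sev_neq_eventually[OF c_conv[OF i] c_conv]] by blast
    qed
    then have "\<forall>\<^sub>F s in at_right 0. \<forall>j\<in>{..<m} - J. rsev (c i) s \<noteq> rsev (c j) s"
      by (intro eventually_ball_finite) auto
    then show ?thesis using U_arc_nz[OF X] by eventually_elim (simp add: H_def)
  qed
  ultimately show ?thesis using that[of H] by (simp add: J_def)
qed

text \<open>The greatest exponent is attained because \<open>k\<close> is admissible and every
  admissible one equals it: the cofactor is not identically zero along the root, so at suitable
  parameters the exponent is an order of vanishing in \<open>x\<close>.\<close>

lemma np_mult_eq:
  assumes i: "i < m"
  shows "np_mult a (puis N (c i)) = card {j. j < m \<and> c j = c i}"
proof -
  define k where "k = card {j. j < m \<and> c j = c i}"
  define \<gamma> where "\<gamma> = puis N (c i)"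
  define S where "S k N h \<epsilon> \<longleftrightarrow> (\<forall>x t. norm x < \<epsilon> \<and> 0 < t \<and> t < \<epsilon> \<longrightarrow>
     ev2 a x (cx (t ^ N)) = (x - pev \<gamma> (t ^ N)) ^ k * cev2 h x (cx t))" for k N h \<epsilon>
  define R where "R k N h \<longleftrightarrow> N > 0 \<and> puis_supp \<gamma> N \<and> conv2 h \<and> (\<exists>\<epsilon>>0. S k N h \<epsilon>) \<and>
     \<not> (\<forall>\<^sub>F t in at_right 0. cev2 h (pev \<gamma> (t ^ N)) (cx t) = 0)" for k N h
  obtain H where H: "germ2 H" "near2 (\<lambda>x t. ev2 a x (t ^ N) = (x - sev (c i) t) ^ k * H x t)"
    "\<forall>\<^sub>F t in at_right 0. H (rsev (c i) t) (cx t) \<noteq> 0"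
    using multiplicity_cofactor[OF i] unfolding k_def by blast
  note ci = c_conv[OF i] c0[OF i]
  note X = conv1_tendsto_0[OF ci]
  have pe: "pev \<gamma> (t ^ N) = rsev (c i) t" if "t > 0" for t
    using pev_puis[OF N ci(2,1) that] by (simp add: \<gamma>_def)
  have Qk: "\<exists>N h. R k N h"
  proof -
    obtain h where h: "conv2 h" "near2 (\<lambda>x t. H x t = cev2 h x t)" using germ2_power_series[OF H(1)] by blast
    obtain e where e: "e > 0" "\<And>x t. norm x < e \<Longrightarrow> norm t < e \<Longrightarrow>
        ev2 a x (t ^ N) = (x - sev (c i) t) ^ k * H x t \<and> H x t = cev2 h x t"
      using near2_conj[OF H(2) h(2)] unfolding near2_def by blast
    have "ev2 a x (cx (t ^ N)) = (x - pev \<gamma> (t ^ N)) ^ k * cev2 h x (cx t)"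
      if "norm x < e" "0 < t" "t < e" for x t
      using e(2)[of x "cx t"] that by (simp add: pe)
    moreover have "\<forall>\<^sub>F t in at_right 0. cev2 h (pev \<gamma> (t ^ N)) (cx t) \<noteq> 0"
      using near2_arc[OF h(2) X] H(3) eventually_at_right_less[of 0]
      by eventually_elim (auto simp: pe)
    then have "\<not> (\<forall>\<^sub>F t in at_right 0. cev2 h (pev \<gamma> (t ^ N)) (cx t) = 0)"
      by (rule not_eventually_at_right)
    moreover have "puis_supp \<gamma> N" unfolding \<gamma>_def by (rule puis_supp_puis) (use N ci in auto)
    ultimately have "R k N h" unfolding R_def S_def using N h(1) e(1) by blast
    then show ?thesis by blast
  qed
  \<comment> \<open>A competing factorization may use another denominator \<open>N'\<close>.
    Parameter \<open>s ^ N'\<close> in the known one and \<open>s ^ N\<close> in the competing one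
    lead to the same \<open>y\<close>.\<close>
  have Quniq: "k' = k" if "R k' N' h" for k' N' h
  proof -
    have h1: "N' > 0" "conv2 h"
      "\<not> (\<forall>\<^sub>F t in at_right 0. cev2 h (pev \<gamma> (t ^ N')) (cx t) = 0)"
      using that unfolding R_def by - (elim conjE, assumption)+
    have "\<exists>\<epsilon>>0. S k' N' h \<epsilon>" using that unfolding R_def by - (elim conjE, assumption)
    then obtain \<epsilon> where \<epsilon>: "\<epsilon> > 0" "S k' N' h \<epsilon>" by blast
    obtain e where e: "e > 0" "\<And>x t. norm x < e \<Longrightarrow> norm t < e \<Longrightarrow>
        ev2 a x (t ^ N) = (x - sev (c i) t) ^ k * H x t \<and> isCont (\<lambda>x. H x t) x"
      using near2_conj[OF H(2) germ2_isCont_x[OF H(1)]] unfolding near2_def by blast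
    obtain e' where e': "e' > 0" "\<And>x t. norm x < e' \<Longrightarrow> norm t < e' \<Longrightarrow> isCont (\<lambda>x. cev2 h x t) x"
      using germ2_isCont_x[OF germ2_cev2[OF h1(2)]] unfolding near2_def by blast
    define \<delta> where "\<delta> = Min {e, e', \<epsilon>}"
    have \<delta>: "\<delta> > 0" "\<delta> \<le> e" "\<delta> \<le> e'" "\<delta> \<le> \<epsilon>" using e e' \<epsilon>(1) by (auto simp: \<delta>_def)
    have E1: "\<forall>\<^sub>F t in at_right 0. H (rsev (c i) t) (cx t) \<noteq> 0 \<and>
       norm (rsev (c i) t) < \<delta> \<and> 0 < t \<and> t < \<delta>"
      using H(3) near2_arc[OF near2_norm_less[OF \<delta>(1)] X] eventually_at_right_less[of 0]
      by eventually_elim auto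
    have E2: "\<forall>\<^sub>F t in at_right (0::real). 0 < t \<and> t < \<delta>"
      using \<delta>(1) unfolding eventually_at_right_field by blast
    have F0: "\<not> (\<forall>\<^sub>F s in at_right 0. cev2 h (pev \<gamma> ((s ^ N) ^ N')) (cx (s ^ N)) = 0)"
      using h1(3) eventually_at_right_power[OF N, of "\<lambda>t. cev2 h (pev \<gamma> (t ^ N')) (cx t) = 0"] by blast
    have F1: "\<forall>\<^sub>F s in at_right 0. H (rsev (c i) (s ^ N')) (cx (s ^ N')) \<noteq> 0 \<and>
       norm (rsev (c i) (s ^ N')) < \<delta> \<and> 0 < s ^ N' \<and> s ^ N' < \<delta>"
      by (rule eventually_at_right_power[OF h1(1), THEN iffD1, OF E1])
    have F2: "\<forall>\<^sub>F s in at_right (0::real). 0 < s ^ N \<and> s ^ N < \<delta>"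
      by (rule eventually_at_right_power[OF N, THEN iffD1, OF E2])
    \<comment> \<open>The competing cofactor is known only not to vanish for all small parameters,
      hence \<open>s\<close> is found by contradiction with \<open>F0\<close>; the other
      requirements hold for every small \<open>s\<close>.\<close>
    obtain s where s: "cev2 h (pev \<gamma> ((s ^ N) ^ N')) (cx (s ^ N)) \<noteq> 0"
       "H (rsev (c i) (s ^ N')) (cx (s ^ N')) \<noteq> 0"
       "norm (rsev (c i) (s ^ N')) < \<delta>" "0 < s ^ N'" "s ^ N' < \<delta>" "0 < s ^ N" "s ^ N < \<delta>"
    proof (rule ccontr)
      note that' = that
      assume no: "\<not> thesis"
      have "\<forall>\<^sub>F s in at_right 0. cev2 h (pev \<gamma> ((s ^ N) ^ N')) (cx (s ^ N)) = 0"
        using F1 F2 by eventually_elim (use no that' in blast)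
      then show False using F0 by contradiction
    qed
    define p where "p = rsev (c i) (s ^ N')"
    have y: "(s ^ N) ^ N' = (s ^ N') ^ N" by (simp add: mult.commute flip: power_mult)
    have p: "pev \<gamma> ((s ^ N) ^ N') = p" unfolding y p_def using pe s by simp
    have n: "norm (cx (s ^ N')) < \<delta>" "norm (cx (s ^ N)) < \<delta>" "norm p < \<delta>"
      using s p_def unfolding norm_of_real by auto
    have "k = k'"
    proof (rule vanishing_order_unique)
      show "isCont (\<lambda>x. H x (cx (s ^ N'))) p"
        using e(2)[of p "cx (s ^ N')"] n \<delta> by linarith
      show "isCont (\<lambda>x. cev2 h x (cx (s ^ N))) p"
        using e'(2)[of p "cx (s ^ N)"] n \<delta> by linarith
      show "H p (cx (s ^ N')) \<noteq> 0" using s p_def by simp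
      show "cev2 h p (cx (s ^ N)) \<noteq> 0" using s p by simp
      have "(x - p) ^ k * H x (cx (s ^ N')) = (x - p) ^ k' * cev2 h x (cx (s ^ N))" if "norm x < \<delta>" for x
      proof -
        have "ev2 a x (cx (s ^ N') ^ N) = (x - p) ^ k * H x (cx (s ^ N'))"
          using e(2)[of x "cx (s ^ N')"] that n \<delta> unfolding p_def by linarith
        moreover have "ev2 a x (cx ((s ^ N) ^ N')) = (x - p) ^ k' * cev2 h x (cx (s ^ N))"
          using \<epsilon>(2)[unfolded S_def, rule_format, of x "s ^ N"] that s \<delta> p by simp
        ultimately show ?thesis unfolding y by simp
      qed
      moreover have "\<forall>\<^sub>F x in nhds p. norm x < \<delta>"
        using eventually_nhds_in_open[of "ball 0 \<delta>" p] s p_def by auto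
      ultimately show "\<forall>\<^sub>F x in nhds p. (x - p) ^ k * H x (cx (s ^ N')) = (x - p) ^ k' * cev2 h x (cx (s ^ N))"
        by (auto elim: eventually_mono)
    qed
    then show ?thesis by simp
  qed
  have "np_mult a \<gamma> = (GREATEST k. \<exists>N h. R k N h)" unfolding np_mult_def R_def S_def ..
  also have "\<dots> = k" by (rule Greatest_equality) (use Qk Quniq in auto)
  finally show ?thesis by (simp add: \<gamma>_def k_def)
qed

end

section \<open>Real approximations\<close>

text \<open>The counterpart of \<open>nonreal_exp\<close> in units of \<open>1 / N\<close>;
  unspecified for a real sequence.\<close>

definition nrx :: "(nat \<Rightarrow> complex) \<Rightarrow> nat" where
  "nrx d = (LEAST k. d k \<notin> \<real>)"

definition ra :: "(nat \<Rightarrow> complex) \<Rightarrow> real \<Rightarrow> nat \<Rightarrow> complex" where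
  "ra d r k = (if k < nrx d then d k else if k = nrx d then cx r else 0)"

text \<open>The order, along a generic real approximation of \<open>e\<close>, of the product of the \<open>x - c i\<close>.\<close>

abbreviation amc :: "nat \<Rightarrow> (nat \<Rightarrow> nat \<Rightarrow> complex) \<Rightarrow> (nat \<Rightarrow> complex) \<Rightarrow> nat" where
  "amc m c e \<equiv> (\<Sum>i<m. mc (nrx e) e (c i))"

lemma nrx:
  assumes "\<exists>k. d k \<notin> \<real>"
  shows "d (nrx d) \<notin> \<real>"
  unfolding nrx_def by (rule LeastI_ex[OF assms])

lemma nrx_less: "k < nrx d \<Longrightarrow> d k \<in> \<real>"
  using not_less_Least[of k "\<lambda>k. d k \<notin> \<real>"] by (simp add: nrx_def)

lemma nrx_le: "d k \<notin> \<real> \<Longrightarrow> nrx d \<le> k"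
  unfolding nrx_def by (rule Least_le)

lemma nrx_pos: "\<exists>k. d k \<notin> \<real> \<Longrightarrow> d 0 = 0 \<Longrightarrow> nrx d > 0"
  using nrx[of d] by (metis Reals_0 gr0I)

lemma real_puiseux_puis: "N > 0 \<Longrightarrow> real_puiseux (puis N d) \<longleftrightarrow> (\<forall>k. d k \<in> \<real>)"
  unfolding real_puiseux_def by (metis Reals_0 puis_frac puis_nz)

lemma nonreal_exp_puis:
  assumes "N > 0" "\<exists>k. d k \<notin> \<real>"
  shows "nonreal_exp (puis N d) = of_nat (nrx d) / of_nat N"
  unfolding nonreal_exp_def
proof (rule Least_equality)
  show "puis N d (of_nat (nrx d) / of_nat N) \<notin> \<real>" using nrx[OF assms(2)] puis_frac[OF assms(1)] by simp
  fix q assume q: "puis N d q \<notin> \<real>"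
  then have "puis N d q \<noteq> 0" by auto
  then obtain k where k: "q = of_nat k / of_nat N" using puis_nz[OF assms(1)] by metis
  then have "nrx d \<le> k" using q puis_frac[OF assms(1)] nrx_le by simp
  then show "of_nat (nrx d) / of_nat N \<le> q" using k assms by (simp add: divide_right_mono)
qed

lemma real_approx_puis:
  assumes "N > 0" "\<exists>k. d k \<notin> \<real>"
  shows "real_approx (puis N d) r = puis N (ra d r)"
proof (rule puis_eqI[OF assms(1)])
  show "real_approx (puis N d) r (of_nat k / of_nat N) = ra d r k" for k
    using assms(1)
    by (simp add: real_approx_def rho_approx_def nonreal_exp_puis[OF assms] ra_def puis_frac divide_less_cancel)
  fix q assume "real_approx (puis N d) r q \<noteq> 0"
  then show "\<exists>k::nat. q = of_nat k / of_nat N"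
    using puis_nz[OF assms(1)]
    by (auto simp: real_approx_def rho_approx_def nonreal_exp_puis[OF assms] split: if_splits) metis
qed

lemma conv1_ra: "conv1 (ra d r)"
  unfolding conv1_def by (intro exI[of _ 1] conjI summable_finite[of "{..nrx d}"]) (auto simp: ra_def)

lemma ra_0: "\<exists>k. d k \<notin> \<real> \<Longrightarrow> d 0 = 0 \<Longrightarrow> ra d r 0 = 0"
  using nrx_pos[of d] by (simp add: ra_def)

lemma ra_real: "ra d r k \<in> \<real>"
  by (simp add: ra_def nrx_less)

text \<open>The approximation agrees with \<open>d\<close> below \<open>nrx d\<close> and, by the
  choice of \<open>r\<close>, separates from \<open>c\<close> at that index at the latest.
  Truncating the contact order of \<open>d\<close> and \<open>c\<close> at \<open>nrx d\<close>
  records exactly this.\<close>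

lemma contact_ra:
  assumes "cx r \<noteq> c (nrx d)"
  shows "ra d r \<noteq> c" "contact (ra d r) c = mc (nrx d) d c"
proof -
  have "ra d r (nrx d) \<noteq> c (nrx d)" using assms by (simp add: ra_def)
  then show "ra d r \<noteq> c" by auto
  show "contact (ra d r) c = mc (nrx d) d c"
  proof (cases "\<forall>k<nrx d. d k = c k")
    case True
    then show ?thesis using assms by (auto simp: mc_agree ra_def intro!: contact_eqI)
  next
    case False
    then obtain k where k: "k < nrx d" "d k \<noteq> c k" by blast
    then have ne: "d \<noteq> c" by auto
    have lt: "contact d c < nrx d" using k contact(2)[OF ne, of k] by (meson not_less order_le_less_trans)
    then show ?thesis using contact[OF ne]
      by (auto simp: mc_contact[OF ne] ra_def intro!: contact_eqI)
  qed
qed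

lemma generic_real:
  fixes c :: "nat \<Rightarrow> complex"
  shows "\<forall>\<^sub>F r in cofinite. \<forall>i<m. cx r \<noteq> c i"
proof -
  have "{r. \<exists>i<m. cx r = c i} \<subseteq> Re ` c ` {..<m}"
    by (auto simp: image_iff) (metis Re_complex_of_real lessThan_iff)
  then have "finite {r. \<exists>i<m. cx r = c i}" by (rule finite_subset) auto
  then show ?thesis by (simp add: eventually_cofinite)
qed

lemma sev_real:
  assumes "conv1 c" "\<And>k. c k \<in> \<real>"
  shows "\<forall>\<^sub>F t in at_right 0. rsev c t \<in> \<real>"
proof -
  obtain r where r: "r > 0" "\<forall>t. norm t < r \<longrightarrow> (\<lambda>k. c k * t ^ k) sums sev c t"
    using conv1_sums[OF assms(1)] by blast
  have "rsev c t \<in> \<real>" if "0 < t" "t < r" for t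
  proof -
    have s: "(\<lambda>k. Im (c k * cx t ^ k)) sums Im (rsev c t)"
      using r that by (intro sums_Im) auto
    have z: "Im (c k * cx t ^ k) = 0" for k
      using assms(2)[of k] by (auto elim!: Reals_cases simp flip: of_real_power)
    have "Im (rsev c t) = 0" using sums_unique2[OF s[unfolded z] sums_zero] .
    then show ?thesis by (simp add: complex_is_Real_iff)
  qed
  then show ?thesis using r(1) unfolding eventually_at_right_field by blast
qed

text \<open>For real \<open>t\<close> the imaginary part is the series of the imaginary parts of the
  coefficients, which starts at \<open>nrx c\<close>. It bounds from below the distance of a
  non-real root to every real \<open>x\<close>.\<close>

lemma sev_Im_leading:
  assumes "conv1 c" "\<exists>k. c k \<notin> \<real>"
  shows "((\<lambda>t. \<bar>Im (rsev c t)\<bar> / t ^ nrx c) \<longlongrightarrow> \<bar>Im (c (nrx c))\<bar>) (at_right 0)"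
proof -
  define b where "b k = cx (Im (c k))" for k
  obtain r where r: "r > 0" "summable (\<lambda>k. norm (c k) * r ^ k)" using assms conv1_def by blast
  have "summable (\<lambda>k. norm (b k) * r ^ k)"
    by (rule summable_comparison_test[OF _ r(2)])
       (use r abs_Im_le_cmod in \<open>auto simp: b_def abs_mult intro!: exI[of _ 0] mult_right_mono\<close>)
  then have b: "conv1 b" unfolding conv1_def using r by blast
  obtain e where e: "e > 0" "\<forall>t. norm t < e \<longrightarrow> (\<lambda>k. c k * t ^ k) sums sev c t"
    using conv1_sums[OF assms(1)] by blast
  have Im: "cx (Im (rsev c t)) = rsev b t" if "0 < t" "t < e" for t
  proof -
    have "(\<lambda>k. Im (c k * cx t ^ k)) sums Im (rsev c t)"
      using e that by (intro sums_Im) auto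
    then have "(\<lambda>k. Im (c k) * t ^ k) sums Im (rsev c t)"
      by (simp flip: of_real_power)
    from sums_of_real[OF this, where 'a=complex] show ?thesis by (simp add: b_def sev_def sums_iff)
  qed
  have "b k = 0" if "k < nrx c" for k using nrx_less[OF that] by (simp add: b_def complex_is_Real_iff)
  then have "((\<lambda>t. sev b t / t ^ nrx c) \<longlongrightarrow> b (nrx c)) (at 0)" by (intro sev_leading b)
  from tendsto_norm[OF tendsto_at_right_of_real[OF this]]
  have "((\<lambda>t. norm (rsev b t / cx t ^ nrx c)) \<longlongrightarrow> \<bar>Im (c (nrx c))\<bar>) (at_right 0)"
    by (simp add: b_def)
  moreover have "\<forall>\<^sub>F t in at_right 0. norm (rsev b t / cx t ^ nrx c) =
     \<bar>Im (rsev c t)\<bar> / t ^ nrx c"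
  proof -
    have "\<forall>\<^sub>F t in at_right (0::real). 0 < t \<and> t < e" using e(1) unfolding eventually_at_right_field by blast
    then show ?thesis
    proof eventually_elim
      case (elim t)
      then show ?case using Im[of t] by (simp add: norm_divide norm_power flip: Im)
    qed
  qed
  ultimately show ?thesis by (rule Lim_transform_eventually)
qed

text \<open>For all but finitely many \<open>r\<close> both orders are sums of truncated contact
  orders, and the factors \<open>1 / N\<close> cancel. Cofinite sets of reals are nonempty, so the
  generic value is unique.\<close>

lemma ell_generic_eq:
  assumes F: "factored a N m c U" and G: "factored b N n d V"
    and e: "e 0 = 0" "\<exists>k. e k \<notin> \<real>"
  shows "ell_generic a b (puis N e) = real (amc m c e) / real (amc n d e)"
    (is "_ = ?L")
proof -
  interpret F: factored a N m c U by fact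
  interpret G: factored b N n d V by fact
  have ev: "\<forall>\<^sub>F r in cofinite. ell a b (real_approx (puis N e) r) = ?L"
    using generic_real[of m "\<lambda>i. c i (nrx e)"] generic_real[of n "\<lambda>j. d j (nrx e)"]
  proof eventually_elim
    case (elim r)
    have "ord0 (\<lambda>y. ev2 a (pev (puis N (ra e r)) y) (cx y)) = real (\<Sum>i<m. contact (ra e r) (c i)) / real N"
      using elim contact_ra(1) by (intro F.ord0_arc conv1_ra ra_0 e) auto
    moreover have "ord0 (\<lambda>y. ev2 b (pev (puis N (ra e r)) y) (cx y)) = real (\<Sum>i<n. contact (ra e r) (d i)) / real N"
      using elim contact_ra(1) by (intro G.ord0_arc conv1_ra ra_0 e) auto
    moreover have "(\<Sum>i<m. contact (ra e r) (c i)) = amc m c e"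
      "(\<Sum>i<n. contact (ra e r) (d i)) = amc n d e"
      using elim contact_ra(2) by (auto intro!: sum.cong)
    ultimately show ?case using F.N by (simp add: ell_def real_approx_puis[OF F.N e(2)])
  qed
  show ?thesis unfolding ell_generic_def
  proof (rule the_equality[where P="\<lambda>L. \<forall>\<^sub>F r in cofinite. ell a b (real_approx (puis N e) r) = L", OF ev])
    fix L assume "\<forall>\<^sub>F r in cofinite. ell a b (real_approx (puis N e) r) = L"
    with ev have "\<forall>\<^sub>F r::real in cofinite. L = ?L" by eventually_elim simp
    then show "L = ?L" by (simp add: eventually_cofinite infinite_UNIV_char_0 split: if_splits)
  qed
qed

lemma ex_factored:
  assumes "conv2 a" "regular_x a"
  shows "\<exists>N m c U. factored a N m c U \<and> (a 0 0 = 0 \<longrightarrow> m > 0)"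
proof -
  obtain m where m: "a m 0 \<noteq> 0" "\<And>i. i < m \<Longrightarrow> a i 0 = 0"
    using assms(2) unfolding regular_x_def by fastforce
  from puiseux_factorization[OF germ2_ev2[OF assms(1)] ordx_ev2[OF assms(1) m]]
  obtain N \<phi> U where P: "N > 0" "\<And>i. i < m \<Longrightarrow> \<phi> i analytic_on {0}" "\<And>i. i < m \<Longrightarrow> \<phi> i 0 = 0" "germ2 U" "U 0 0 \<noteq> 0"
    "near2 (\<lambda>x t. ev2 a x (t ^ N) = U x t * (\<Prod>i<m. x - \<phi> i t))" by blast
  have "\<forall>i<m. \<exists>c. conv1 c \<and> c 0 = 0 \<and> (\<forall>\<^sub>F t in nhds 0. \<phi> i t = sev c t)"
    using analytic_series[OF P(2)] P(3) by metis
  then obtain c where c: "\<And>i. i < m \<Longrightarrow> conv1 (c i)" "\<And>i. i < m \<Longrightarrow> c i 0 = 0"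
     "\<And>i. i < m \<Longrightarrow> \<forall>\<^sub>F t in nhds 0. \<phi> i t = sev (c i) t" by metis
  have "\<forall>\<^sub>F t in nhds 0. \<forall>i\<in>{..<m}. \<phi> i t = sev (c i) t"
    by (intro eventually_ball_finite) (use c in auto)
  from near2_conj[OF P(6) near2_of_eventually[OF this]]
  have "near2 (\<lambda>x t. ev2 a x (t ^ N) = U x t * (\<Prod>i<m. x - sev (c i) t))"
    by (rule near2_mono) auto
  then have "factored a N m c U" using P c by unfold_locales auto
  moreover have "a 0 0 = 0 \<longrightarrow> m > 0" using m by (metis gr0I)
  ultimately show ?thesis by blast
qed

lemma ex_factored_pair:
  assumes "conv2 a" "regular_x a" "conv2 b" "regular_x b" "a 0 0 = 0" "b 0 0 = 0"
  shows "\<exists>N m c U n d V. factored a N m c U \<and> factored b N n d V \<and> m > 0 \<and> n > 0"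
proof -
  obtain N m c U where F: "factored a N m c U" "m > 0" using ex_factored[OF assms(1,2)] assms(5) by blast
  obtain N' n d V where G: "factored b N' n d V" "n > 0" using ex_factored[OF assms(3,4)] assms(6) by blast
  have N: "N > 0" "N' > 0" using F G factored.N by blast+
  show ?thesis using factored.refine[OF F(1) N(2)] factored.refine[OF G(1) N(1)] F G
    by (metis mult.commute)
qed

section \<open>The tree of contact orders\<close>

text \<open>A finite set \<open>I\<close> of roots with real weights: \<open>cw k x\<close> is the total weight of the roots sharing
  the first \<open>k\<close> coefficients of \<open>x\<close>, i.e. the slope of the weighted contact order \<open>ew\<close>.\<close>

locale weighted_roots =
  fixes I :: "(nat \<Rightarrow> complex) set" and w :: "(nat \<Rightarrow> complex) \<Rightarrow> real"
  assumes fin: "finite I"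
    and nonreal: "\<And>x. x \<in> I \<Longrightarrow> \<exists>k. x k \<notin> \<real> \<Longrightarrow> w x > 0 \<Longrightarrow> (\<Sum>x'\<in>I. w x' * real (mc (nrx x) x x')) \<le> 0"
    and real: "\<And>x. x \<in> I \<Longrightarrow> \<forall>k. x k \<in> \<real> \<Longrightarrow> w x \<le> 0"
begin

definition cw :: "nat \<Rightarrow> (nat \<Rightarrow> complex) \<Rightarrow> real" where
  "cw k x = (\<Sum>x'\<in>{x'\<in>I. \<forall>i<k. x' i = x i}. w x')"

definition ew :: "nat \<Rightarrow> (nat \<Rightarrow> complex) \<Rightarrow> real" where
  "ew k x = (\<Sum>x'\<in>I. w x' * real (mc k x x'))"

lemma ew_0: "ew 0 x = 0"
  by (simp add: ew_def mc_def)

lemma ew_Suc: "ew (Suc k) x = ew k x + cw (Suc k) x"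
proof -
  have "cw (Suc k) x = (\<Sum>x'\<in>I. if \<forall>i<Suc k. x' i = x i then w x' else 0)"
    unfolding cw_def using fin by (simp add: sum.inter_filter)
  also have "\<dots> = (\<Sum>x'\<in>I. w x' * real (if \<forall>i\<le>k. x i = x' i then 1 else 0))"
    by (rule sum.cong) (auto simp: less_Suc_eq_le)
  finally show ?thesis unfolding ew_def mc_def
    by (simp add: sum.distrib[symmetric] distrib_left)
qed

lemma ew_cong: assumes "\<And>i. i < k \<Longrightarrow> x i = x' i" shows "ew k x = ew k x'"
proof -
  have "mc k x y = mc k x' y" for y unfolding mc_def by (rule sum.cong) (use assms in auto)
  then show ?thesis by (simp add: ew_def)
qed

text \<open>Provides the start of a downward induction: beyond the level \<open>K\<close> the finite
  tree no longer branches, and every non-real root has already shown a non-real coefficient.\<close>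

lemma separation: "\<exists>K. (\<forall>x\<in>I. \<forall>x'\<in>I. (\<forall>i<K. x i = x' i) \<longrightarrow> x = x') \<and> (\<forall>x\<in>I. (\<exists>k. x k \<notin> \<real>) \<longrightarrow> nrx x < K)"
proof -
  define A where "A = (\<lambda>(x, x'). contact x x') ` (I \<times> I) \<union> nrx ` I"
  have A: "finite A" using fin by (auto simp: A_def)
  define K where "K = Suc (Max A)"
  have le: "k < K" if "k \<in> A" for k using Max_ge[OF A that] by (simp add: K_def)
  have "x = x'" if "x \<in> I" "x' \<in> I" "\<forall>i<K. x i = x' i" for x x'
  proof (rule ccontr)
    assume "x \<noteq> x'"
    moreover have "contact x x' < K" using that by (intro le) (auto simp: A_def)
    ultimately show False using contact(1) that by blast
  qed
  moreover have "nrx x < K" if "x \<in> I" for x using that by (intro le) (auto simp: A_def)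
  ultimately show ?thesis by blast
qed

text \<open>Above a point of positive slope one can climb the tree, always along positive slopes, until
  a non-real root of positive weight branches off; a real root of positive weight cannot be reached.\<close>

lemma ew_nonpos_of_slope:
  assumes "x \<in> I" "\<And>i. i < k \<Longrightarrow> x i \<in> \<real>" "cw k x > 0"
  shows "ew k x \<le> 0"
proof -
  obtain K where K: "\<And>x x'. x \<in> I \<Longrightarrow> x' \<in> I \<Longrightarrow> (\<forall>i<K. x i = x' i) \<Longrightarrow> x = x'"
    "\<And>x. x \<in> I \<Longrightarrow> \<exists>k. x k \<notin> \<real> \<Longrightarrow> nrx x < K" using separation by blast
  show ?thesis using assms
  proof (induction "K - k" arbitrary: k x)
    \<comment> \<open>At a level \<open>k \<ge> K\<close> the class of \<open>x\<close> is a single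
      root of positive weight, hence non-real; its lowest non-real index is below \<open>K\<close>,
      against the reality of the initial coefficients.\<close>
    case 0
    have "{x'\<in>I. \<forall>i<k. x' i = x i} = {x}"
      using K(1)[of _ x] 0 by auto
    then have w: "w x > 0" using 0 by (simp add: cw_def)
    have "\<exists>k. x k \<notin> \<real>" using real[OF 0(2)] w by fastforce
    then have "nrx x < k" "x (nrx x) \<notin> \<real>" using K(2)[OF 0(2)] nrx 0 by auto
    then show ?case using 0 by blast
  next
    case (Suc j)
    define C where "C = {x'\<in>I. \<forall>i<k. x' i = x i}"
    have C: "finite C" "\<And>x'. x' \<in> C \<Longrightarrow> x' \<in> I" "\<And>x' i. x' \<in> C \<Longrightarrow> i < k \<Longrightarrow> x' i = x i" using fin by (auto simp: C_def)
    show ?case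
    proof (cases "\<exists>x'\<in>C. x' k \<notin> \<real> \<and> w x' > 0")
      \<comment> \<open>This branch leaves the real tree exactly at level \<open>k\<close>, so
        \<open>nrx x' = k\<close> and the hypothesis on non-real roots bounds
        \<open>ew k\<close>.\<close>
      case True
      then obtain x' where x': "x' \<in> C" "x' k \<notin> \<real>" "w x' > 0" by blast
      have "nrx x' = k"
      proof (rule antisym)
        show "nrx x' \<le> k" using nrx_le x' by blast
        show "k \<le> nrx x'"
          using nrx[of x'] x' C(3)[OF x'(1)] Suc.prems(2) by (metis not_le)
      qed
      then have "ew k x' \<le> 0" using nonreal[OF C(2)[OF x'(1)]] x' unfolding ew_def by auto
      then show ?thesis using ew_cong[of k x x'] C(3)[OF x'(1)] by simp
    next
      case False
      \<comment> \<open>Branches with a non-real coefficient at \<open>k\<close> now have total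
        weight at most \<open>0\<close>, so some real value \<open>v\<close> of this coefficient
        carries positive slope. The bound at level \<open>k + 1\<close> descends to
        \<open>k\<close>, because the increment of \<open>ew\<close> is that positive slope.\<close>
      define R where "R = {x'\<in>C. x' k \<in> \<real>}"
      have R: "finite R" "R \<subseteq> C" using C by (auto simp: R_def)
      have "0 < sum w C" using Suc.prems(3) by (simp add: cw_def C_def)
      also have "sum w C = sum w (C - R) + sum w R" by (rule sum.subset_diff[OF R(2) C(1)])
      also have "sum w (C - R) \<le> 0" by (rule sum_nonpos) (use False in \<open>force simp: R_def\<close>)
      finally have "0 < sum w R" by simp
      also have "sum w R = (\<Sum>v\<in>(\<lambda>x'. x' k) ` R. sum w {x'\<in>R. x' k = v})"
        by (rule sum.image_gen[OF R(1)])
      finally obtain v where v: "v \<in> (\<lambda>x'. x' k) ` R" "sum w {x'\<in>R. x' k = v} > 0"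
        using sum_nonpos[of "(\<lambda>x'. x' k) ` R" "\<lambda>v. sum w {x'\<in>R. x' k = v}"] by (meson not_le)
      then obtain x' where x': "x' \<in> R" "x' k = v" by blast
      have "{y\<in>I. \<forall>i<Suc k. y i = x' i} = {y\<in>R. y k = v}"
        using x' C(3)[of x'] by (auto simp: R_def C_def less_Suc_eq)
      then have cw: "cw (Suc k) x' > 0" using v by (simp add: cw_def)
      have x'C: "x' \<in> C" "x' k \<in> \<real>" using x' by (auto simp: R_def)
      have "ew (Suc k) x' \<le> 0"
      proof (rule Suc.hyps(1))
        show "j = K - Suc k" using Suc.hyps(2) by simp
        show "x' \<in> I" using x'C C by blast
        show "x' i \<in> \<real>" if "i < Suc k" for i
          using that x'C C(3)[OF x'C(1)] Suc.prems(2) by (auto simp: less_Suc_eq)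
      qed (rule cw)
      then have "ew k x' \<le> 0" using ew_Suc[of k x'] cw by simp
      then show ?thesis using ew_cong[of k x x'] C(3)[OF x'C(1)] by simp
    qed
  qed
qed

text \<open>Where the incoming slope is positive, \<open>ew_nonpos_of_slope\<close> applies;
  elsewhere the value has not increased since the preceding level.\<close>

lemma ew_nonpos:
  assumes "x \<in> I" "\<And>i. i < k \<Longrightarrow> x i \<in> \<real>"
  shows "ew k x \<le> 0"
  using assms(2)
proof (induction k)
  case (Suc k)
  show ?case
  proof (cases "cw (Suc k) x > 0")
    case True then show ?thesis using ew_nonpos_of_slope[OF assms(1)] Suc.prems by blast
  next
    case False then show ?thesis using Suc ew_Suc[of k x] by auto
  qed
qed (simp add: ew_0)

text \<open>The contact order truncated at a real level \<open>s\<close>, a sequence having infinite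
  contact with itself. For a point whose nearest root \<open>x\<close> is at distance about
  \<open>t powr s\<close>, it is the exponent of the distance to \<open>x'\<close>.\<close>

definition rmc :: "real \<Rightarrow> (nat \<Rightarrow> complex) \<Rightarrow> (nat \<Rightarrow> complex) \<Rightarrow> real" where
  "rmc s x x' = (if x = x' then s else min s (real (contact x x')))"

lemma rmc_interpolate:
  assumes "real k \<le> s" "s < real k + 1"
  shows "rmc s x x' = (1 - (s - real k)) * real (mc k x x') + (s - real k) * real (mc (Suc k) x x')"
proof (cases "x = x'")
  case True
  then have "mc k x x' = k" "mc (Suc k) x x' = Suc k" by (auto intro: mc_agree)
  then show ?thesis using True by (simp add: rmc_def algebra_simps)
next
  case False
  consider "contact x x' \<le> k" | "contact x x' \<ge> Suc k" by linarith
  then show ?thesis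
  proof cases
    case 1
    then have "min s (real (contact x x')) = real (contact x x')" using assms by simp
    then show ?thesis using False 1 by (simp add: rmc_def mc_contact algebra_simps)
  next
    case 2
    then have "real (Suc k) \<le> real (contact x x')" by (simp only: of_nat_le_iff)
    then have "min s (real (contact x x')) = s" using assms by simp
    then show ?thesis using False 2 by (simp add: rmc_def mc_contact algebra_simps)
  qed
qed

text \<open>Between consecutive integers the weighted sum interpolates \<open>ew k\<close> and
  \<open>ew (Suc k)\<close> linearly, so the bound at integer levels suffices.\<close>

lemma rmc_sum_nonpos:
  assumes "x \<in> I" "s \<ge> 0" "(\<exists>k. x k \<notin> \<real>) \<Longrightarrow> s \<le> real (nrx x)"
  shows "(\<Sum>x'\<in>I. w x' * rmc s x x') \<le> 0"
proof -
  define k where "k = nat \<lfloor>s\<rfloor>"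
  define \<theta> where "\<theta> = s - real k"
  have k: "real k \<le> s" "s < real k + 1" using assms(2) by (auto simp: k_def)
  have \<theta>: "0 \<le> \<theta>" "\<theta> < 1" using k by (auto simp: \<theta>_def)
  have "(\<Sum>x'\<in>I. w x' * rmc s x x') = (1 - \<theta>) * ew k x + \<theta> * ew (Suc k) x"
    unfolding ew_def rmc_interpolate[OF k] sum_distrib_left sum.distrib[symmetric]
    by (rule sum.cong) (auto simp: \<theta>_def algebra_simps)
  moreover have re: "x i \<in> \<real>" if "real i < s" for i
  proof (rule ccontr)
    assume "x i \<notin> \<real>"
    then have "nrx x \<le> i" "s \<le> real (nrx x)" using nrx_le assms(3) by blast+
    then show False using that by linarith
  qed
  then have "x i \<in> \<real>" if "i < k" for i using that k by force
  then have "ew k x \<le> 0" by (rule ew_nonpos[OF assms(1)])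
  \<comment> \<open>When \<open>s\<close> is the integer \<open>k\<close>, the coefficient of index
    \<open>k\<close> may be non-real, and then \<open>ew_nonpos\<close> says nothing about
    \<open>ew (Suc k) x\<close>; its factor \<open>\<theta>\<close> is \<open>0\<close> in that
    case.\<close>
  moreover have "\<theta> * ew (Suc k) x \<le> 0"
  proof (cases "\<theta> = 0")
    case False
    then have "real k < s" using \<theta> by (simp add: \<theta>_def)
    then have "x i \<in> \<real>" if "i < Suc k" for i using re that by (metis less_Suc_eq_le of_nat_le_iff order_le_less_trans)
    then have "ew (Suc k) x \<le> 0" by (rule ew_nonpos[OF assms(1)])
    then show ?thesis using \<theta> by (simp add: mult_nonneg_nonpos)
  qed simp
  ultimately show ?thesis using \<theta> by (smt (verit) mult_nonneg_nonpos)
qed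

end

section \<open>The inequality for products over roots\<close>

lemma sum_card_fibres:
  fixes F :: "'a \<Rightarrow> real" and f :: "nat \<Rightarrow> 'a"
  assumes "finite I" "f ` {..<m} \<subseteq> I"
  shows "(\<Sum>x\<in>I. real (card {i. i < m \<and> f i = x}) * F x) = (\<Sum>i<m. F (f i))"
proof -
  have "(\<Sum>i<m. F (f i)) = (\<Sum>x\<in>I. \<Sum>i\<in>{i \<in> {..<m}. f i = x}. F (f i))"
    by (rule sum.group[symmetric]) (use assms in auto)
  also have "\<dots> = (\<Sum>x\<in>I. real (card {i. i < m \<and> f i = x}) * F x)"
    by (rule sum.cong) auto
  finally show ?thesis ..
qed

text \<open>Monotonicity in \<open>A\<close> lets finitely many constants be replaced by their
  minimum.\<close>

lemma uniform_constant:
  assumes "finite S" "\<And>s A A' t. s \<in> S \<Longrightarrow> 0 < A' \<Longrightarrow> A' \<le> A \<Longrightarrow> P s A t \<Longrightarrow> P s A' t"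
    "\<And>s. s \<in> S \<Longrightarrow> \<exists>A>0. \<forall>\<^sub>F t in at_right (0::real). P s A t"
  shows "\<exists>A>0::real. \<forall>\<^sub>F t in at_right 0. \<forall>s\<in>S. P s A t"
  using assms
proof (induction S rule: finite_induct)
  case empty
  then show ?case by (auto intro: exI[of _ 1])
next
  case (insert s S)
  have "\<exists>A>0::real. \<forall>\<^sub>F t in at_right 0. \<forall>s\<in>S. P s A t"
  proof (rule insert.IH)
    show "P s A' t" if "s \<in> S" "0 < A'" "A' \<le> A" "P s A t" for s A A' t
      using insert.prems(1)[of s A' A t] that by simp
    show "\<exists>A>0. \<forall>\<^sub>F t in at_right (0::real). P s A t" if "s \<in> S" for s
      using insert.prems(2)[of s] that by simp
  qed
  then obtain A1 where A1: "A1 > 0" "\<forall>\<^sub>F t in at_right 0. \<forall>s\<in>S. P s A1 t" by blast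
  obtain A2 where A2: "A2 > 0" "\<forall>\<^sub>F t in at_right 0. P s A2 t" using insert.prems(2)[of s] by blast
  have "\<forall>\<^sub>F t in at_right 0. \<forall>s\<in>insert s S. P s (min A1 A2) t"
    using A1(2) A2(2)
  proof eventually_elim
    case (elim t)
    then show ?case using A1(1) A2(1)
      by (auto intro: insert.prems(1)[of _ "min A1 A2" A1] insert.prems(1)[of s "min A1 A2" A2])
  qed
  then show ?case using A1(1) A2(1) by (intro exI[of _ "min A1 A2"]) auto
qed

lemma eventually_comparable:
  assumes "(q \<longlongrightarrow> l) (at_right (0::real))" "l > 0"
  shows "\<exists>A>0. \<forall>\<^sub>F t in at_right 0. A \<le> q t \<and> A * q t \<le> (1::real)"
proof -
  define A where "A = min (l/2) (1/(2*l))"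
  have A: "A > 0" "A \<le> l/2" "A \<le> 1/(2*l)" using assms(2) by (auto simp: A_def)
  have "\<forall>\<^sub>F t in at_right 0. l/2 < q t" "\<forall>\<^sub>F t in at_right 0. q t < 2*l"
    using order_tendstoD(1)[OF assms(1), of "l/2"] order_tendstoD(2)[OF assms(1), of "2*l"] assms(2) by auto
  then have "\<forall>\<^sub>F t in at_right 0. A \<le> q t \<and> A * q t \<le> 1"
  proof eventually_elim
    case (elim t)
    have "A * q t \<le> 1/(2*l) * (2*l)" using elim A assms(2) by (intro mult_mono) auto
    then show ?case using elim A assms(2) by auto
  qed
  then show ?thesis using A by blast
qed

text \<open>Logarithms turn the claim into \<open>rmc_sum_nonpos\<close> once every factor is known
  up to constants independent of \<open>x\<close> and \<open>t\<close>. There are finitely many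
  roots, so one constant \<open>A\<close> serves all pairs.\<close>

lemma product_inequality:
  fixes c d :: "nat \<Rightarrow> nat \<Rightarrow> complex" and \<alpha> :: real
  assumes \<alpha>: "\<alpha> > 0" and m: "m > 0"
    and c: "\<And>i. i < m \<Longrightarrow> conv1 (c i)" "\<And>i. i < m \<Longrightarrow> c i 0 = 0"
    and d: "\<And>i. i < n \<Longrightarrow> conv1 (d i)" "\<And>i. i < n \<Longrightarrow> d i 0 = 0"
    and nonreal: "\<And>i. i < m \<Longrightarrow> \<exists>k. c i k \<notin> \<real> \<Longrightarrow>
      real (amc m c (c i)) \<le> \<alpha> * real (amc n d (c i))"
    and re: "\<And>i. i < m \<Longrightarrow> \<forall>k. c i k \<in> \<real> \<Longrightarrow>
      real (card {i'. i' < m \<and> c i' = c i}) \<le> \<alpha> * real (card {j. j < n \<and> d j = c i})"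
  shows "\<exists>C>0. \<exists>\<delta>>0. \<forall>x t::real. \<bar>x\<bar> < \<delta> \<longrightarrow> 0 < t \<longrightarrow> t < \<delta> \<longrightarrow>
    C * (\<Prod>j<n. norm (cx x - rsev (d j) t)) powr \<alpha> \<le>
      (\<Prod>i<m. norm (cx x - rsev (c i) t))"
proof -
  define I where "I = c ` {..<m} \<union> d ` {..<n}"
  define w where "w x = real (card {i. i < m \<and> c i = x}) - \<alpha> * real (card {j. j < n \<and> d j = x})" for x
  have I: "finite I" "I \<noteq> {}" "c ` {..<m} \<subseteq> I" "d ` {..<n} \<subseteq> I" using m by (auto simp: I_def)
  have conv: "conv1 x" "x 0 = 0" if "x \<in> I" for x using that c d by (auto simp: I_def)
  have wsum: "(\<Sum>x\<in>I. w x * F x) = (\<Sum>i<m. F (c i)) - \<alpha> * (\<Sum>j<n. F (d j))" for F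
    using sum_card_fibres[OF I(1,3), of F] sum_card_fibres[OF I(1,4), of F]
    by (simp add: w_def left_diff_distrib sum_subtractf mult.assoc flip: sum_distrib_left)
  have w_not_c: "w x \<le> 0" if "x \<notin> c ` {..<m}" for x
  proof -
    have e: "{i. i < m \<and> c i = x} = {}" using that by auto
    show ?thesis unfolding w_def e using \<alpha> by simp
  qed
  interpret weighted_roots I w
  proof
    fix x assume x: "x \<in> I"
    show "(\<Sum>x'\<in>I. w x' * real (mc (nrx x) x x')) \<le> 0" if "\<exists>k. x k \<notin> \<real>" "w x > 0"
    proof -
      obtain i where i: "i < m" "x = c i" using w_not_c[of x] \<open>w x > 0\<close> by fastforce
      then show ?thesis unfolding wsum using nonreal[of i] that by simp
    qed
    show "w x \<le> 0" if "\<forall>k. x k \<in> \<real>"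
    proof (cases "x \<in> c ` {..<m}")
      case True
      then obtain i where "i < m" "x = c i" by auto
      then show ?thesis using re[of i] that by (simp add: w_def)
    qed (rule w_not_c)
  qed (rule I(1))
  have "\<exists>A>0. \<forall>\<^sub>F t in at_right 0. \<forall>p\<in>I \<times> I. fst p \<noteq> snd p \<longrightarrow>
     A * t ^ contact (fst p) (snd p) \<le> norm (rsev (fst p) t - rsev (snd p) t) \<and>
     A * norm (rsev (fst p) t - rsev (snd p) t) \<le> t ^ contact (fst p) (snd p) \<and> t > 0"
    (is "\<exists>A>0. \<forall>\<^sub>F t in at_right 0. \<forall>p\<in>I \<times> I. ?P p A t")
  proof (rule uniform_constant)
    show "finite (I \<times> I)" using I by auto
    show "?P p A' t" if "0 < A'" "A' \<le> A" "?P p A t" for p A A' t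
      using that by (auto intro: order_trans[OF mult_right_mono])
    fix p assume p: "p \<in> I \<times> I"
    show "\<exists>A>0. \<forall>\<^sub>F t in at_right 0. ?P p A t"
    proof (cases "fst p = snd p")
      case True then show ?thesis by (auto intro: exI[of _ 1])
    next
      case False
      let ?o = "contact (fst p) (snd p)"
      have "\<exists>A>0. \<forall>\<^sub>F t in at_right 0.
        A \<le> norm ((rsev (fst p) t - rsev (snd p) t) / cx t ^ ?o) \<and>
        A * norm ((rsev (fst p) t - rsev (snd p) t) / cx t ^ ?o) \<le> 1"
      proof (rule eventually_comparable)
        show "((\<lambda>t. norm ((rsev (fst p) t - rsev (snd p) t) / cx t ^ ?o))
          \<longlongrightarrow> norm (fst p ?o - snd p ?o)) (at_right 0)"
          using p False by (intro tendsto_norm tendsto_at_right_of_real[OF sev_diff_leading] conv) auto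
        show "norm (fst p ?o - snd p ?o) > 0" using contact(1)[OF False] by simp
      qed
      then obtain A where A: "A > 0" "\<forall>\<^sub>F t in at_right 0.
        A \<le> norm ((rsev (fst p) t - rsev (snd p) t) / cx t ^ ?o) \<and>
        A * norm ((rsev (fst p) t - rsev (snd p) t) / cx t ^ ?o) \<le> 1" by blast
      have "\<forall>\<^sub>F t in at_right 0. ?P p A t"
        using A(2) eventually_at_right_less[of 0]
        by eventually_elim (auto simp: norm_divide norm_power field_simps)
      then show ?thesis using A(1) by blast
    qed
  qed
  then obtain A1 where A1: "A1 > 0" "\<forall>\<^sub>F t in at_right 0. \<forall>p\<in>I \<times> I. ?P p A1 t" by blast
  have "\<exists>A>0. \<forall>\<^sub>F t in at_right 0. \<forall>x\<in>I. (\<exists>k. x k \<notin> \<real>) \<longrightarrow> A * t ^ nrx x \<le> \<bar>Im (rsev x t)\<bar> \<and> t > 0"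
    (is "\<exists>A>0. \<forall>\<^sub>F t in at_right 0. \<forall>x\<in>I. ?Q x A t")
  proof (rule uniform_constant[OF I(1)])
    show "?Q x A' t" if "0 < A'" "A' \<le> A" "?Q x A t" for x A A' t
      using that by (auto intro: order_trans[OF mult_right_mono])
    fix x assume x: "x \<in> I"
    show "\<exists>A>0. \<forall>\<^sub>F t in at_right 0. ?Q x A t"
    proof (cases "\<exists>k. x k \<notin> \<real>")
      case False then show ?thesis by (auto intro: exI[of _ 1])
    next
      case True
      have "\<bar>Im (x (nrx x))\<bar> > 0" using nrx[OF True] by (simp add: complex_is_Real_iff)
      from eventually_comparable[OF sev_Im_leading[OF conv(1)[OF x] True] this]
      obtain A where A: "A > 0" "\<forall>\<^sub>F t in at_right 0. A \<le> \<bar>Im (rsev x t)\<bar> / t ^ nrx x \<and>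
          A * (\<bar>Im (rsev x t)\<bar> / t ^ nrx x) \<le> 1" by blast
      have "\<forall>\<^sub>F t in at_right 0. ?Q x A t"
        using A(2) eventually_at_right_less[of 0] by eventually_elim (auto simp: field_simps)
      then show ?thesis using A(1) by blast
    qed
  qed
  then obtain A2 where A2: "A2 > 0" "\<forall>\<^sub>F t in at_right 0. \<forall>x\<in>I. ?Q x A2 t" by blast
  \<comment> \<open>The value \<open>1/4\<close>, which also bounds \<open>\<delta>\<close>, makes
    all distances from \<open>x\<close> to the roots less than \<open>1\<close>, so that the level
    \<open>s\<close> below is nonnegative.\<close>
  have "\<forall>\<^sub>F t in at_right 0. \<forall>x\<in>I. norm (rsev x t) < 1/4"
  proof (intro eventually_ball_finite[OF I(1)] ballI)
    fix x assume "x \<in> I"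
    from conv1_tendsto_0[OF conv[OF this]] show "\<forall>\<^sub>F t in at_right 0. norm (rsev x t) < 1/4"
      unfolding tendsto_iff by (auto dest!: spec[of _ "1/4"] simp: dist_norm)
  qed
  with A1(2) A2(2) have "\<forall>\<^sub>F t in at_right 0. (\<forall>p\<in>I \<times> I. ?P p A1 t) \<and> (\<forall>x\<in>I. ?Q x A2 t) \<and>
     (\<forall>x\<in>I. norm (rsev x t) < 1/4)" by eventually_elim blast
  then obtain \<delta>0 where \<delta>0: "\<delta>0 > 0" "\<And>t. 0 < t \<Longrightarrow> t < \<delta>0 \<Longrightarrow> (\<forall>p\<in>I \<times> I. ?P p A1 t) \<and> (\<forall>x\<in>I. ?Q x A2 t) \<and>
     (\<forall>x\<in>I. norm (rsev x t) < 1/4)"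
    unfolding eventually_at_right_field by blast
  define A where "A = min 1 (min A1 A2)"
  have A: "A > 0" "A \<le> 1" "A \<le> A1" "A \<le> A2" using A1 A2 by (auto simp: A_def)
  define \<delta> where "\<delta> = min \<delta>0 (1/4)"
  have \<delta>: "\<delta> > 0" "\<delta> \<le> \<delta>0" "\<delta> \<le> 1/4" using \<delta>0 by (auto simp: \<delta>_def)
  \<comment> \<open>The comparison of distances loses a factor \<open>A\<close> and, through the
    triangle inequality, a factor \<open>2\<close>. Each \<open>c i\<close> contributes one
    \<open>\<kappa>\<close> and each \<open>d j\<close> one \<open>\<mu>\<close> to the constant
    \<open>C\<close>.\<close>
  define \<kappa> where "\<kappa> = A/2"
  define \<mu> where "\<mu> = 2/A"
  have \<kappa>\<mu>: "\<kappa> > 0" "\<mu> > 0" using A by (auto simp: \<kappa>_def \<mu>_def)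
  define C where "C = \<kappa> ^ m / (\<mu> ^ n) powr \<alpha>"
  have C: "C > 0" using \<kappa>\<mu> by (simp add: C_def)
  have main: "C * (\<Prod>j<n. norm (cx x - rsev (d j) t)) powr \<alpha> \<le>
      (\<Prod>i<m. norm (cx x - rsev (c i) t))"
    if x: "\<bar>x\<bar> < \<delta>" and t: "0 < t" "t < \<delta>" for x t
  proof -
    define q where "q y = rsev y t" for y
    define D0 where "D0 y = norm (cx x - q y)" for y
    have tt: "t < \<delta>0" "t < 1" using t \<delta> by auto
    have pair: "A * t ^ contact y y' \<le> norm (q y - q y')" "A * norm (q y - q y') \<le> t ^ contact y y'"
      if "y \<in> I" "y' \<in> I" "y \<noteq> y'" for y y'
    proof -
      have "A1 * t ^ contact y y' \<le> norm (q y - q y')" "A1 * norm (q y - q y') \<le> t ^ contact y y'"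
        using \<delta>0(2)[OF t(1) tt(1)] that by (auto simp: q_def)
      then show "A * t ^ contact y y' \<le> norm (q y - q y')" "A * norm (q y - q y') \<le> t ^ contact y y'"
        using A(3) t by (auto intro: order_trans[OF mult_right_mono])
    qed
    have imag: "A * t ^ nrx y \<le> D0 y" if "y \<in> I" "\<exists>k. y k \<notin> \<real>" for y
    proof -
      have "A2 * t ^ nrx y \<le> \<bar>Im (q y)\<bar>" using \<delta>0(2)[OF t(1) tt(1)] that by (auto simp: q_def)
      moreover have "A * t ^ nrx y \<le> A2 * t ^ nrx y" using A t by (intro mult_right_mono) auto
      moreover have "\<bar>Im (q y)\<bar> \<le> D0 y"
        using abs_Im_le_cmod[of "cx x - q y"] by (simp add: D0_def)
      ultimately show ?thesis by simp
    qed
    have small: "D0 y < 1" if "y \<in> I" for y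
    proof -
      have "norm (q y) < 1/4" using \<delta>0(2)[OF t(1) tt(1)] that by (auto simp: q_def)
      then show ?thesis using norm_triangle_ineq4[of "cx x" "q y"] x \<delta> by (simp add: D0_def)
    qed
    obtain y where y: "y \<in> I" "\<And>y'. y' \<in> I \<Longrightarrow> D0 y \<le> D0 y'"
      using ex_min_finite[OF I(1,2), of D0] by blast
    show ?thesis
    proof (cases "D0 y = 0")
      \<comment> \<open>On a root itself there is no level \<open>s\<close>. That root is real, and
        \<open>re\<close> forces it among the \<open>d j\<close>, so the left-hand side is
        \<open>0\<close>.\<close>
      case True
      have "\<forall>k. y k \<in> \<real>"
      proof (rule ccontr)
        assume "\<not> ?thesis"
        then have "A * t ^ nrx y \<le> 0" using imag[OF y(1)] True by auto
        moreover have "A * t ^ nrx y > 0" using A t by simp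
        ultimately show False by simp
      qed
      have "y \<in> d ` {..<n}"
      proof (rule ccontr)
        assume no: "y \<notin> d ` {..<n}"
        then obtain i where i: "i < m" "y = c i" using y(1) by (auto simp: I_def)
        have e: "{j. j < n \<and> d j = c i} = {}" using no i by force
        have "real (card {i'. i' < m \<and> c i' = c i}) \<le> 0"
          using re[OF i(1)] \<open>\<forall>k. y k \<in> \<real>\<close> i(2) unfolding e by simp
        moreover have "0 < real (card {i'. i' < m \<and> c i' = c i})"
          unfolding of_nat_0_less_iff using i by (auto simp: card_gt_0_iff)
        ultimately show False by linarith
      qed
      then obtain j where "j < n" "y = d j" by auto
      then have z: "(\<Prod>j<n. norm (cx x - rsev (d j) t)) = 0"
        using True by (auto simp: D0_def q_def)
      show ?thesis unfolding z by (simp add: prod_nonneg)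
    next
      case False
      then have D0: "D0 y > 0" by (simp add: D0_def)
      \<comment> \<open>For a non-real \<open>y\<close> the distance is raised to at least
        \<open>t ^ nrx y\<close>. By \<open>imag\<close> this costs at most a factor
        \<open>1 / A\<close>, and it ensures \<open>s \<le> real (nrx y)\<close>, as
        \<open>rmc_sum_nonpos\<close> requires.\<close>
      define D where "D = (if \<exists>k. y k \<notin> \<real> then max (D0 y) (t ^ nrx y) else D0 y)"
      have D: "D0 y \<le> D" "A * D \<le> D0 y" "D < 1" "D > 0"
      proof -
        have AD: "A * D0 y \<le> D0 y" using A D0 by simp
        show "D0 y \<le> D" by (simp add: D_def)
        then show "D > 0" using D0 by simp
        show "A * D \<le> D0 y" using imag[OF y(1)] AD by (auto simp: D_def max_def)
        have "t ^ nrx y < 1" if "\<exists>k. y k \<notin> \<real>"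
          using nrx_pos[OF that conv(2)[OF y(1)]] t tt by (simp add: power_less_one_iff)
        then show "D < 1" using small[OF y(1)] by (auto simp: D_def)
      qed
      \<comment> \<open>The model for the distance to \<open>y'\<close>: with the level
        \<open>s\<close> defined below it equals \<open>t\<close> to the power
        \<open>rmc s y y'\<close>.\<close>
      define E where "E y' = (if y' = y then D else max D (t ^ contact y y'))" for y'
      have E: "E y' > 0" for y' using D by (auto simp: E_def)
      have lower: "\<kappa> * E y' \<le> D0 y'" and upper: "D0 y' \<le> \<mu> * E y'" if y': "y' \<in> I" for y'
      proof -
        have "\<kappa> * E y' \<le> D0 y' \<and> D0 y' \<le> \<mu> * E y'"
        proof (cases "y' = y")
          case True
          have "A / 2 * D \<le> D0 y" using D D0 by simp
          moreover have "D0 y \<le> 2 / A * D"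
          proof -
            have "1 * D \<le> 2 / A * D" using A D by (intro mult_right_mono) auto
            then show ?thesis using D by simp
          qed
          ultimately show ?thesis using True by (simp add: E_def \<kappa>_def \<mu>_def)
        next
          case False
          let ?u = "t ^ contact y y'"
          have p: "A * ?u \<le> norm (q y - q y')" "A * norm (q y - q y') \<le> ?u" using pair[OF y(1) y'] False by auto
          \<comment> \<open>As \<open>y\<close> is a nearest root, \<open>D0 y \<le> D0 y'\<close>;
            hence both \<open>D\<close> and the distance between the two roots are bounded by
            multiples of \<open>D0 y'\<close>.\<close>
          have tri1: "norm (q y - q y') \<le> D0 y + D0 y'"
            using norm_triangle_ineq4[of "cx x - q y'" "cx x - q y"] by (simp add: D0_def)
          have tri2: "D0 y' \<le> D0 y + norm (q y - q y')"
            using norm_triangle_ineq[of "cx x - q y" "q y - q y'"] by (simp add: D0_def)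
          have min: "D0 y \<le> D0 y'" by (rule y(2)[OF y'])
          have "A * D \<le> 2 * D0 y'" "A * ?u \<le> 2 * D0 y'" using D p tri1 min D0 by linarith+
          then have 1: "\<kappa> * max D ?u \<le> D0 y'" by (auto simp: \<kappa>_def max_def)
          have "A * D0 y' \<le> A * D0 y + A * norm (q y - q y')" using tri2 A by (simp flip: distrib_left)
          also have "\<dots> \<le> D + ?u" using p(2) D A D0 by (smt (verit) mult_left_le_one_le)
          also have "\<dots> \<le> 2 * max D ?u" by simp
          finally have "D0 y' \<le> \<mu> * max D ?u" using A by (simp add: \<mu>_def field_simps)
          with 1 show ?thesis using False by (simp add: E_def)
        qed
        then show "\<kappa> * E y' \<le> D0 y'" "D0 y' \<le> \<mu> * E y'" by auto
      qed
      define s where "s = ln D / ln t"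
      have lt: "ln t < 0" using t tt by simp
      have lD: "ln D = ln t * s" using lt by (simp add: s_def)
      have "ln D < 0" using D by simp
      then have s0: "s \<ge> 0" using lt by (simp add: s_def divide_nonpos_nonpos)
      have s1: "s \<le> real (nrx y)" if "\<exists>k. y k \<notin> \<real>"
      proof -
        have "t ^ nrx y \<le> D" using that by (simp add: D_def)
        then have "ln (t ^ nrx y) \<le> ln D" using t D by simp
        then have "real (nrx y) * ln t \<le> s * ln t" using t lD by (simp add: ln_realpow mult.commute)
        then show ?thesis using lt by simp
      qed
      have lnE: "ln (E y') = ln t * rmc s y y'" for y'
      proof (cases "y' = y")
        case True then show ?thesis by (simp add: E_def rmc_def lD)
      next
        case False
        let ?u = "t ^ contact y y'"
        have lu: "ln ?u = ln t * real (contact y y')" using t by (simp add: ln_realpow mult.commute)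
        have "ln (max D ?u) = max (ln D) (ln ?u)" using D t by (auto simp: max_def)
        also have "\<dots> = ln t * min s (real (contact y y'))"
          unfolding lD lu using lt by (auto simp: max_def min_def)
        finally show ?thesis using False by (auto simp: E_def rmc_def)
      qed
      have "(\<Sum>y'\<in>I. w y' * rmc s y y') \<le> 0" by (rule rmc_sum_nonpos[OF y(1) s0 s1])
      \<comment> \<open>\<open>ln t\<close> is negative, so the nonpositive weighted sum of
        exponents becomes a nonnegative weighted sum of logarithms.\<close>
      then have "0 \<le> ln t * (\<Sum>y'\<in>I. w y' * rmc s y y')" using lt by (intro mult_nonpos_nonpos) auto
      also have "\<dots> = (\<Sum>y'\<in>I. w y' * ln (E y'))"
        unfolding sum_distrib_left lnE by (rule sum.cong) auto
      finally have ineq: "\<alpha> * (\<Sum>j<n. ln (E (d j))) \<le> (\<Sum>i<m. ln (E (c i)))" unfolding wsum by simp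
      have "(\<Prod>j<n. E (d j)) powr \<alpha> = exp (\<alpha> * (\<Sum>j<n. ln (E (d j))))"
        using E by (simp add: powr_def prod_pos ln_prod less_imp_neq[symmetric])
      also have "\<dots> \<le> exp (\<Sum>i<m. ln (E (c i)))" using ineq by simp
      also have "\<dots> = (\<Prod>i<m. E (c i))" using E by (simp add: exp_sum)
      finally have PE: "(\<Prod>j<n. E (d j)) powr \<alpha> \<le> (\<Prod>i<m. E (c i))" .
      have "(\<Prod>j<n. D0 (d j)) \<le> (\<Prod>j<n. \<mu> * E (d j))"
        by (rule prod_mono) (use upper I in \<open>auto simp: D0_def\<close>)
      then have "(\<Prod>j<n. D0 (d j)) powr \<alpha> \<le> (\<mu> ^ n * (\<Prod>j<n. E (d j))) powr \<alpha>"
        using \<alpha> by (intro powr_mono2) (auto simp: prod.distrib D0_def prod_nonneg)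
      also have "\<dots> = (\<mu> ^ n) powr \<alpha> * (\<Prod>j<n. E (d j)) powr \<alpha>"
        by (rule powr_mult)
      also have "\<dots> \<le> (\<mu> ^ n) powr \<alpha> * (\<Prod>i<m. E (c i))" using PE by (intro mult_left_mono) auto
      finally have "C * (\<Prod>j<n. D0 (d j)) powr \<alpha> \<le> C * ((\<mu> ^ n) powr \<alpha> * (\<Prod>i<m. E (c i)))"
        using C by (intro mult_left_mono) auto
      also have "\<dots> = (\<Prod>i<m. \<kappa> * E (c i))" using \<kappa>\<mu> by (simp add: C_def prod.distrib)
      also have "\<dots> \<le> (\<Prod>i<m. D0 (c i))"
        by (rule prod_mono) (use lower I \<kappa>\<mu> E in \<open>auto simp: less_imp_le\<close>)
      finally show ?thesis by (simp add: D0_def q_def)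
    qed
  qed
  show ?thesis using C \<delta>(1) main by blast
qed

section \<open>The exponent in a half plane\<close>

text \<open>If \<open>k\<close> exceeded \<open>\<alpha> * l\<close>, division by
  \<open>s powr (\<alpha> * l)\<close> would leave a positive limit on the left and the limit
  \<open>0\<close> on the right.\<close>

lemma order_comparison:
  fixes p q :: "real \<Rightarrow> real"
  assumes p: "(p \<longlongrightarrow> P) (at_right 0)" and q: "(q \<longlongrightarrow> Q) (at_right 0)" "Q > 0"
    and C: "C > 0"
    and le: "\<forall>\<^sub>F s in at_right 0. C * (s ^ l * q s) powr \<alpha> \<le> s ^ k * p s"
  shows "real k \<le> \<alpha> * real l"
proof (rule ccontr)
  assume "\<not> ?thesis"
  then have pos: "real k - \<alpha> * real l > 0" by simp
  have qpos: "\<forall>\<^sub>F s in at_right 0. q s > 0" using order_tendstoD(1)[OF q(1), of 0] q(2) by simp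
  have "\<forall>\<^sub>F s in at_right 0. C * q s powr \<alpha> \<le> s powr (real k - \<alpha> * real l) * p s"
    using le qpos eventually_at_right_less[of 0]
  proof eventually_elim
    case (elim s)
    have "(s ^ l * q s) powr \<alpha> = (s ^ l) powr \<alpha> * q s powr \<alpha>" by (rule powr_mult)
    also have "(s ^ l) powr \<alpha> = s powr (\<alpha> * real l)"
      using elim by (simp add: powr_realpow[symmetric] powr_powr mult.commute)
    finally have "s powr (\<alpha> * real l) * (C * q s powr \<alpha>) \<le> s powr real k * p s"
      using elim by (simp add: powr_realpow mult_ac)
    also have "s powr real k = s powr (\<alpha> * real l) * s powr (real k - \<alpha> * real l)" by (simp flip: powr_add)
    finally show ?case using elim by (simp add: mult.assoc)
  qed
  moreover have "((\<lambda>s. C * q s powr \<alpha>) \<longlongrightarrow> C * Q powr \<alpha>) (at_right 0)"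
    using q by (intro tendsto_intros) auto
  moreover have "((\<lambda>s. s powr (real k - \<alpha> * real l) * p s) \<longlongrightarrow> 0 * P) (at_right (0::real))"
  proof (rule tendsto_mult[OF _ p])
    show "((\<lambda>s. s powr (real k - \<alpha> * real l)) \<longlongrightarrow> 0) (at_right (0::real))"
      using pos by (intro tendsto_eq_intros) (auto simp: eventually_at_right_less eventually_mono[OF eventually_at_right_less])
  qed
  ultimately have "C * Q powr \<alpha> \<le> 0 * P" by (intro tendsto_le[of "at_right (0::real)"]) auto
  moreover have "C * Q powr \<alpha> > 0" using C q(2) by simp
  ultimately show False by simp
qed

text \<open>The inequality on the open half plane \<open>y > 0\<close>, where Puiseux series are
  evaluated; \<open>flipy\<close> supplies the other half.\<close>

definition loj_up :: "(nat \<Rightarrow> nat \<Rightarrow> real) \<Rightarrow> (nat \<Rightarrow> nat \<Rightarrow> real) \<Rightarrow> real \<Rightarrow> bool" where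
  "loj_up a b \<alpha> \<longleftrightarrow> (\<exists>C>0. \<exists>r>0. \<forall>x y. \<bar>x\<bar> < r \<longrightarrow> 0 < y \<longrightarrow> y < r \<longrightarrow> C * \<bar>ev2 b x y\<bar> powr \<alpha> \<le> \<bar>ev2 a x y\<bar>)"

locale factored_pair = F: factored a N m c U + G: factored b N n d V
  for a b N m c U n d V +
  assumes conv_a: "conv2 a" and conv_b: "conv2 b" and m: "m > 0" and n: "n > 0"
    and incl: "\<exists>r>0. \<forall>x y::real. \<bar>x\<bar> < r \<longrightarrow> 0 < y \<longrightarrow> y < r \<longrightarrow> ev2 a x y = 0 \<longrightarrow> ev2 b x y = 0"
begin

definition real_radius :: "real \<Rightarrow> bool" where
  "real_radius e \<longleftrightarrow> e > 0 \<and> (\<forall>x y. \<bar>x\<bar> < e \<longrightarrow> \<bar>y\<bar> < e \<longrightarrow>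
     ev2 a (cx x) (cx y) = cx (ev2 a x y) \<and> ev2 b (cx x) (cx y) = cx (ev2 b x y))"

lemma ex_real_radius: "\<exists>e. real_radius e"
proof -
  obtain e1 where e1: "e1 > 0" "\<forall>x y. \<bar>x\<bar> < e1 \<longrightarrow> \<bar>y\<bar> < e1 \<longrightarrow> ev2 a (cx x) (cx y) = cx (ev2 a x y)"
    using ev2_of_real[OF conv_a] by blast
  obtain e2 where e2: "e2 > 0" "\<forall>x y. \<bar>x\<bar> < e2 \<longrightarrow> \<bar>y\<bar> < e2 \<longrightarrow> ev2 b (cx x) (cx y) = cx (ev2 b x y)"
    using ev2_of_real[OF conv_b] by blast
  have "real_radius (min e1 e2)" unfolding real_radius_def using e1 e2 by auto
  then show ?thesis ..
qed

lemma real_radiusD: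
  assumes "real_radius e"
  shows "e > 0" "\<bar>x\<bar> < e \<Longrightarrow> \<bar>y\<bar> < e \<Longrightarrow> ev2 a (cx x) (cx y) = cx (ev2 a x y)"
    "\<bar>x\<bar> < e \<Longrightarrow> \<bar>y\<bar> < e \<Longrightarrow> ev2 b (cx x) (cx y) = cx (ev2 b x y)"
  using assms unfolding real_radius_def by auto

text \<open>Along a series with real coefficients complex evaluation reduces to real evaluation, so
  hypotheses about real points become available.\<close>

lemma real_arc:
  assumes e: "conv1 e" "e 0 = 0" "\<And>k. e k \<in> \<real>" and r: "r > 0"
  shows "\<forall>\<^sub>F t in at_right 0. \<exists>x. rsev e t = cx x \<and> \<bar>x\<bar> < r \<and> 0 < t ^ N \<and> t ^ N < r \<and>
    ev2 a (cx x) (cx (t ^ N)) = cx (ev2 a x (t ^ N)) \<and>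
    ev2 b (cx x) (cx (t ^ N)) = cx (ev2 b x (t ^ N))"
proof -
  obtain e0 where "real_radius e0" using ex_real_radius by blast
  note e0 = real_radiusD[OF this]
  define s where "s = min e0 r"
  have s: "s > 0" "s \<le> e0" "s \<le> r" using e0 r by (auto simp: s_def)
  have "\<forall>\<^sub>F t in at_right 0. norm (rsev e t) < s"
    using near2_arc[OF near2_norm_less[OF s(1)] conv1_tendsto_0[OF e(1,2)]] by eventually_elim simp
  moreover have "\<forall>\<^sub>F t in at_right (0::real). 0 < t ^ N \<and> t ^ N < s"
    by (rule eventually_at_right_power[OF F.N, THEN iffD1]) (use s(1) in \<open>auto simp: eventually_at_right_field\<close>)
  ultimately show ?thesis using sev_real[OF e(1,3)]
  proof eventually_elim
    case (elim t)
    obtain x where x: "rsev e t = cx x" using elim(3) by (auto elim: Reals_cases)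
    then have "\<bar>x\<bar> < s" using elim(1) by simp
    then show ?case using x elim s e0(2)[of x "t ^ N"] e0(3)[of x "t ^ N"] by (intro exI[of _ x]) auto
  qed
qed

text \<open>A root with real coefficients is an actual zero arc over \<open>y > 0\<close>, so
  \<open>incl\<close> makes \<open>b\<close> vanish along it, and \<open>np_root_iff\<close> finds
  it among the \<open>d j\<close>. This keeps the quotients of multiplicities from having
  denominator \<open>0\<close>.\<close>

lemma real_root_common:
  assumes i: "i < m" "\<forall>k. c i k \<in> \<real>"
  obtains j where "j < n" "d j = c i"
proof -
  obtain r where r: "r > 0" "\<And>x y. \<bar>x\<bar> < r \<Longrightarrow> 0 < y \<Longrightarrow> y < r \<Longrightarrow> ev2 a x y = 0 \<Longrightarrow> ev2 b x y = (0::real)"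
    using incl by blast
  note ci = F.c_conv[OF i(1)] F.c0[OF i(1)]
  have "\<forall>\<^sub>F t in at_right 0. ev2 b (pev (puis N (c i)) (t ^ N)) (cx (t ^ N)) = 0"
    using real_arc[OF ci i(2)[rule_format] r(1)] F.fac_arc[OF conv1_tendsto_0[OF ci]] eventually_at_right_less[of 0]
  proof eventually_elim
    case (elim t)
    obtain x where x: "rsev (c i) t = cx x" "\<bar>x\<bar> < r" "0 < t ^ N" "t ^ N < r"
      "ev2 a (cx x) (cx (t ^ N)) = cx (ev2 a x (t ^ N))"
      "ev2 b (cx x) (cx (t ^ N)) = cx (ev2 b x (t ^ N))" using elim(1) by blast
    have "ev2 a (rsev (c i) t) (cx (t ^ N)) = 0" using elim(2) i(1) by auto
    then have "ev2 a x (t ^ N) = 0" using x(1,5) by (metis of_real_eq_0_iff)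
    then have "ev2 b x (t ^ N) = 0" using r(2) x by blast
    then show ?case using x pev_puis[OF F.N ci(2,1) elim(3)] by simp
  qed
  then have "\<forall>\<^sub>F y in at_right 0. ev2 b (pev (puis N (c i)) y) (cx y) = 0"
    by (rule eventually_at_right_power[OF F.N, THEN iffD2])
  then have "np_root b (puis N (c i))"
    unfolding np_root_def using is_puiseux_puis[of N "c i"] F.N ci by blast
  then obtain j where "j < n" "puis N (c i) = puis N (d j)" unfolding G.np_root_iff by blast
  then show ?thesis using that puis_inj[OF F.N] by metis
qed

text \<open>The candidates in \<open>Lplus\<close>, indexed by the roots of \<open>a\<close>: they
  form a finite set, nonempty as \<open>m > 0\<close>, which makes \<open>Max\<close>
  meaningful.\<close>

definition lval :: "nat \<Rightarrow> real" where
  "lval i = (if \<exists>k. c i k \<notin> \<real>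
     then real (amc m c (c i)) / real (amc n d (c i))
     else real (card {i'. i' < m \<and> c i' = c i}) / real (card {j. j < n \<and> d j = c i}))"

text \<open>All series agree at index \<open>0\<close>, where they vanish, and
  \<open>nrx (c i) > 0\<close>; each truncated contact order is thus at least
  \<open>1\<close>.\<close>

lemma mc_sum_pos:
  assumes "i < m" "\<exists>k. c i k \<notin> \<real>"
  shows "amc m c (c i) > 0" "amc n d (c i) > 0"
proof -
  have pos: "mc (nrx (c i)) (c i) x > 0" if "x 0 = 0" for x
  proof (cases "c i = x")
    case True
    then show ?thesis using nrx_pos[OF assms(2) F.c0[OF assms(1)]] by (simp add: mc_agree)
  next
    case False
    have "contact (c i) x \<noteq> 0" using contact(1)[OF False] that F.c0[OF assms(1)] by metis
    then show ?thesis using nrx_pos[OF assms(2) F.c0[OF assms(1)]] by (simp add: mc_contact[OF False])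
  qed
  show "amc m c (c i) > 0"
    by (rule sum_pos) (use m pos F.c0 in auto)
  show "amc n d (c i) > 0"
    by (rule sum_pos) (use n pos G.c0 in auto)
qed

lemma card_root_pos:
  assumes "i < m" "\<forall>k. c i k \<in> \<real>"
  shows "card {i'. i' < m \<and> c i' = c i} > 0" "card {j. j < n \<and> d j = c i} > 0"
proof -
  obtain j where "j < n" "d j = c i" using real_root_common[OF assms] .
  then show "card {i'. i' < m \<and> c i' = c i} > 0" "card {j. j < n \<and> d j = c i} > 0"
    using assms(1) by (auto simp: card_gt_0_iff)
qed

lemma lval_pos: "i < m \<Longrightarrow> lval i > 0"
  using mc_sum_pos card_root_pos unfolding lval_def by (auto simp del: of_nat_sum)

lemma Lplus_eq: "Lplus a b = Max (lval ` {..<m})"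
proof -
  have 1: "ell_generic a b (puis N (c i)) = lval i" if "i < m" "\<exists>k. c i k \<notin> \<real>" for i
    using ell_generic_eq[OF F.factored_axioms G.factored_axioms F.c0[OF that(1)] that(2)] that(2)
    by (simp add: lval_def)
  have 2: "np_root b (puis N (c i)) \<and> real (np_mult a (puis N (c i))) / real (np_mult b (puis N (c i))) = lval i"
    if i: "i < m" "\<forall>k. c i k \<in> \<real>" for i
  proof -
    obtain j where j: "j < n" "d j = c i" using real_root_common[OF i] .
    have "np_mult b (puis N (c i)) = card {j'. j' < n \<and> d j' = c i}" using G.np_mult_eq[OF j(1)] j(2) by simp
    moreover have "np_root b (puis N (c i))" unfolding G.np_root_iff using j by metis
    ultimately show ?thesis using F.np_mult_eq[OF i(1)] i(2) by (simp add: lval_def)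
  qed
  have "{ell_generic a b \<gamma> | \<gamma>. np_root a \<gamma> \<and> \<not> real_puiseux \<gamma>} \<union>
     {real (np_mult a \<beta>) / real (np_mult b \<beta>) | \<beta>. np_root a \<beta> \<and> np_root b \<beta> \<and> real_puiseux \<beta>} = lval ` {..<m}"
    (is "?A \<union> ?B = _")
  proof (intro equalityI subsetI)
    fix v assume "v \<in> ?A \<union> ?B"
    then show "v \<in> lval ` {..<m}"
    proof
      assume "v \<in> ?A"
      then obtain i where "i < m" "v = ell_generic a b (puis N (c i))" "\<not> real_puiseux (puis N (c i))"
        unfolding F.np_root_iff by blast
      then show ?thesis using 1[of i] real_puiseux_puis[OF F.N] by auto
    next
      assume "v \<in> ?B"
      then obtain i where "i < m" "v = real (np_mult a (puis N (c i))) / real (np_mult b (puis N (c i)))" "real_puiseux (puis N (c i))"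
        unfolding F.np_root_iff by blast
      then show ?thesis using 2[of i] real_puiseux_puis[OF F.N] by auto
    qed
  next
    fix v assume "v \<in> lval ` {..<m}"
    then obtain i where i: "i < m" "v = lval i" by auto
    have root: "np_root a (puis N (c i))" unfolding F.np_root_iff using i by blast
    show "v \<in> ?A \<union> ?B"
    proof (cases "\<exists>k. c i k \<notin> \<real>")
      case True
      then have "v = ell_generic a b (puis N (c i))" "\<not> real_puiseux (puis N (c i))"
        using 1[OF i(1)] i(2) real_puiseux_puis[OF F.N] by auto
      then show ?thesis using root by blast
    next
      case False
      then have "v = real (np_mult a (puis N (c i))) / real (np_mult b (puis N (c i)))" "real_puiseux (puis N (c i))"
        "np_root b (puis N (c i))"
        using 2[OF i(1)] i(2) real_puiseux_puis[OF F.N] by auto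
      then show ?thesis using root by blast
    qed
  qed
  then show ?thesis by (simp add: Lplus_def)
qed

lemma Lplus_le_iff: "Lplus a b \<le> \<alpha> \<longleftrightarrow> (\<forall>i<m. lval i \<le> \<alpha>)"
  unfolding Lplus_eq using m by (subst Max_le_iff) auto

lemma Lplus_pos: "Lplus a b > 0"
  unfolding Lplus_eq using m lval_pos by (subst Max_gr_iff) auto

section \<open>Exponents at least \<open>Lplus\<close> are admissible\<close>

lemma upper:
  assumes \<alpha>: "\<alpha> > 0" "Lplus a b \<le> \<alpha>"
  shows "loj_up a b \<alpha>"
proof -
  have le: "lval i \<le> \<alpha>" if "i < m" for i using \<alpha> that Lplus_le_iff by blast
  have "\<exists>C>0. \<exists>\<delta>>0. \<forall>x t::real. \<bar>x\<bar> < \<delta> \<longrightarrow> 0 < t \<longrightarrow> t < \<delta> \<longrightarrow>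
    C * (\<Prod>j<n. norm (cx x - rsev (d j) t)) powr \<alpha> \<le>
      (\<Prod>i<m. norm (cx x - rsev (c i) t))"
  proof (rule product_inequality[OF \<alpha>(1) m F.c_conv F.c0 G.c_conv G.c0])
    fix i assume i: "i < m"
    show "real (amc m c (c i)) \<le> \<alpha> * real (amc n d (c i))"
      if "\<exists>k. c i k \<notin> \<real>"
      using le[OF i] mc_sum_pos[OF i that] that by (simp add: lval_def pos_divide_le_eq del: of_nat_sum)
    show "real (card {i'. i' < m \<and> c i' = c i}) \<le> \<alpha> * real (card {j. j < n \<and> d j = c i})"
      if "\<forall>k. c i k \<in> \<real>"
      using le[OF i] card_root_pos[OF i that] that by (simp add: lval_def pos_divide_le_eq)
  qed
  then obtain C \<delta> where C: "C > 0" "\<delta> > 0" "\<And>x t::real. \<bar>x\<bar> < \<delta> \<Longrightarrow> 0 < t \<Longrightarrow> t < \<delta> \<Longrightarrow>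
    C * (\<Prod>j<n. norm (cx x - rsev (d j) t)) powr \<alpha> \<le>
      (\<Prod>i<m. norm (cx x - rsev (c i) t))" by blast
  have nU: "near2 (\<lambda>x t. norm (U x t - U 0 0) < norm (U 0 0) / 2)" using F.U by (intro germ2_near) auto
  have nV: "near2 (\<lambda>x t. norm (V x t - V 0 0) < norm (V 0 0) / 2)" using G.U by (intro germ2_near) auto
  obtain e where e: "e > 0" "\<And>x t. norm x < e \<Longrightarrow> norm t < e \<Longrightarrow>
     (norm (U x t - U 0 0) < norm (U 0 0) / 2 \<and> norm (V x t - V 0 0) < norm (V 0 0) / 2) \<and>
     (ev2 a x (t ^ N) = U x t * (\<Prod>i<m. x - sev (c i) t) \<and> ev2 b x (t ^ N) = V x t * (\<Prod>i<n. x - sev (d i) t))"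
    using near2_conj[OF near2_conj[OF nU nV] near2_conj[OF F.fac G.fac]] unfolding near2_def by blast
  obtain e0 where "real_radius e0" using ex_real_radius by blast
  note e0 = real_radiusD[OF this]
  \<comment> \<open>\<open>s \<le> 1\<close> gives \<open>s ^ N \<le> s\<close>, so
    \<open>y < s ^ N\<close> controls both \<open>y\<close> and \<open>t = root N y\<close>.\<close>
  define s where "s = min (min e \<delta>) (min e0 1)"
  have s: "s > 0" "s \<le> e" "s \<le> \<delta>" "s \<le> e0" "s \<le> 1" using e e0 C by (auto simp: s_def)
  define r where "r = s ^ N"
  have r: "r > 0" "r \<le> s"
    using s F.N power_decreasing[of 1 N s] by (auto simp: r_def)
  \<comment> \<open>Near the origin \<open>norm (U x t) \<ge> u\<close> and
    \<open>norm (V x t) \<le> v\<close>; the units enter the constant through these bounds.\<close>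
  define u where "u = norm (U 0 0) / 2"
  define v where "v = 2 * norm (V 0 0)"
  have uv: "u > 0" "v > 0" using F.U G.U by (auto simp: u_def v_def)
  define C' where "C' = u * C / v powr \<alpha>"
  have C': "C' > 0" using uv C by (simp add: C'_def)
  have "C' * \<bar>ev2 b x y\<bar> powr \<alpha> \<le> \<bar>ev2 a x y\<bar>" if xy: "\<bar>x\<bar> < r" "0 < y" "y < r" for x y :: real
  proof -
    define t where "t = root N y"
    have t: "t > 0" "t ^ N = y" using xy F.N by (auto simp: t_def)
    have ts: "t < s" using xy F.N s unfolding t_def r_def
      by (metis less_imp_le real_root_less_iff real_root_power_cancel)
    let ?x = "cx x" and ?t = "cx t"
    have nn: "norm ?x < e" "norm ?t < e" using xy r s ts t by auto
    note E = e(2)[OF nn]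
    have ra: "norm (ev2 a ?x (?t ^ N)) = \<bar>ev2 a x y\<bar>" "norm (ev2 b ?x (?t ^ N)) = \<bar>ev2 b x y\<bar>"
      using e0(2)[of x y] e0(3)[of x y] xy r s t by (auto simp flip: of_real_power)
    define PC where "PC = (\<Prod>i<m. norm (?x - sev (c i) ?t))"
    define PD where "PD = (\<Prod>i<n. norm (?x - sev (d i) ?t))"
    have CP: "C * PD powr \<alpha> \<le> PC" unfolding PC_def PD_def by (rule C(3)) (use xy r s ts t in auto)
    have fa: "\<bar>ev2 a x y\<bar> = norm (U ?x ?t) * PC" "\<bar>ev2 b x y\<bar> = norm (V ?x ?t) * PD"
      unfolding ra[symmetric] using E by (auto simp: norm_mult PC_def PD_def prod_norm)
    have PDn: "PD \<ge> 0" "PC \<ge> 0" by (auto simp: PD_def PC_def prod_nonneg)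
    have "u \<le> norm (U ?x ?t)"
      using E norm_triangle_ineq2[of "U 0 0" "U ?x ?t"] by (simp add: u_def norm_minus_commute)
    then have f1: "u * PC \<le> \<bar>ev2 a x y\<bar>" using fa PDn by (simp add: mult_right_mono)
    have "norm (V ?x ?t) \<le> v"
      using E norm_triangle_ineq2[of "V ?x ?t" "V 0 0"] norm_ge_zero[of "V 0 0"] unfolding v_def by linarith
    then have "\<bar>ev2 b x y\<bar> \<le> v * PD" using fa PDn by (simp add: mult_right_mono)
    then have "\<bar>ev2 b x y\<bar> powr \<alpha> \<le> (v * PD) powr \<alpha>" using \<alpha> by (intro powr_mono2) auto
    also have "\<dots> = v powr \<alpha> * PD powr \<alpha>" by (rule powr_mult)
    finally have "C' * \<bar>ev2 b x y\<bar> powr \<alpha> \<le> C' * (v powr \<alpha> * PD powr \<alpha>)" using C' by (intro mult_left_mono) auto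
    also have "\<dots> = u * (C * PD powr \<alpha>)" using uv by (simp add: C'_def)
    also have "\<dots> \<le> u * PC" using CP uv by (intro mult_left_mono) auto
    finally show ?thesis using f1 by simp
  qed
  then show ?thesis unfolding loj_up_def using C' r(1) by blast
qed

section \<open>Admissible exponents are at least \<open>Lplus\<close>\<close>

lemma lower_nonreal:
  assumes L: "loj_up a b \<alpha>" and i: "i < m" "\<exists>k. c i k \<notin> \<real>"
  shows "lval i \<le> \<alpha>"
proof -
  obtain C r where C: "C > 0" "r > 0" "\<And>x y. \<bar>x\<bar> < r \<Longrightarrow> 0 < y \<Longrightarrow> y < r \<Longrightarrow> C * \<bar>ev2 b x y\<bar> powr \<alpha> \<le> \<bar>ev2 a x y\<bar>"
    using L unfolding loj_up_def by blast
  let ?\<rho> = "nrx (c i)"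
  \<comment> \<open>One constant \<open>s\<close> off a finite set of coefficients is generic
    enough: along the resulting arc the orders of \<open>a\<close> and \<open>b\<close> in
    \<open>t\<close> are the numerator and the denominator of \<open>lval i\<close>.\<close>
  have "\<forall>\<^sub>F s in cofinite. (\<forall>i'<m. cx s \<noteq> c i' ?\<rho>) \<and> (\<forall>j<n. cx s \<noteq> d j ?\<rho>)"
    by (intro eventually_conj generic_real)
  then have "\<exists>s. (\<forall>i'<m. cx s \<noteq> c i' ?\<rho>) \<and> (\<forall>j<n. cx s \<noteq> d j ?\<rho>)"
    by (rule eventually_happens'[rotated]) (simp add: infinite_UNIV_char_0)
  then obtain s where s: "\<And>i'. i' < m \<Longrightarrow> cx s \<noteq> c i' ?\<rho>" "\<And>j. j < n \<Longrightarrow> cx s \<noteq> d j ?\<rho>"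
    by blast
  define e where "e = ra (c i) s"
  have e: "conv1 e" "e 0 = 0" "\<And>k. e k \<in> \<real>"
    using conv1_ra ra_0[OF i(2) F.c0[OF i(1)]] ra_real by (auto simp: e_def)
  have e_c: "e \<noteq> c i'" "contact e (c i') = mc ?\<rho> (c i) (c i')" if "i' < m" for i'
    using contact_ra[of s "c i'" "c i"] s(1)[OF that] by (auto simp: e_def)
  have e_d: "e \<noteq> d j" "contact e (d j) = mc ?\<rho> (c i) (d j)" if "j < n" for j
    using contact_ra[of s "d j" "c i"] s(2)[OF that] by (auto simp: e_def)
  define Sa where "Sa = amc m c (c i)"
  define Sb where "Sb = amc n d (c i)"
  have S: "(\<Sum>i'<m. contact e (c i')) = Sa" "(\<Sum>j<n. contact e (d j)) = Sb"
    using e_c e_d by (auto simp: Sa_def Sb_def intro!: sum.cong)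
  let ?f = "\<lambda>t. ev2 a (rsev e t) (cx (t ^ N))"
  let ?g = "\<lambda>t. ev2 b (rsev e t) (cx (t ^ N))"
  obtain K where K: "K \<noteq> 0" "((\<lambda>t. ?f t / cx t ^ Sa) \<longlongrightarrow> K) (at_right 0)"
    using F.arc_leading[OF e(1,2) e_c(1)] S by auto
  obtain K' where K': "K' \<noteq> 0" "((\<lambda>t. ?g t / cx t ^ Sb) \<longlongrightarrow> K') (at_right 0)"
    using G.arc_leading[OF e(1,2) e_d(1)] S by auto
  have "real Sa \<le> \<alpha> * real Sb"
  proof (rule order_comparison[OF tendsto_norm[OF K(2)] tendsto_norm[OF K'(2)] _ C(1)])
    show "norm K' > 0" using K' by simp
    show "\<forall>\<^sub>F t in at_right 0. C * (t ^ Sb * norm (?g t / cx t ^ Sb)) powr \<alpha> \<le>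
       t ^ Sa * norm (?f t / cx t ^ Sa)"
      using real_arc[OF e C(2)] eventually_at_right_less[of 0]
    proof eventually_elim
      case (elim t)
      obtain x where x: "rsev e t = cx x" "\<bar>x\<bar> < r" "0 < t ^ N" "t ^ N < r"
        "ev2 a (cx x) (cx (t ^ N)) = cx (ev2 a x (t ^ N))"
        "ev2 b (cx x) (cx (t ^ N)) = cx (ev2 b x (t ^ N))" using elim(1) by blast
      have "norm (?f t) = \<bar>ev2 a x (t ^ N)\<bar>" "norm (?g t) = \<bar>ev2 b x (t ^ N)\<bar>"
        unfolding x(1) x(5) x(6) by simp_all
      then show ?case using C(3)[OF x(2-4)] elim(2) by (simp add: norm_divide norm_power)
    qed
  qed
  then show ?thesis using mc_sum_pos[OF i] i(2)
    by (simp add: lval_def Sa_def Sb_def pos_divide_le_eq del: of_nat_sum)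
qed

text \<open>At a fixed small \<open>t\<close> where both cofactors are nonzero at the root, the
  germs vanish there to orders exactly \<open>k\<close> and \<open>l\<close> in the real
  displacement \<open>s\<close>, so \<open>order_comparison\<close> applies on this horizontal
  line.\<close>

lemma lower_real:
  assumes L: "loj_up a b \<alpha>" and i: "i < m" "\<forall>k. c i k \<in> \<real>"
  shows "lval i \<le> \<alpha>"
proof -
  obtain C r where C: "C > 0" "r > 0" "\<And>x y. \<bar>x\<bar> < r \<Longrightarrow> 0 < y \<Longrightarrow> y < r \<Longrightarrow> C * \<bar>ev2 b x y\<bar> powr \<alpha> \<le> \<bar>ev2 a x y\<bar>"
    using L unfolding loj_up_def by blast
  obtain j where j: "j < n" "d j = c i" using real_root_common[OF i] .
  define k where "k = card {i'. i' < m \<and> c i' = c i}"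
  define l where "l = card {j'. j' < n \<and> d j' = c i}"
  obtain H where H: "germ2 H" "near2 (\<lambda>x t. ev2 a x (t ^ N) = (x - sev (c i) t) ^ k * H x t)"
    "\<forall>\<^sub>F t in at_right 0. H (rsev (c i) t) (cx t) \<noteq> 0"
    using F.multiplicity_cofactor[OF i(1)] unfolding k_def by blast
  obtain H' where H': "germ2 H'" "near2 (\<lambda>x t. ev2 b x (t ^ N) = (x - sev (c i) t) ^ l * H' x t)"
    "\<forall>\<^sub>F t in at_right 0. H' (rsev (c i) t) (cx t) \<noteq> 0"
    using G.multiplicity_cofactor[OF j(1)] unfolding l_def j(2) by blast
  obtain e where e: "e > 0" "\<And>x t. norm x < e \<Longrightarrow> norm t < e \<Longrightarrow>
     (ev2 a x (t ^ N) = (x - sev (c i) t) ^ k * H x t \<and> ev2 b x (t ^ N) = (x - sev (c i) t) ^ l * H' x t) \<and>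
     (isCont (\<lambda>x. H x t) x \<and> isCont (\<lambda>x. H' x t) x)"
    using near2_conj[OF near2_conj[OF H(2) H'(2)] near2_conj[OF germ2_isCont_x[OF H(1)] germ2_isCont_x[OF H'(1)]]]
    unfolding near2_def by blast
  obtain e0 where "real_radius e0" using ex_real_radius by blast
  note e0 = real_radiusD[OF this]
  define \<delta> where "\<delta> = min e (min e0 r)"
  have \<delta>: "\<delta> > 0" "\<delta> \<le> e" "\<delta> \<le> e0" "\<delta> \<le> r" using e e0 C by (auto simp: \<delta>_def)
  note ci = F.c_conv[OF i(1)] F.c0[OF i(1)]
  have "\<forall>\<^sub>F t in at_right 0. \<exists>z. rsev (c i) t = cx z \<and> \<bar>z\<bar> < \<delta> \<and> 0 < t \<and> t < \<delta> \<and> 0 < t ^ N \<and> t ^ N < \<delta> \<and>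
     H (cx z) (cx t) \<noteq> 0 \<and> H' (cx z) (cx t) \<noteq> 0"
  proof -
    have "\<forall>\<^sub>F t in at_right (0::real). 0 < t \<and> t < \<delta>"
      using \<delta>(1) unfolding eventually_at_right_field by blast
    with real_arc[OF ci i(2)[rule_format] \<delta>(1)] H(3) H'(3) show ?thesis by eventually_elim auto
  qed
  then have "\<exists>t z. rsev (c i) t = cx z \<and> \<bar>z\<bar> < \<delta> \<and> 0 < t \<and> t < \<delta> \<and> 0 < t ^ N \<and> t ^ N < \<delta> \<and>
     H (cx z) (cx t) \<noteq> 0 \<and> H' (cx z) (cx t) \<noteq> 0"
    by (auto dest: eventually_happens)
  then obtain t z where tz: "rsev (c i) t = cx z" "\<bar>z\<bar> < \<delta>" "0 < t" "t < \<delta>" "0 < t ^ N" "t ^ N < \<delta>"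
     "H (cx z) (cx t) \<noteq> 0" "H' (cx z) (cx t) \<noteq> 0" by blast
  have lim: "((\<lambda>s. norm (G (cx (z + s)) (cx t))) \<longlongrightarrow> norm (G (cx z) (cx t))) (at_right 0)"
    if "isCont (\<lambda>x. G x (cx t)) (cx z)" for G
  proof -
    have "((\<lambda>s. cx (z + s)) \<longlongrightarrow> cx (z + 0)) (at_right 0)"
      by (intro tendsto_intros)
    then show ?thesis using isCont_tendsto_compose[OF that] by (intro tendsto_norm) simp
  qed
  have zt: "norm (cx z) < e" "norm (cx t) < e" using tz \<delta> by auto
  have "real k \<le> \<alpha> * real l"
  proof (rule order_comparison[OF lim[of H] lim[of H'] _ C(1)])
    show "isCont (\<lambda>x. H x (cx t)) (cx z)"
      "isCont (\<lambda>x. H' x (cx t)) (cx z)" using e(2)[OF zt] by auto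
    show "norm (H' (cx z) (cx t)) > 0" using tz by simp
    have "\<forall>\<^sub>F s in at_right (0::real). 0 < s \<and> s < \<delta> - \<bar>z\<bar>"
      using tz(2) unfolding eventually_at_right_field by (intro exI[of _ "\<delta> - \<bar>z\<bar>"]) auto
    then show "\<forall>\<^sub>F s in at_right 0. C * (s ^ l * norm (H' (cx (z + s)) (cx t))) powr \<alpha>
       \<le> s ^ k * norm (H (cx (z + s)) (cx t))"
    proof eventually_elim
      case (elim s)
      have zs: "\<bar>z + s\<bar> < \<delta>" using elim by linarith
      have E: "ev2 a (cx (z + s)) (cx t ^ N) = cx s ^ k * H (cx (z + s)) (cx t)"
        "ev2 b (cx (z + s)) (cx t ^ N) = cx s ^ l * H' (cx (z + s)) (cx t)"
        using e(2)[of "cx (z + s)" "cx t"] zs zt \<delta> tz(1) unfolding norm_of_real by auto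
      have "\<bar>ev2 a (z + s) (t ^ N)\<bar> = norm (ev2 a (cx (z + s)) (cx (t ^ N)))"
        "\<bar>ev2 b (z + s) (t ^ N)\<bar> = norm (ev2 b (cx (z + s)) (cx (t ^ N)))"
        using e0(2)[of "z + s" "t ^ N"] e0(3)[of "z + s" "t ^ N"] zs tz \<delta> by (simp_all del: of_real_add of_real_power)
      then have "\<bar>ev2 a (z + s) (t ^ N)\<bar> = s ^ k * norm (H (cx (z + s)) (cx t))"
        "\<bar>ev2 b (z + s) (t ^ N)\<bar> = s ^ l * norm (H' (cx (z + s)) (cx t))"
        unfolding of_real_power E using elim by (simp_all add: norm_mult norm_power)
      then show ?case using C(3)[of "z + s" "t ^ N"] zs \<delta> tz by auto
    qed
  qed
  then show ?thesis using card_root_pos[OF i] i(2)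
    by (simp add: lval_def k_def l_def pos_divide_le_eq)
qed

lemma loj_up_iff: assumes "\<alpha> > 0" shows "loj_up a b \<alpha> \<longleftrightarrow> Lplus a b \<le> \<alpha>"
  using upper[OF assms] lower_real lower_nonreal Lplus_le_iff by blast

end

lemma half_plane:
  assumes "conv2 a" "conv2 b" "regular_x a" "regular_x b" "a 0 0 = 0" "b 0 0 = 0"
    and "\<exists>r>0. \<forall>x y::real. \<bar>x\<bar> < r \<longrightarrow> 0 < y \<longrightarrow> y < r \<longrightarrow> ev2 a x y = 0 \<longrightarrow> ev2 b x y = 0"
  shows "Lplus a b > 0" "\<alpha> > 0 \<Longrightarrow> loj_up a b \<alpha> \<longleftrightarrow> Lplus a b \<le> \<alpha>"
proof -
  obtain N m c U n d V where "factored a N m c U" "factored b N n d V" "m > 0" "n > 0"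
    using ex_factored_pair[OF assms(1,3,2,4,5,6)] by blast
  then have P: "factored_pair a b N m c U n d V"
    using assms by (intro factored_pair.intro factored_pair_axioms.intro) auto
  show "Lplus a b > 0" by (rule factored_pair.Lplus_pos[OF P])
  show "\<alpha> > 0 \<Longrightarrow> loj_up a b \<alpha> \<longleftrightarrow> Lplus a b \<le> \<alpha>" by (rule factored_pair.loj_up_iff[OF P])
qed

section \<open>Gluing the two half planes\<close>

lemma ev2_flipy: "ev2 (flipy a) x y = ev2 a x (- y)"
proof -
  have e: "of_real (flipy a i j) * x ^ i * y ^ j = of_real (a i j) * x ^ i * (- y) ^ j" for i j
    by (simp add: flipy_def power_minus[of y j] mult_ac)
  show ?thesis unfolding ev2_def by (rule infsum_cong, clarify, rule e)
qed

text \<open>The axis \<open>y = 0\<close> belongs to neither open half plane; the inequality is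
  carried to it by continuity in \<open>y\<close>.\<close>

lemma ev2_tendsto_axis:
  assumes "conv2 a"
  shows "\<exists>e>0. \<forall>x::real. \<bar>x\<bar> < e \<longrightarrow> ((\<lambda>y. ev2 a x y) \<longlongrightarrow> ev2 a x 0) (at_right 0)"
proof -
  obtain r M where r: "r > 0" "bsep r M (ev2 a)" using germ2_ev2[OF assms] unfolding germ2_def by blast
  obtain e0 where e0: "e0 > 0" "\<forall>x y. \<bar>x\<bar> < e0 \<longrightarrow> \<bar>y\<bar> < e0 \<longrightarrow>
     ev2 a (cx x) (cx y) = cx (ev2 a x y)" using ev2_of_real[OF assms] by blast
  have "((\<lambda>y. ev2 a x y) \<longlongrightarrow> ev2 a x 0) (at_right 0)" if x: "\<bar>x\<bar> < min r e0" for x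
  proof -
    have "ev2 a (cx x) holomorphic_on ball 0 r" using x by (intro bsepD(2)[OF r(2)]) auto
    then have "isCont (ev2 a (cx x)) 0"
      using r holomorphic_on_imp_continuous_on continuous_on_eq_continuous_at[of "ball 0 r"] by fastforce
    then have l1: "((\<lambda>y. Re (ev2 a (cx x) (cx y))) \<longlongrightarrow> Re (ev2 a (cx x) 0)) (at_right 0)"
      unfolding isCont_def by (intro tendsto_Re tendsto_at_right_of_real)
    have l2: "\<forall>\<^sub>F y in at_right 0. Re (ev2 a (cx x) (cx y)) = ev2 a x y"
      using e0 x unfolding eventually_at_right_field by (intro exI[of _ e0]) auto
    have l3: "Re (ev2 a (cx x) 0) = ev2 a x 0"
      using e0(2)[rule_format, of x 0] e0(1) x by simp
    show ?thesis using Lim_transform_eventually[OF l1 l2] unfolding l3 .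
  qed
  then show ?thesis using r e0 by (intro exI[of _ "min r e0"]) auto
qed

lemma loj_iff_half_planes:
  assumes ab: "conv2 a" "conv2 b" and \<alpha>: "\<alpha> > 0"
  shows "(\<exists>C>0. \<exists>r>0. \<forall>x y. norm (x, y) \<le> r \<longrightarrow> \<bar>ev2 a x y\<bar> \<ge> C * \<bar>ev2 b x y\<bar> powr \<alpha>) \<longleftrightarrow>
    loj_up a b \<alpha> \<and> loj_up (flipy a) (flipy b) \<alpha>"
proof
  assume "\<exists>C>0. \<exists>r>0. \<forall>x y. norm (x, y) \<le> r \<longrightarrow> \<bar>ev2 a x y\<bar> \<ge> C * \<bar>ev2 b x y\<bar> powr \<alpha>"
  then obtain C r where C: "C > 0" "r > 0" "\<And>x y. norm (x, y) \<le> r \<Longrightarrow> C * \<bar>ev2 b x y\<bar> powr \<alpha> \<le> \<bar>ev2 a x y\<bar>" by blast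
  \<comment> \<open>The Euclidean norm is at most \<open>\<bar>x\<bar> + \<bar>y\<bar>\<close>,
    hence the halved radius.\<close>
  have n: "norm (x, y) \<le> r" if "\<bar>x\<bar> < r/2" "\<bar>y\<bar> < r/2" for x y
    using norm_Pair_le[of x y] that by simp
  have "loj_up a b \<alpha>" unfolding loj_up_def
    using C n by (intro exI[of _ C] conjI exI[of _ "r/2"]) auto
  moreover have "loj_up (flipy a) (flipy b) \<alpha>" unfolding loj_up_def ev2_flipy
    using C n by (intro exI[of _ C] conjI exI[of _ "r/2"]) auto
  ultimately show "loj_up a b \<alpha> \<and> loj_up (flipy a) (flipy b) \<alpha>" by blast
next
  assume L: "loj_up a b \<alpha> \<and> loj_up (flipy a) (flipy b) \<alpha>"
  obtain C1 r1 where C1: "C1 > 0" "r1 > 0" "\<And>x y. \<bar>x\<bar> < r1 \<Longrightarrow> 0 < y \<Longrightarrow> y < r1 \<Longrightarrow> C1 * \<bar>ev2 b x y\<bar> powr \<alpha> \<le> \<bar>ev2 a x y\<bar>"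
    using L unfolding loj_up_def by blast
  obtain C2 r2 where C2: "C2 > 0" "r2 > 0" "\<And>x y. \<bar>x\<bar> < r2 \<Longrightarrow> 0 < y \<Longrightarrow> y < r2 \<Longrightarrow> C2 * \<bar>ev2 b x (-y)\<bar> powr \<alpha> \<le> \<bar>ev2 a x (-y)\<bar>"
    using L unfolding loj_up_def ev2_flipy by blast
  obtain e1 where e1: "e1 > 0" "\<And>x::real. \<bar>x\<bar> < e1 \<Longrightarrow> ((\<lambda>y. ev2 a x y) \<longlongrightarrow> ev2 a x 0) (at_right 0)"
    using ev2_tendsto_axis[OF ab(1)] by blast
  obtain e2 where e2: "e2 > 0" "\<And>x::real. \<bar>x\<bar> < e2 \<Longrightarrow> ((\<lambda>y. ev2 b x y) \<longlongrightarrow> ev2 b x 0) (at_right 0)"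
    using ev2_tendsto_axis[OF ab(2)] by blast
  define C where "C = min C1 C2"
  define r where "r = min (min r1 r2) (min e1 e2) / 2"
  have C: "C > 0" "C \<le> C1" "C \<le> C2" using C1 C2 by (auto simp: C_def)
  have r: "r > 0" "r < r1" "r < r2" "r < e1" "r < e2" using C1 C2 e1 e2 by (auto simp: r_def)
  have "C * \<bar>ev2 b x y\<bar> powr \<alpha> \<le> \<bar>ev2 a x y\<bar>" if "norm (x, y) \<le> r" for x y
  proof -
    have xy: "\<bar>x\<bar> \<le> r" "\<bar>y\<bar> \<le> r" using norm_fst_le[of x y] norm_snd_le[of y x] that by auto
    consider "y > 0" | "y < 0" | "y = 0" by linarith
    then show ?thesis
    proof cases
      case 1
      have "C * \<bar>ev2 b x y\<bar> powr \<alpha> \<le> C1 * \<bar>ev2 b x y\<bar> powr \<alpha>" using C by (intro mult_right_mono) auto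
      then show ?thesis using C1(3)[of x y] 1 xy r by auto
    next
      case 2
      have "C * \<bar>ev2 b x y\<bar> powr \<alpha> \<le> C2 * \<bar>ev2 b x y\<bar> powr \<alpha>" using C by (intro mult_right_mono) auto
      then show ?thesis using C2(3)[of x "-y"] 2 xy r by auto
    next
      case 3
      have "C1 * \<bar>ev2 b x 0\<bar> powr \<alpha> \<le> \<bar>ev2 a x 0\<bar>"
      proof (rule tendsto_le[of "at_right (0::real)"])
        show "((\<lambda>y. \<bar>ev2 a x y\<bar>) \<longlongrightarrow> \<bar>ev2 a x 0\<bar>) (at_right 0)"
          by (intro tendsto_rabs e1) (use xy r in auto)
        have "((\<lambda>y. \<bar>ev2 b x y\<bar>) \<longlongrightarrow> \<bar>ev2 b x 0\<bar>) (at_right 0)"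
          by (intro tendsto_rabs e2) (use xy r in auto)
        \<comment> \<open>The base may tend to \<open>0\<close>, where continuity of the power
          relies on \<open>\<alpha> > 0\<close>.\<close>
        then have "((\<lambda>y. \<bar>ev2 b x y\<bar> powr \<alpha>) \<longlongrightarrow> \<bar>ev2 b x 0\<bar> powr \<alpha>) (at_right 0)"
          by (rule tendsto_powr'[OF _ tendsto_const]) (use \<alpha> in auto)
        then show "((\<lambda>y. C1 * \<bar>ev2 b x y\<bar> powr \<alpha>) \<longlongrightarrow> C1 * \<bar>ev2 b x 0\<bar> powr \<alpha>) (at_right 0)"
          by (intro tendsto_mult tendsto_const)
        show "\<forall>\<^sub>F y in at_right 0. C1 * \<bar>ev2 b x y\<bar> powr \<alpha> \<le> \<bar>ev2 a x y\<bar>"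
          unfolding eventually_at_right_field using C1 xy r by (intro exI[of _ r1]) auto
      qed auto
      moreover have "C * \<bar>ev2 b x 0\<bar> powr \<alpha> \<le> C1 * \<bar>ev2 b x 0\<bar> powr \<alpha>" using C by (intro mult_right_mono) auto
      ultimately show ?thesis using 3 by simp
    qed
  qed
  then show "\<exists>C>0. \<exists>r>0. \<forall>x y. norm (x, y) \<le> r \<longrightarrow> \<bar>ev2 a x y\<bar> \<ge> C * \<bar>ev2 b x y\<bar> powr \<alpha>"
    using C(1) r(1) by blast
qed

lemma flipy_invariants:
  "conv2 (flipy a) \<longleftrightarrow> conv2 a" "regular_x (flipy a) \<longleftrightarrow> regular_x a" "flipy a 0 0 = a 0 0"
proof -
  show "conv2 (flipy a) \<longleftrightarrow> conv2 a"
    unfolding conv2_def by (simp add: flipy_def abs_mult power_abs)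
  show "regular_x (flipy a) \<longleftrightarrow> regular_x a"
    unfolding regular_x_def by (simp add: flipy_def)
qed (simp add: flipy_def)

theorem theorem3p2:
  fixes a b :: "nat \<Rightarrow> nat \<Rightarrow> real"
  assumes conv_a: "conv2 a" and conv_b: "conv2 b"
    and nonzero_a: "a \<noteq> (\<lambda>i j. 0)" and nonzero_b: "b \<noteq> (\<lambda>i j. 0)"
    and reg_a: "regular_x a" and reg_b: "regular_x b"
    and f0: "a 0 0 = 0" and g0: "b 0 0 = 0"
    and zero_incl: "\<exists>r>0. \<forall>x y::real. norm (x, y) < r \<longrightarrow> ev2 a x y = 0 \<longrightarrow> ev2 b x y = 0"
  shows "loj_exp (ev2 a) (ev2 b) = max (Lplus a b) (Lminus a b)"
proof -
  obtain r where r: "r > 0" "\<And>x y::real. norm (x, y) < r \<Longrightarrow> ev2 a x y = 0 \<Longrightarrow> ev2 b x y = 0"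
    using zero_incl by blast
  have n: "norm (x, y) < r" if "\<bar>x\<bar> < r/2" "\<bar>y\<bar> < r/2" for x y :: real
    using norm_Pair_le[of x y] that by simp
  have up: "\<exists>r>0. \<forall>x y::real. \<bar>x\<bar> < r \<longrightarrow> 0 < y \<longrightarrow> y < r \<longrightarrow> ev2 a x y = 0 \<longrightarrow> ev2 b x y = 0"
    using r n by (intro exI[of _ "r/2"]) auto
  have down: "\<exists>r>0. \<forall>x y::real. \<bar>x\<bar> < r \<longrightarrow> 0 < y \<longrightarrow> y < r \<longrightarrow> ev2 (flipy a) x y = 0 \<longrightarrow> ev2 (flipy b) x y = 0"
    unfolding ev2_flipy using r n by (intro exI[of _ "r/2"]) auto
  note P = half_plane[OF conv_a conv_b reg_a reg_b f0 g0 up]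
  have M: "Lminus a b > 0" "\<And>\<alpha>. \<alpha> > 0 \<Longrightarrow> loj_up (flipy a) (flipy b) \<alpha> \<longleftrightarrow> Lminus a b \<le> \<alpha>"
    unfolding Lminus_def
    using half_plane[of "flipy a" "flipy b"] conv_a conv_b reg_a reg_b f0 g0 down
    by (simp_all add: flipy_invariants)
  \<comment> \<open>The admissible exponents form exactly the closed ray above the maximum; for
    \<open>\<alpha> \<le> 0\<close> both sides fail because \<open>Lplus\<close> is positive. The
    infimum is therefore attained.\<close>
  have e: "\<alpha> > 0 \<and> (\<exists>C>0. \<exists>r>0. \<forall>x y. norm (x, y) \<le> r \<longrightarrow> \<bar>ev2 a x y\<bar> \<ge> C * \<bar>ev2 b x y\<bar> powr \<alpha>) \<longleftrightarrow>
     max (Lplus a b) (Lminus a b) \<le> \<alpha>" for \<alpha>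
  proof (cases "\<alpha> > 0")
    case True
    show ?thesis
      unfolding loj_iff_half_planes[OF conv_a conv_b True] P(2)[OF True] M(2)[OF True] using True by simp
  next
    case False
    then show ?thesis using P(1) by auto
  qed
  show ?thesis unfolding loj_exp_def e atLeast_def[symmetric] by simp
qed

end
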